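(* Let $A$ be a $C^{*}$-algebra. A subspace $W$ of $A$ is a matrix order unit ideal in $A$ (that is, there is $e\in W^{+}$ such that $(W,e)$ is a matrix order unit ideal of $A$) if and only if $W$ is a unital hereditary $C^{*}$-subalgebra of $A$ (that is, a hereditary $C^{*}$-subalgebra of $A$ possessing a multiplicative identity of its own, which need not be an identity of $A$).
   Context: For each $n$, $M_{n}(A)$ is the $C^{*}$-algebra of $n\times n$ matrices over $A$, with its $C^{*}$-norm $\|\cdot\|_{n}$ and its cone of positive elements $M_{n}(A)^{+}$; $A^{+}=M_{1}(A)^{+}$. For a self-adjoint linear subspace $W$ of $A$, put $M_{n}(W)^{+}=M_{n}(A)^{+}\cap M_{n}(W)_{sa}$, where $M_{n}(W)_{sa}$ is the set of self-adjoint elements of $M_n(W)$, and $W^{+}=M_{1}(W)^{+}$. Such a $W$ is called a matrix order ideal of $A$ if whenever $v\in A^{+}$ and $v\leq w$ for some $w\in W^{+}$, then $v\in W^{+}$. An element $e\in W^{+}$ is an order unit for $W$ if for each $v\in W$ there is $k>0$ with $\begin{pmatrix} ke & v\\ v^{*} & ke\end{pmatrix}\in M_{2}(W)^{+}$. Write $e^{n}=e\oplus\cdots\oplus e\in M_{n}(W)^{+}$ ($n$ copies). The pair $(W,e)$ is a matrix order unit ideal of $A$ if $W$ is a matrix order ideal of $A$, $e$ is an order unit for $W$, $W^{+}$ is proper, each $M_{n}(W)^{+}$ is Archimedean (if $v\in M_{n}(W)_{sa}$ and $w\in M_{n}(W)^{+}$ satisfy $kw+v\in M_{n}(W)^{+}$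 for all $k>0$, then $v\in M_{n}(W)^{+}$), and $e$ determines the norms of $A$ on $W$, i.e. for every $n$ and every $v\in M_{n}(W)$, $$\|v\|_{n}=\inf\left\{\lambda>0 : \begin{pmatrix}\lambda e^{n} & v\\ v^{*} & \lambda e^{n}\end{pmatrix}\in M_{2n}(W)^{+}\right\}.$$ A $C^{*}$-subalgebra $B$ of $A$ is hereditary if $0\leq a\leq b$ with $a\in A$ and $b\in B^{+}$ implies $a\in B$. *)

theory Defs
  imports Complex_Main "Jordan_Normal_Form.Matrix"
begin

section \<open>C*-algebras\<close>

text \<open>
  C*-algebras are not assumed unital, and the zero algebra is allowed. Submultiplicativity of the
  norm and completeness are inherited from \<^class>\<open>real_normed_algebra\<close> and
  \<^class>\<open>banach\<close>.
\<close>

class cstar_algebra = real_normed_algebra + banach +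
  fixes scaleC :: "complex \<Rightarrow> 'a \<Rightarrow> 'a"  (infixr \<open>*\<^sub>C\<close> 75)
    and star :: "'a \<Rightarrow> 'a"
  assumes scaleC_of_real: "complex_of_real r *\<^sub>C x = r *\<^sub>R x"
    and scaleC_add_right: "c *\<^sub>C (x + y) = c *\<^sub>C x + c *\<^sub>C y"
    and scaleC_add_left: "(c + d) *\<^sub>C x = c *\<^sub>C x + d *\<^sub>C x"
    and scaleC_scaleC: "c *\<^sub>C d *\<^sub>C x = (c * d) *\<^sub>C x"
    and mult_scaleC_left: "(c *\<^sub>C x) * y = c *\<^sub>C (x * y)"
    and mult_scaleC_right: "x * (c *\<^sub>C y) = c *\<^sub>C (x * y)"
    and norm_scaleC: "norm (c *\<^sub>C x) = cmod c * norm x"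
    and star_add: "star (x + y) = star x + star y"
    and star_scaleC: "star (c *\<^sub>C x) = cnj c *\<^sub>C star x"
    and star_mult: "star (x * y) = star y * star x"
    and star_star: "star (star x) = x"
    and cstar_identity: "norm (star x * x) = (norm x)\<^sup>2"

definition pos_elems :: "'a::cstar_algebra set" where
  "pos_elems = {star y * y | y. True}"

definition csubspace :: "'a::cstar_algebra set \<Rightarrow> bool" where
  "csubspace W \<longleftrightarrow>
     0 \<in> W \<and> (\<forall>x\<in>W. \<forall>y\<in>W. x + y \<in> W) \<and> (\<forall>c. \<forall>x\<in>W. c *\<^sub>C x \<in> W)"

definition selfadjoint_set :: "'a::cstar_algebra set \<Rightarrow> bool" where
  "selfadjoint_set W \<longleftrightarrow> (\<forall>x\<in>W. star x \<in> W)"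


section \<open>The C*-algebras of square matrices\<close>

definition mat_star :: "'a::cstar_algebra mat \<Rightarrow> 'a mat" where
  "mat_star V = map_mat star (transpose_mat V)"

definition mat_scaleC :: "complex \<Rightarrow> 'a::cstar_algebra mat \<Rightarrow> 'a mat" where
  "mat_scaleC c V = map_mat (\<lambda>x. c *\<^sub>C x) V"

definition is_cstar_norm_mat :: "nat \<Rightarrow> ('a::cstar_algebra mat \<Rightarrow> real) \<Rightarrow> bool" where
  "is_cstar_norm_mat n N \<longleftrightarrow>
     (\<forall>X\<in>carrier_mat n n. 0 \<le> N X \<and> (N X = 0 \<longleftrightarrow> X = 0\<^sub>m n n)) \<and>
     (\<forall>X\<in>carrier_mat n n. \<forall>Y\<in>carrier_mat n n. N (X + Y) \<le> N X + N Y) \<and>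
     (\<forall>c. \<forall>X\<in>carrier_mat n n. N (mat_scaleC c X) = cmod c * N X) \<and>
     (\<forall>X\<in>carrier_mat n n. \<forall>Y\<in>carrier_mat n n. N (X * Y) \<le> N X * N Y) \<and>
     (\<forall>X\<in>carrier_mat n n. N (mat_star X * X) = (N X)\<^sup>2) \<and>
     (\<forall>S :: nat \<Rightarrow> 'a mat.
        (\<forall>k. S k \<in> carrier_mat n n) \<and>
        (\<forall>\<epsilon>>0. \<exists>K. \<forall>k\<ge>K. \<forall>l\<ge>K. N (S k - S l) < \<epsilon>) \<longrightarrow>
        (\<exists>L\<in>carrier_mat n n. (\<lambda>k. N (S k - L)) \<longlonglongrightarrow> 0))"

text \<open>
  A *-algebra carries at most one norm making it a C*-algebra, and the algebra of
  \<open>n \<times> n\<close> matrices over a C*-algebra carries one. The value is taken pointwise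
  because the norm is only determined on the \<open>n \<times> n\<close> matrices.
\<close>

definition mat_norm :: "nat \<Rightarrow> 'a::cstar_algebra mat \<Rightarrow> real" where
  "mat_norm n V = (THE r. \<exists>N. is_cstar_norm_mat n N \<and> N V = r)"

definition pos_mats :: "nat \<Rightarrow> 'a::cstar_algebra mat set" where
  "pos_mats n = {mat_star Y * Y | Y. Y \<in> carrier_mat n n}"


section \<open>Matrices over a subspace\<close>

definition mats_over :: "nat \<Rightarrow> 'a set \<Rightarrow> 'a mat set" where
  "mats_over n W = {V \<in> carrier_mat n n. \<forall>i<n. \<forall>j<n. V $$ (i, j) \<in> W}"

definition sa_mats :: "nat \<Rightarrow> 'a::cstar_algebra set \<Rightarrow> 'a mat set" where
  "sa_mats n W = {V \<in> mats_over n W. mat_star V = V}"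

definition pos_mats_of :: "nat \<Rightarrow> 'a::cstar_algebra set \<Rightarrow> 'a mat set" where
  "pos_mats_of n W = pos_mats n \<inter> sa_mats n W"

text \<open>The case \<open>n = 1\<close>, with \<open>1 \<times> 1\<close> matrices identified with their entry.\<close>

definition pos_of :: "'a::cstar_algebra set \<Rightarrow> 'a set" where
  "pos_of W = pos_elems \<inter> {w \<in> W. star w = w}"

definition diag_copies :: "nat \<Rightarrow> 'a::zero \<Rightarrow> 'a mat" where
  "diag_copies n e = mat n n (\<lambda>(i, j). if i = j then e else 0)"


section \<open>Matrix order unit ideals\<close>

definition matrix_order_ideal :: "'a::cstar_algebra set \<Rightarrow> bool" where
  "matrix_order_ideal W \<longleftrightarrow>
     csubspace W \<and> selfadjoint_set W \<and>
     (\<forall>v\<in>pos_elems. \<forall>w\<in>pos_of W. w - v \<in> pos_elems \<longrightarrow> v \<in> pos_of W)"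

definition order_unit_for :: "'a::cstar_algebra set \<Rightarrow> 'a \<Rightarrow> bool" where
  "order_unit_for W e \<longleftrightarrow>
     e \<in> pos_of W \<and>
     (\<forall>v\<in>W. \<exists>k::real. k > 0 \<and>
        mat_of_rows_list 2 [[k *\<^sub>R e, v], [star v, k *\<^sub>R e]] \<in> pos_mats_of 2 W)"

definition proper_cone :: "'a::cstar_algebra set \<Rightarrow> bool" where
  "proper_cone P \<longleftrightarrow> P \<inter> uminus ` P = {0}"

definition archimedean_level :: "nat \<Rightarrow> 'a::cstar_algebra set \<Rightarrow> bool" where
  "archimedean_level n W \<longleftrightarrow>
     (\<forall>v\<in>sa_mats n W. \<forall>w\<in>pos_mats_of n W.
        (\<forall>k::real. k > 0 \<longrightarrow> mat_scaleC (complex_of_real k) w + v \<in> pos_mats_of n W) \<longrightarrow>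
        v \<in> pos_mats_of n W)"

definition determines_norms :: "'a::cstar_algebra set \<Rightarrow> 'a \<Rightarrow> bool" where
  "determines_norms W e \<longleftrightarrow>
     (\<forall>n\<ge>1. \<forall>v\<in>mats_over n W.
        mat_norm n v =
          Inf {\<mu>::real. \<mu> > 0 \<and>
             four_block_mat (diag_copies n (\<mu> *\<^sub>R e)) v (mat_star v) (diag_copies n (\<mu> *\<^sub>R e))
               \<in> pos_mats_of (2 * n) W})"

definition matrix_order_unit_ideal :: "'a::cstar_algebra set \<Rightarrow> 'a \<Rightarrow> bool" where
  "matrix_order_unit_ideal W e \<longleftrightarrow>
     matrix_order_ideal W \<and>
     order_unit_for W e \<and>
     proper_cone (pos_of W) \<and>
     (\<forall>n\<ge>1. archimedean_level n W) \<and>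
     determines_norms W e"


section \<open>Hereditary C*-subalgebras\<close>

definition cstar_subalgebra :: "'a::cstar_algebra set \<Rightarrow> bool" where
  "cstar_subalgebra B \<longleftrightarrow>
     csubspace B \<and> selfadjoint_set B \<and> (\<forall>x\<in>B. \<forall>y\<in>B. x * y \<in> B) \<and> closed B"

definition hereditary :: "'a::cstar_algebra set \<Rightarrow> bool" where
  "hereditary B \<longleftrightarrow>
     (\<forall>a\<in>pos_elems. \<forall>b\<in>pos_of B. b - a \<in> pos_elems \<longrightarrow> a \<in> B)"

definition has_own_identity :: "'a::cstar_algebra set \<Rightarrow> bool" where
  "has_own_identity B \<longleftrightarrow> (\<exists>u\<in>B. \<forall>x\<in>B. u * x = x \<and> x * u = x)"

end

(*
If (W, e) is a matrix order unit ideal, the norm formula for n = 1 says that every self-adjoint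
element of W of norm at most 1 lies below e. In particular e has norm at most 1, so e^2 <= e and
e^2 lies in W; then 2e - e^2 is an element of W of norm at most 1, so 2e - e^2 <= e and e is a
projection. Order ideals containing a projection e as order unit are equal to eAe.

Conversely let e be the identity of the hereditary subalgebra W. If v is a matrix over W of norm
at most 1 and d^2 = e - vv*, then [[e, v], [v*, e]] = Y*Y for Y = [[d, 0], [v*, e]]; this gives the
order unit and one half of the norm formula. The other half comes from evaluating the block
matrix on columns (-vx, ex).

No spectral theory is used. Square roots 1 - sqrt (1 - h) are limits of k |-> (h + k^2)/2, and
norms are estimated through the remark that commuting self-adjoint a, s with a^2 + s^2 = 1 make
a + is unitary, so that a is a contraction. The same remark shows that a *-algebra carries at
most one C*-norm.
*)
theory Submission
  imports Defs
begin

section \<open>Elementary facts\<close>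

text \<open>Two obstacles shape the proof. The algebra may lack a unit, so \<open>1 - h\<close>
  exists only as an operator: either a scalar and an element are carried side by side
  (\<open>mult_bound\<close>, \<open>nonneg\<close>), or an identity is multiplied by a further
  factor such as \<open>x\<close>, \<open>c\<close> or \<open>s\<close>, after which it holds inside
  the algebra. And \<open>mat_norm\<close> is a definite description over all C*-norms, so it has a
  value only once existence and uniqueness are known; uniqueness compares two unknown norms, so
  matrix square roots are built from the axioms of an arbitrary one. Positivity of \<open>a\<close>
  means that \<open>t - a\<close> has norm at most \<open>t\<close> for some \<open>t\<close>. Sums
  are then immediate, and the work moves to showing that \<open>star y * y\<close> is positive. The
  equality of \<open>W\<close> with the corner has two halves. If \<open>0 <= v <= k e\<close> with
  \<open>e\<close> a projection, compressing by \<open>1 - e\<close> makes \<open>v\<close> both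
  positive and negative, so \<open>v\<close> lies in the corner. If \<open>a\<close> is a
  self-adjoint contraction, \<open>e a e\<close> lies between \<open>- e\<close> and
  \<open>e\<close>, so it belongs to the ideal.\<close>

lemma scaleC_simps [simp]:
  fixes x :: "'a::cstar_algebra"
  shows "0 *\<^sub>C x = 0" "1 *\<^sub>C x = x" "c *\<^sub>C (0::'a) = 0"
    "(- c) *\<^sub>C x = - (c *\<^sub>C x)" "c *\<^sub>C (- x) = - (c *\<^sub>C x)"
proof -
  show 0: "0 *\<^sub>C x = 0" using scaleC_of_real[of 0 x] by simp
  show "1 *\<^sub>C x = x" using scaleC_of_real[of 1 x] by simp
  show 1: "c *\<^sub>C (0::'a) = 0" using scaleC_add_right[of c 0 "0::'a"] by simp
  show "(- c) *\<^sub>C x = - (c *\<^sub>C x)"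
    using scaleC_add_left[of "-c" c x] 0 by (simp add: eq_neg_iff_add_eq_0)
  show "c *\<^sub>C (- x) = - (c *\<^sub>C x)"
    using scaleC_add_right[of c "-x" x] 1 by (simp add: eq_neg_iff_add_eq_0)
qed

lemma scaleC_diff_right: "c *\<^sub>C (x - y) = c *\<^sub>C x - c *\<^sub>C (y::'a::cstar_algebra)"
  using scaleC_add_right[of c x "-y"] by simp

lemma scaleC_sum: "c *\<^sub>C (\<Sum>i\<in>I. f i) = (\<Sum>i\<in>I. c *\<^sub>C (f i :: 'a::cstar_algebra))"
  by (induction I rule: infinite_finite_induct) (auto simp: scaleC_add_right)

lemma star_scaleR [simp]: "star (r *\<^sub>R x) = r *\<^sub>R star (x::'a::cstar_algebra)"
  by (metis scaleC_of_real star_scaleC complex_cnj_complex_of_real)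

lemma star_zero [simp]: "star 0 = (0::'a::cstar_algebra)"
  using star_scaleR[of 0] by simp

lemma star_minus [simp]: "star (- x) = - star (x::'a::cstar_algebra)"
  using star_scaleR[of "-1"] by simp

lemma star_diff: "star (x - y) = star x - star (y::'a::cstar_algebra)"
  using star_add[of x "-y"] by simp

declare star_star [simp]

lemma star_sum: "star (\<Sum>i\<in>I. f i) = (\<Sum>i\<in>I. star (f i :: 'a::cstar_algebra))"
  by (induction I rule: infinite_finite_induct) (auto simp: star_add)

lemmas star_simps = star_add star_diff star_mult star_scaleC

lemma norm_star [simp]: "norm (star x) = norm (x::'a::cstar_algebra)"
proof -
  have "norm y \<le> norm (star y)" for y :: 'a
  proof (cases "y = 0")
    case False
    have "norm y * norm y \<le> norm (star y) * norm y"
      using norm_mult_ineq[of "star y" y] by (simp add: cstar_identity power2_eq_square)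
    then show ?thesis using False by simp
  qed simp
  from this[of x] this[of "star x"] show ?thesis by simp
qed

lemma star_mult_self_eq_0: "star x * x = 0 \<longleftrightarrow> x = (0::'a::cstar_algebra)"
  using cstar_identity[of x] by auto

lemma selfadjoint_square_eq_0:
  "star x = x \<Longrightarrow> x * x = 0 \<Longrightarrow> x = (0::'a::cstar_algebra)"
  by (metis star_mult_self_eq_0)

lemma bounded_linear_star: "bounded_linear (star :: 'a::cstar_algebra \<Rightarrow> 'a)"
  by (intro bounded_linear_intro[where K = 1]) (auto simp: star_add)

lemmas tendsto_star = bounded_linear.tendsto[OF bounded_linear_star]

text \<open>Both X + iY and X - iY satisfy the C*-identity with the same right-hand side.\<close>

lemma norm_le_sum_of_squares:
  fixes X Y :: "'a::cstar_algebra"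
  assumes "star X * Y = star Y * X"
  shows "(norm X)\<^sup>2 \<le> norm (star X * X + star Y * Y)"
proof -
  define S where "S = star X * X + star Y * Y"
  have *: "norm (X + c *\<^sub>C Y) ^ 2 = norm S" if "c = \<i> \<or> c = - \<i>" for c
  proof -
    have "star (X + c *\<^sub>C Y) * (X + c *\<^sub>C Y) = S"
      using that assms
      by (auto simp: S_def star_simps mult_scaleC_left mult_scaleC_right scaleC_scaleC
          algebra_simps scaleC_add_right)
    then show ?thesis using cstar_identity by metis
  qed
  have "2 * norm X = norm ((X + \<i> *\<^sub>C Y) + (X + (-\<i>) *\<^sub>C Y))"
    by (simp add: scaleR_2[symmetric])
  also have "\<dots> \<le> norm (X + \<i> *\<^sub>C Y) + norm (X + (-\<i>) *\<^sub>C Y)"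
    by (rule norm_triangle_ineq)
  also have "norm (X + \<i> *\<^sub>C Y) = sqrt (norm S)"
    using *[of \<i>] by (intro real_sqrt_unique[symmetric]) auto
  also have "norm (X + (-\<i>) *\<^sub>C Y) = sqrt (norm S)"
    using *[of "-\<i>"] by (intro real_sqrt_unique[symmetric]) auto
  finally have "norm X \<le> sqrt (norm S)" by simp
  then show ?thesis
    unfolding S_def by (simp add: real_le_rsqrt sqrt_ge_absD)
qed

section \<open>Square roots\<close>

text \<open>
  The iteration \<open>k \<mapsto> (h + k\<^sup>2)/2\<close> started at \<open>0\<close> converges to
  \<open>1 - sqrt (1 - h)\<close> whenever \<open>h\<close> has norm at most \<open>1\<close>, with the scalar iteration for
  \<open>h = 1\<close> as a majorant. To apply it to \<open>h = \<alpha> + g\<close> in the unitization, the scalar part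
  and the part in the algebra are recorded separately; the norm of \<open>\<alpha> + g\<close> is that of
  the multiplication operator.
\<close>

primrec scalar_iter :: "real \<Rightarrow> nat \<Rightarrow> real" where
  "scalar_iter \<alpha> 0 = 0"
| "scalar_iter \<alpha> (Suc n) = (\<alpha> + (scalar_iter \<alpha> n)\<^sup>2) / 2"

primrec alg_iter :: "real \<Rightarrow> 'a::cstar_algebra \<Rightarrow> nat \<Rightarrow> 'a" where
  "alg_iter \<alpha> g 0 = 0"
| "alg_iter \<alpha> g (Suc n) = (1/2) *\<^sub>R
     (g + (2 * scalar_iter \<alpha> n) *\<^sub>R alg_iter \<alpha> g n + alg_iter \<alpha> g n * alg_iter \<alpha> g n)"

text \<open>This bounds the operator sending \<open>x\<close> to \<open>(alpha + g) x\<close>, so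
  the unitization itself never has to be formed. If the algebra has a unit, different pairs may give
  the same operator; the bound sees only the operator.\<close>

definition mult_bound :: "real \<Rightarrow> 'a::cstar_algebra \<Rightarrow> real \<Rightarrow> bool" where
  "mult_bound \<alpha> g K \<longleftrightarrow> (\<forall>x. norm (\<alpha> *\<^sub>R x + g * x) \<le> K * norm x)"

abbreviation majorant :: "nat \<Rightarrow> real" where
  "majorant \<equiv> scalar_iter 1"

lemma majorant_bounds: "0 \<le> majorant n" "majorant n \<le> 1"
proof -
  have "0 \<le> majorant n \<and> majorant n \<le> 1"
    by (induction n) (auto simp: power_le_one)
  then show "0 \<le> majorant n" "majorant n \<le> 1" by auto
qed

lemma majorant_step: "majorant n \<le> majorant (Suc n)"
  using sum_squares_bound[of "majorant n" 1] by simp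

lemma convergent_majorant: "convergent majorant"
proof -
  have "incseq majorant" using majorant_step by (rule incseq_SucI)
  then obtain L where "majorant \<longlonglongrightarrow> L"
    using incseq_convergent[of majorant 1] majorant_bounds(2) by blast
  then show ?thesis by (auto simp: convergent_def)
qed

text \<open>For consecutive iterates \<open>l\<close> and \<open>l'\<close> the next increment is
  \<open>(l' - l) * (l' + l) / 2\<close>. Both factors are dominated by those of the majorant, which
  factors in the same way, so the estimate passes from step to step.\<close>

lemma scalar_iter_bound:
  assumes "\<bar>\<alpha>\<bar> \<le> 1"
  shows "\<bar>scalar_iter \<alpha> n\<bar> \<le> majorant n"
    and "\<bar>scalar_iter \<alpha> (Suc n) - scalar_iter \<alpha> n\<bar> \<le> majorant (Suc n) - majorant n"
proof -
  have b: "\<bar>scalar_iter \<alpha> n\<bar> \<le> majorant n" for n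
  proof (induction n)
    case (Suc n)
    have "\<bar>scalar_iter \<alpha> n\<bar>\<^sup>2 \<le> (majorant n)\<^sup>2"
      using Suc by (intro power_mono) auto
    then have "(scalar_iter \<alpha> n)\<^sup>2 \<le> (majorant n)\<^sup>2" by simp
    then show ?case
      using assms abs_triangle_ineq[of \<alpha> "(scalar_iter \<alpha> n)\<^sup>2"] by simp
  qed simp
  show "\<bar>scalar_iter \<alpha> n\<bar> \<le> majorant n" by (rule b)
  show "\<bar>scalar_iter \<alpha> (Suc n) - scalar_iter \<alpha> n\<bar> \<le> majorant (Suc n) - majorant n"
  proof (induction n)
    case (Suc n)
    let ?l = "scalar_iter \<alpha>" and ?t = majorant
    have "?l (Suc (Suc n)) - ?l (Suc n) = (?l (Suc n) - ?l n) * (?l (Suc n) + ?l n) / 2"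
      by (simp add: field_simps power2_eq_square)
    also have "\<bar>\<dots>\<bar> \<le> (?t (Suc n) - ?t n) * (?t (Suc n) + ?t n) / 2"
      unfolding abs_mult abs_divide using Suc b[of n] b[of "Suc n"] majorant_step[of n]
      by (auto intro!: mult_mono divide_right_mono simp del: scalar_iter.simps)
    also have "\<dots> = ?t (Suc (Suc n)) - ?t (Suc n)"
      by (simp add: field_simps power2_eq_square)
    finally show ?case .
  qed (use assms in simp)
qed

lemma majorised_increment:
  fixes c :: "nat \<Rightarrow> 'a::real_normed_vector"
  assumes step: "\<And>n. norm (c (Suc n) - c n) \<le> K * (majorant (Suc n) - majorant n)"
  shows "norm (c (n + m) - c n) \<le> K * (majorant (n + m) - majorant n)"
proof (induction m)
  case (Suc m)
  have "norm (c (n + Suc m) - c n) \<le> norm (c (Suc (n + m)) - c (n + m)) + norm (c (n + m) - c n)"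
    using norm_triangle_ineq[of "c (Suc (n + m)) - c (n + m)" "c (n + m) - c n"] by simp
  with Suc step[of "n + m"] show ?case
    by (simp add: right_diff_distrib)
qed simp

lemma majorant_Cauchy:
  assumes "\<epsilon> > 0"
  shows "\<exists>M. \<forall>n\<ge>M. \<forall>m. majorant (n + m) - majorant n < \<epsilon>"
proof -
  have "Cauchy majorant" using convergent_majorant by (simp add: Cauchy_convergent_iff)
  then obtain M where "\<forall>m\<ge>M. \<forall>n\<ge>M. norm (majorant m - majorant n) < \<epsilon>"
    using CauchyD[OF _ assms] by blast
  then show ?thesis by (intro exI[of _ M]) (smt (verit) real_norm_def trans_le_add1)
qed

lemma convergent_if_majorised:
  fixes c :: "nat \<Rightarrow> 'a::banach"
  assumes step: "\<And>n. norm (c (Suc n) - c n) \<le> K * (majorant (Suc n) - majorant n)"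
    and "K > 0"
  shows "convergent c"
proof -
  have "Cauchy c"
  proof (rule CauchyI')
    fix e :: real assume "e > 0"
    with \<open>K > 0\<close> have "e / K > 0" by simp
    from majorant_Cauchy[OF this] obtain M
      where M: "\<And>n m. n \<ge> M \<Longrightarrow> majorant (n + m) - majorant n < e / K" by blast
    have "norm (c m - c n) < e" if "m \<ge> M" "n > m" for m n
    proof -
      obtain d where d: "n = m + d" using \<open>n > m\<close> less_imp_add_positive by blast
      have "norm (c n - c m) \<le> K * (majorant n - majorant m)"
        unfolding d by (rule majorised_increment[OF step])
      also have "\<dots> < K * (e / K)"
        unfolding d using M[OF \<open>m \<ge> M\<close>] \<open>K > 0\<close> by (intro mult_strict_left_mono)
      finally show ?thesis using \<open>K > 0\<close> by (simp add: norm_minus_commute)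
    qed
    then show "\<exists>M. \<forall>m\<ge>M. \<forall>n>m. dist (c m) (c n) < e"
      unfolding dist_norm by blast
  qed
  then show ?thesis by (simp add: Cauchy_convergent_iff)
qed

text \<open>Take \<open>x = star c\<close>: the C*-identity turns the left side into the square of
  the norm of \<open>c\<close>. Testing at the adjoint replaces testing at a unit.\<close>

lemma mult_bound_norm_le:
  assumes "mult_bound 0 c K" "K \<ge> 0"
  shows "norm c \<le> K"
proof (cases "c = 0")
  case False
  have "norm c * norm c = norm (star (star c) * star c)"
    by (simp only: cstar_identity norm_star power2_eq_square)
  also have "\<dots> \<le> K * norm c"
    using assms(1) unfolding mult_bound_def by (metis add_0 norm_star scale_zero_left star_star)
  finally show ?thesis using False by simp
qed (use assms in simp)

lemma mult_bound_norm: "mult_bound 0 c (norm c)"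
  by (simp add: mult_bound_def norm_mult_ineq)

lemma mult_bound_add:
  assumes "mult_bound l c K" "mult_bound m d L"
  shows "mult_bound (l + m) (c + d) (K + L)"
  unfolding mult_bound_def
proof
  fix x :: 'a
  have "norm ((l + m) *\<^sub>R x + (c + d) * x) \<le> norm (l *\<^sub>R x + c * x) + norm (m *\<^sub>R x + d * x)"
    using norm_triangle_ineq[of "l *\<^sub>R x + c * x" "m *\<^sub>R x + d * x"]
    by (simp add: algebra_simps)
  also have "\<dots> \<le> K * norm x + L * norm x"
    using assms unfolding mult_bound_def by (intro add_mono) auto
  finally show "norm ((l + m) *\<^sub>R x + (c + d) * x) \<le> (K + L) * norm x"
    by (simp add: algebra_simps)
qed

lemma mult_bound_scaleR:
  assumes "mult_bound l c K"
  shows "mult_bound (r * l) (r *\<^sub>R c) (\<bar>r\<bar> * K)"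
  unfolding mult_bound_def
proof
  fix x :: 'a
  have "norm ((r * l) *\<^sub>R x + (r *\<^sub>R c) * x) = \<bar>r\<bar> * norm (l *\<^sub>R x + c * x)"
    unfolding norm_scaleR[symmetric] by (simp add: algebra_simps)
  also have "\<dots> \<le> \<bar>r\<bar> * (K * norm x)"
    using assms unfolding mult_bound_def by (intro mult_left_mono) auto
  finally show "norm ((r * l) *\<^sub>R x + (r *\<^sub>R c) * x) \<le> (\<bar>r\<bar> * K) * norm x"
    by (simp add: algebra_simps)
qed

lemma mult_bound_mult:
  assumes "mult_bound l c K" "mult_bound m d L" "K \<ge> 0"
  shows "mult_bound (l * m) (l *\<^sub>R d + m *\<^sub>R c + c * d) (K * L)"
  unfolding mult_bound_def
proof
  fix x :: 'a
  define y where "y = m *\<^sub>R x + d * x"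
  have "norm (l *\<^sub>R y + c * y) \<le> K * norm y"
    using assms unfolding mult_bound_def by auto
  also have "\<dots> \<le> K * (L * norm x)"
    using assms unfolding mult_bound_def y_def by (intro mult_left_mono) auto
  also have "l *\<^sub>R y + c * y = (l * m) *\<^sub>R x + (l *\<^sub>R d + m *\<^sub>R c + c * d) * x"
    by (simp add: y_def algebra_simps)
  finally show "norm ((l * m) *\<^sub>R x + (l *\<^sub>R d + m *\<^sub>R c + c * d) * x) \<le> K * L * norm x"
    by (simp add: algebra_simps)
qed

text \<open>The induction for the scalars, carried out for pairs. Without appealing to
  commutativity, the difference of squares is split as
  \<open>k' k' - k k = k' (k' - k) + (k' - k) k\<close>.\<close>

lemma alg_iter_bound:
  fixes g :: "'a::cstar_algebra"
  assumes "mult_bound \<alpha> g 1"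
  shows "mult_bound (scalar_iter \<alpha> n) (alg_iter \<alpha> g n) (majorant n)"
    and "mult_bound (scalar_iter \<alpha> (Suc n) - scalar_iter \<alpha> n)
           (alg_iter \<alpha> g (Suc n) - alg_iter \<alpha> g n) (majorant (Suc n) - majorant n)"
proof -
  let ?l = "scalar_iter \<alpha>" and ?c = "alg_iter \<alpha> g" and ?t = majorant
  have two: "(2 * r) *\<^sub>R x = r *\<^sub>R x + r *\<^sub>R x" for r and x :: 'a
    by (simp only: mult_2 scaleR_add_left)
  have b: "mult_bound (?l n) (?c n) (?t n)" for n
  proof (induction n)
    case (Suc n)
    from mult_bound_mult[OF Suc Suc majorant_bounds(1)]
    have "mult_bound (?l n * ?l n) (?l n *\<^sub>R ?c n + ?l n *\<^sub>R ?c n + ?c n * ?c n) (?t n * ?t n)" .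
    note 1 = mult_bound_scaleR[OF mult_bound_add[OF assms this], of "1/2"]
    have "1/2 * (\<alpha> + ?l n * ?l n) = ?l (Suc n)" "\<bar>1/2\<bar> * (1 + ?t n * ?t n) = ?t (Suc n)"
      by (simp_all add: power2_eq_square)
    moreover have "(1/2) *\<^sub>R (g + (?l n *\<^sub>R ?c n + ?l n *\<^sub>R ?c n + ?c n * ?c n)) = ?c (Suc n)"
      by (simp add: two add.assoc)
    ultimately show ?case using 1 by (simp only:)
  qed (simp add: mult_bound_def)
  show "mult_bound (?l n) (?c n) (?t n)" by (rule b)
  show "mult_bound (?l (Suc n) - ?l n) (?c (Suc n) - ?c n) (?t (Suc n) - ?t n)"
  proof (induction n)
    case 0
    then show ?case using mult_bound_scaleR[OF assms, of "1/2"] by simp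
  next
    case (Suc n)
    let ?dl = "?l (Suc n) - ?l n" and ?dc = "?c (Suc n) - ?c n" and ?dt = "?t (Suc n) - ?t n"
    note 1 = mult_bound_mult[OF b[of "Suc n"] Suc majorant_bounds(1)]
    have "?dt \<ge> 0" using majorant_step[of n] by simp
    note 2 = mult_bound_mult[OF Suc b[of n] this]
    note 3 = mult_bound_scaleR[OF mult_bound_add[OF 1 2], of "1/2"]
    have l: "1/2 * (?l (Suc n) * ?dl + ?dl * ?l n) = ?l (Suc (Suc n)) - ?l (Suc n)"
      and t: "\<bar>1/2\<bar> * (?t (Suc n) * ?dt + ?dt * ?t n) = ?t (Suc (Suc n)) - ?t (Suc n)"
      by (simp_all add: field_simps power2_eq_square)
    have "alg_iter \<alpha> g (Suc (Suc n)) - alg_iter \<alpha> g (Suc n) = (1/2) *\<^sub>R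
      ((g + (2 * ?l (Suc n)) *\<^sub>R ?c (Suc n) + ?c (Suc n) * ?c (Suc n))
        - (g + (2 * ?l n) *\<^sub>R ?c n + ?c n * ?c n))"
      by (simp only: alg_iter.simps(2)[of \<alpha> g "Suc n"] alg_iter.simps(2)[of \<alpha> g n]
          scaleR_diff_right)
    also have "\<dots> = (1/2) *\<^sub>R (?l (Suc n) *\<^sub>R ?dc + ?dl *\<^sub>R ?c (Suc n) + ?c (Suc n) * ?dc
        + (?dl *\<^sub>R ?c n + ?l n *\<^sub>R ?dc + ?dc * ?c n))"
      unfolding two
      by (simp add: algebra_simps del: scalar_iter.simps alg_iter.simps)
    finally show ?case using 3 unfolding l t by (simp only:)
  qed
qed

lemma scalar_iter_convergent:
  assumes "\<bar>\<alpha>\<bar> \<le> 1"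
  shows "convergent (scalar_iter \<alpha>)"
proof (rule convergent_if_majorised[where K = 1])
  fix n show "norm (scalar_iter \<alpha> (Suc n) - scalar_iter \<alpha> n) \<le> 1 * (majorant (Suc n) - majorant n)"
    unfolding real_norm_def mult_1 by (rule scalar_iter_bound(2)[OF assms])
qed simp

lemma alg_iter_convergent:
  assumes "\<bar>\<alpha>\<bar> \<le> 1" "mult_bound \<alpha> g 1"
  shows "convergent (alg_iter \<alpha> g)"
proof (rule convergent_if_majorised[where K = 2])
  fix n
  let ?l = "scalar_iter \<alpha>" and ?c = "alg_iter \<alpha> g" and ?t = majorant
  \<comment> \<open>The known bound concerns scalar plus element. Adding the negated scalar
    increment, which obeys the same majorant, leaves the element alone; this is the factor 2 in
    \<open>K\<close>.\<close>
  have "mult_bound (-(?l (Suc n) - ?l n)) 0 (?t (Suc n) - ?t n)"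
    using scalar_iter_bound(2)[OF assms(1), of n]
    by (auto simp: mult_bound_def abs_minus_commute intro!: mult_right_mono
        simp del: scalar_iter.simps)
  from mult_bound_add[OF alg_iter_bound(2)[OF assms(2), of n] this]
  have "mult_bound 0 (?c (Suc n) - ?c n) (2 * (?t (Suc n) - ?t n))"
    by (simp del: scalar_iter.simps alg_iter.simps add: algebra_simps)
  then show "norm (?c (Suc n) - ?c n) \<le> 2 * (?t (Suc n) - ?t n)"
    by (rule mult_bound_norm_le) (use majorant_step[of n] in simp)
qed simp

section \<open>Limits of the iteration\<close>

definition scalar_lim :: "real \<Rightarrow> real" where
  "scalar_lim \<alpha> = lim (scalar_iter \<alpha>)"

definition alg_lim :: "real \<Rightarrow> 'a::cstar_algebra \<Rightarrow> 'a" where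
  "alg_lim \<alpha> g = lim (alg_iter \<alpha> g)"

lemma scalar_iter_tendsto:
  "\<bar>\<alpha>\<bar> \<le> 1 \<Longrightarrow> scalar_iter \<alpha> \<longlonglongrightarrow> scalar_lim \<alpha>"
  using scalar_iter_convergent unfolding scalar_lim_def by (simp add: convergent_LIMSEQ_iff)

lemma alg_iter_tendsto:
  "\<bar>\<alpha>\<bar> \<le> 1 \<Longrightarrow> mult_bound \<alpha> g 1 \<Longrightarrow> alg_iter \<alpha> g \<longlonglongrightarrow> alg_lim \<alpha> g"
  using alg_iter_convergent unfolding alg_lim_def by (simp add: convergent_LIMSEQ_iff)

lemma scalar_lim_eq:
  assumes "\<bar>\<alpha>\<bar> \<le> 1"
  shows "2 * scalar_lim \<alpha> = \<alpha> + (scalar_lim \<alpha>)\<^sup>2"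
proof -
  have "(\<lambda>n. scalar_iter \<alpha> (Suc n)) \<longlonglongrightarrow> (\<alpha> + (scalar_lim \<alpha>)\<^sup>2) / 2"
    unfolding scalar_iter.simps by (intro tendsto_intros scalar_iter_tendsto assms) simp
  from LIMSEQ_unique[OF this LIMSEQ_Suc[OF scalar_iter_tendsto[OF assms]]]
  show ?thesis by simp
qed

lemma scalar_lim_0 [simp]: "scalar_lim 0 = 0"
proof -
  have "scalar_iter 0 n = 0" for n by (induction n) auto
  then have "scalar_iter 0 = (\<lambda>_. 0)" by auto
  then show ?thesis by (simp add: scalar_lim_def)
qed

text \<open>The fixed-point equation has the double root 1. Hence \<open>1 - k\<close> has no scalar
  part for \<open>alpha = 1\<close>, and the square root of an element stays in the algebra.\<close>

lemma scalar_lim_1 [simp]: "scalar_lim 1 = 1"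
proof -
  have "(scalar_lim 1 - 1)\<^sup>2 = 0"
    using scalar_lim_eq[of 1] by (simp add: power2_eq_square algebra_simps)
  then show ?thesis by simp
qed

lemma alg_lim_eq:
  fixes g :: "'a::cstar_algebra"
  assumes "\<bar>\<alpha>\<bar> \<le> 1" "mult_bound \<alpha> g 1"
  shows "2 *\<^sub>R alg_lim \<alpha> g
    = g + (2 * scalar_lim \<alpha>) *\<^sub>R alg_lim \<alpha> g + alg_lim \<alpha> g * alg_lim \<alpha> g" (is "_ = ?r")
proof -
  have "(\<lambda>n. alg_iter \<alpha> g (Suc n)) \<longlonglongrightarrow> (1/2) *\<^sub>R ?r"
    unfolding alg_iter.simps
    by (intro tendsto_intros scalar_iter_tendsto alg_iter_tendsto assms)
  note arg_cong[OF LIMSEQ_unique[OF this LIMSEQ_Suc[OF alg_iter_tendsto[OF assms]]], of "scaleR 2"]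
  moreover have "2 *\<^sub>R (1/2) *\<^sub>R x = x" for x :: 'a by simp
  ultimately show ?thesis by (simp only:)
qed

text \<open>The iterates are polynomials in \<open>g\<close>, so the relation passes to them and
  then to the limits. Two elements \<open>g\<close> and \<open>g'\<close> are allowed for the sake
  of \<open>nonneg_intertwine_square\<close>; \<open>g = g'\<close> gives commutation.\<close>

lemma alg_lim_intertwine:
  assumes "\<bar>\<alpha>\<bar> \<le> 1" "mult_bound \<alpha> g 1" "mult_bound \<alpha> g' 1" "g * z = z * g'"
  shows "alg_lim \<alpha> g * z = z * alg_lim \<alpha> g'"
proof -
  let ?c = "alg_iter \<alpha> g" and ?c' = "alg_iter \<alpha> g'"
  have "?c n * z = z * ?c' n" for n
  proof (induction n)
    case (Suc n)
    have "?c n * ?c n * z = z * (?c' n * ?c' n)"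
      by (metis Suc mult.assoc)
    then show ?case
      by (simp only: alg_iter.simps distrib_left distrib_right mult_scaleR_left mult_scaleR_right
          Suc assms(4))
  qed simp
  then have "(\<lambda>n. ?c n * z) = (\<lambda>n. z * ?c' n)" by (rule ext)
  moreover have "(\<lambda>n. ?c n * z) \<longlonglongrightarrow> alg_lim \<alpha> g * z"
    by (intro tendsto_intros alg_iter_tendsto assms)
  moreover have "(\<lambda>n. z * ?c' n) \<longlonglongrightarrow> z * alg_lim \<alpha> g'"
    by (intro tendsto_intros alg_iter_tendsto assms)
  ultimately show ?thesis by (metis LIMSEQ_unique)
qed

lemma alg_lim_selfadjoint:
  assumes "\<bar>\<alpha>\<bar> \<le> 1" "mult_bound \<alpha> g 1" "star g = g"
  shows "star (alg_lim \<alpha> g) = alg_lim \<alpha> g"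
proof -
  have "star (alg_iter \<alpha> g n) = alg_iter \<alpha> g n" for n
    by (induction n) (simp_all add: star_simps assms(3))
  then have "(\<lambda>n. star (alg_iter \<alpha> g n)) = alg_iter \<alpha> g" by (rule ext)
  with tendsto_star[OF alg_iter_tendsto[OF assms(1,2)]]
  have "alg_iter \<alpha> g \<longlonglongrightarrow> star (alg_lim \<alpha> g)" by (simp only:)
  then show ?thesis by (rule LIMSEQ_unique[OF _ alg_iter_tendsto[OF assms(1,2)]])
qed

text \<open>With \<open>alpha = 1\<close> this bound is the witness \<open>t = 1\<close> that makes
  \<open>psqrt\<close> positive.\<close>

lemma alg_lim_bound:
  assumes "\<bar>\<alpha>\<bar> \<le> 1" "mult_bound \<alpha> g 1"
  shows "mult_bound (scalar_lim \<alpha>) (alg_lim \<alpha> g) 1"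
  unfolding mult_bound_def
proof
  fix x
  show "norm (scalar_lim \<alpha> *\<^sub>R x + alg_lim \<alpha> g * x) \<le> 1 * norm x"
  proof (rule LIMSEQ_le_const2)
    show "(\<lambda>n. norm (scalar_iter \<alpha> n *\<^sub>R x + alg_iter \<alpha> g n * x))
        \<longlonglongrightarrow> norm (scalar_lim \<alpha> *\<^sub>R x + alg_lim \<alpha> g * x)"
      by (intro tendsto_intros scalar_iter_tendsto alg_iter_tendsto assms)
    have "norm (scalar_iter \<alpha> n *\<^sub>R x + alg_iter \<alpha> g n * x) \<le> 1 * norm x" for n
    proof -
      have "norm (scalar_iter \<alpha> n *\<^sub>R x + alg_iter \<alpha> g n * x) \<le> majorant n * norm x"
        using alg_iter_bound(1)[OF assms(2)] unfolding mult_bound_def by blast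
      also have "\<dots> \<le> 1 * norm x" by (intro mult_right_mono majorant_bounds norm_ge_zero)
      finally show ?thesis .
    qed
    then show "\<exists>N. \<forall>n\<ge>N. norm (scalar_iter \<alpha> n *\<^sub>R x + alg_iter \<alpha> g n * x) \<le> 1 * norm x"
      by blast
  qed
qed

section \<open>The positive cone\<close>

text \<open>\<open>k\<close> stands for \<open>1 - sqrt (1 - h)\<close>, which lies in the algebra
  although \<open>1\<close> and \<open>1 - h\<close> need not; the second equation is
  \<open>(1 - k)^2 = 1 - h\<close> with the unit cancelled.\<close>

lemma one_minus_sqrt:
  fixes h :: "'a::cstar_algebra"
  assumes "star h = h" "norm h \<le> 1"
  obtains k where "star k = k" "k + k = h + k * k" "\<And>z. h * z = z * h \<Longrightarrow> k * z = z * k"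
proof
  have b: "mult_bound 0 h 1"
    using assms(2) mult_bound_norm[of h] unfolding mult_bound_def
    by (meson mult_right_mono norm_ge_zero order_trans)
  show "star (alg_lim 0 h) = alg_lim 0 h"
    by (rule alg_lim_selfadjoint[OF _ b assms(1)]) simp
  show "alg_lim 0 h + alg_lim 0 h = h + alg_lim 0 h * alg_lim 0 h"
    using alg_lim_eq[OF _ b] by (simp add: scaleR_2)
  show "alg_lim 0 h * z = z * alg_lim 0 h" if "h * z = z * h" for z
    by (rule alg_lim_intertwine[OF _ b b that]) simp
qed

text \<open>With \<open>s = 1 - k\<close> one has \<open>a^2 + s^2 = 1\<close>, and \<open>s\<close>
  commutes with \<open>a\<close>. Applying \<open>norm_le_sum_of_squares\<close> to
  \<open>s x\<close> and \<open>a x\<close> shows that \<open>s\<close> is a contraction; then so is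
  \<open>s^2 = 1 - a^2\<close>.\<close>

lemma square_bound:
  fixes a :: "'a::cstar_algebra"
  assumes "star a = a" "norm a \<le> 1"
  shows "mult_bound 1 (- (a * a)) 1"
proof -
  have "norm (a * a) \<le> 1"
    using assms norm_mult_ineq[of a a] mult_le_one[of "norm a" "norm a"] by simp
  then obtain k where k: "star k = k" "k + k = a * a + k * k"
      "\<And>z. a * a * z = z * (a * a) \<Longrightarrow> k * z = z * k"
    using one_minus_sqrt[of "a * a"] assms(1) by (metis star_mult)
  have comm: "k * a = a * k" by (rule k(3)) (simp add: mult.assoc)
  have "mult_bound 1 (- k) 1"
    unfolding mult_bound_def
  proof
    fix x :: 'a
    define X Y where "X = x - k * x" and "Y = a * x"
    have "star X * Y = star Y * X"
      unfolding X_def Y_def star_simps k(1) assms(1)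
      by (simp add: algebra_simps) (metis comm mult.assoc)
    then have "(norm X)\<^sup>2 \<le> norm (star X * X + star Y * Y)"
      by (rule norm_le_sum_of_squares)
    also have "star X * X + star Y * Y = star x * (x - (k + k) * x + (a * a + k * k) * x)"
      unfolding X_def Y_def star_simps k(1) assms(1) by (simp add: algebra_simps)
    also have "\<dots> = star x * x" unfolding k(2) by simp
    finally have "(norm X)\<^sup>2 \<le> (norm x)\<^sup>2" by (simp add: cstar_identity)
    then show "norm (1 *\<^sub>R x + - k * x) \<le> 1 * norm x"
      by (simp add: X_def power2_le_iff_abs_le)
  qed
  from mult_bound_mult[OF this this]
  have "mult_bound 1 (k * k - (k + k)) 1" by (simp add: algebra_simps)
  then show ?thesis unfolding k(2) by simp
qed

text \<open>
  In the unitization, a self-adjoint \<open>a\<close> is positive if and only if \<open>t - a\<close> has norm at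
  most \<open>t\<close> for some \<open>t > 0\<close>.
\<close>

definition nonneg :: "'a::cstar_algebra \<Rightarrow> bool" where
  "nonneg a \<longleftrightarrow> star a = a \<and> (\<exists>t>0. mult_bound t (- a) t)"

lemma nonneg_selfadjoint: "nonneg a \<Longrightarrow> star a = a"
  by (simp add: nonneg_def)

lemma nonneg_0 [simp]: "nonneg 0"
  unfolding nonneg_def by (auto simp: mult_bound_def intro!: exI[of _ 1])

lemma nonneg_add: "nonneg a \<Longrightarrow> nonneg b \<Longrightarrow> nonneg (a + b)"
proof -
  assume ab: "nonneg a" "nonneg b"
  then obtain s t where "s > 0" "t > 0" "mult_bound s (- a) s" "mult_bound t (- b) t"
    by (auto simp: nonneg_def)
  with mult_bound_add[of s "-a" s t "-b" t] ab show ?thesis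
    by (auto simp: nonneg_def star_add intro!: exI[of _ "s + t"])
qed

lemma nonneg_scaleR:
  assumes "nonneg a" "r \<ge> 0"
  shows "nonneg (r *\<^sub>R a)"
proof (cases "r = 0")
  case False
  obtain t where "t > 0" "mult_bound t (- a) t" using assms by (auto simp: nonneg_def)
  with mult_bound_scaleR[of t "-a" t r] False assms show ?thesis
    by (auto simp: nonneg_def intro!: exI[of _ "r * t"])
qed simp

lemma nonneg_sum: "(\<And>i. i \<in> I \<Longrightarrow> nonneg (f i)) \<Longrightarrow> nonneg (\<Sum>i\<in>I. f i)"
  by (induction I rule: infinite_finite_induct) (auto intro: nonneg_add)

lemma nonneg_square_bound:
  fixes a :: "'a::cstar_algebra"
  assumes "star a = a" "t > 0" "(norm a)\<^sup>2 \<le> t"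
  shows "mult_bound t (- (a * a)) t"
proof -
  define b where "b = (1 / sqrt t) *\<^sub>R a"
  have "norm a \<le> sqrt t" using assms by (simp add: real_le_rsqrt)
  then have "norm b \<le> 1" using assms by (simp add: b_def)
  then have "mult_bound 1 (- (b * b)) 1"
    by (intro square_bound) (simp_all add: b_def assms)
  moreover have "b * b = (1 / t) *\<^sub>R (a * a)"
    using assms by (simp add: b_def)
  ultimately show ?thesis
    using mult_bound_scaleR[of 1 "- (b * b)" 1 t] assms by simp
qed

lemma nonneg_square:
  assumes "star a = a"
  shows "nonneg (a * a)"
proof -
  \<comment> \<open>The added 1 keeps the constant positive for \<open>a = 0\<close>.\<close>
  have "(norm a)\<^sup>2 \<le> (norm a)\<^sup>2 + 1" "0 < (norm a)\<^sup>2 + 1"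
    by (simp_all add: add_nonneg_pos)
  then show ?thesis
    using nonneg_square_bound[OF assms, of "(norm a)\<^sup>2 + 1"] assms
    unfolding nonneg_def by (auto simp: star_mult)
qed

text \<open>For \<open>h = 1 - a\<close> the limit \<open>1 - sqrt (1 - h)\<close> has scalar part 1
  and algebra part \<open>alg_lim 1 (- a)\<close>, so \<open>sqrt a\<close> is the negative of the
  latter.\<close>

definition psqrt :: "'a::cstar_algebra \<Rightarrow> 'a" where
  "psqrt a = - alg_lim 1 (- a)"

lemma psqrt:
  fixes a :: "'a::cstar_algebra"
  assumes "star a = a" "mult_bound 1 (- a) 1"
  shows "nonneg (psqrt a)" "psqrt a * psqrt a = a"
proof -
  have "star (alg_lim 1 (- a)) = alg_lim 1 (- a)"
    by (rule alg_lim_selfadjoint) (use assms in auto)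
  moreover have "mult_bound 1 (alg_lim 1 (- a)) 1"
    using alg_lim_bound[of 1 "-a"] assms by simp
  ultimately show "nonneg (psqrt a)"
    unfolding nonneg_def psqrt_def by (auto intro: exI[of _ 1])
  show "psqrt a * psqrt a = a"
    using alg_lim_eq[of 1 "-a"] assms by (simp add: psqrt_def)
qed

lemma psqrt_intertwine:
  assumes "mult_bound 1 (- a) 1" "mult_bound 1 (- b) 1" "a * z = z * b"
  shows "psqrt a * z = z * psqrt b"
  using alg_lim_intertwine[of 1 "-a" "-b" z] assms by (simp add: psqrt_def)

lemma nonneg_sqrt:
  assumes "nonneg a"
  obtains b where "nonneg b" "b * b = a" "\<And>z. a * z = z * a \<Longrightarrow> b * z = z * b"
proof -
  obtain t where t: "t > 0" "mult_bound t (- a) t" using assms by (auto simp: nonneg_def)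
  define c where "c = (1 / t) *\<^sub>R a"
  have c: "star c = c" "mult_bound 1 (- c) 1"
    using mult_bound_scaleR[OF t(2), of "1 / t"] t(1) assms
    by (simp_all add: c_def nonneg_selfadjoint)
  show ?thesis
  proof
    show "nonneg (sqrt t *\<^sub>R psqrt c)"
      by (intro nonneg_scaleR psqrt c) (use t in auto)
    show "sqrt t *\<^sub>R psqrt c * sqrt t *\<^sub>R psqrt c = a"
      using t(1) by (simp add: psqrt[OF c]) (simp add: c_def)
    show "sqrt t *\<^sub>R psqrt c * z = z * sqrt t *\<^sub>R psqrt c" if "a * z = z * a" for z
      using psqrt_intertwine[OF c(2) c(2), of z] that by (simp add: c_def)
  qed
qed

section \<open>Antisymmetry of the order and uniqueness of positive square roots\<close>

lemma commuting_squares_eq_0: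
  fixes a b :: "'a::cstar_algebra"
  assumes "star a = a" "star b = b" "a * b = b * a" "a * a + b * b = 0"
  shows "a = 0"
  using norm_le_sum_of_squares[of a b] assms by simp

text \<open>Roots \<open>b\<close> of \<open>a\<close> and \<open>c\<close> of \<open>- a\<close>
  can be chosen to commute, and \<open>b^2 + c^2 = 0\<close>.\<close>

lemma nonneg_antisym:
  assumes "nonneg a" "nonneg (- a)"
  shows "a = 0"
proof -
  obtain b where b: "nonneg b" "b * b = a" "\<And>z. a * z = z * a \<Longrightarrow> b * z = z * b"
    using nonneg_sqrt[OF assms(1)] by blast
  obtain c where c: "nonneg c" "c * c = - a" "\<And>z. - a * z = z * - a \<Longrightarrow> c * z = z * c"
    using nonneg_sqrt[OF assms(2)] by blast
  have "c * a = a * c" by (rule c(3)) simp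
  then have "b * c = c * b" by (intro b(3)) simp
  then have "b = 0"
    by (rule commuting_squares_eq_0[OF nonneg_selfadjoint[OF b(1)] nonneg_selfadjoint[OF c(1)]])
      (simp add: b(2) c(2))
  then show ?thesis using b(2) by simp
qed

text \<open>The summands are the squares of \<open>d * w\<close> and \<open>f * w\<close>, where
  \<open>d\<close> and \<open>f\<close> are roots of \<open>r\<close> and \<open>p\<close>. These
  products are self-adjoint and commute, so they vanish once their squares add up to 0.\<close>

lemma commuting_sandwich_eq_0:
  fixes r p w :: "'a::cstar_algebra"
  assumes "nonneg r" "nonneg p" "star w = w" "r * w = w * r" "p * w = w * p" "r * p = p * r"
    and "w * r * w + w * p * w = 0"
  shows "w * r * w = 0"
proof -
  obtain d where d: "nonneg d" "d * d = r" "\<And>z. r * z = z * r \<Longrightarrow> d * z = z * d"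
    using nonneg_sqrt[OF assms(1)] by blast
  obtain f where f: "nonneg f" "f * f = p" "\<And>z. p * z = z * p \<Longrightarrow> f * z = z * f"
    using nonneg_sqrt[OF assms(2)] by blast
  have dw: "d * w = w * d" and fw: "f * w = w * f" using d(3) f(3) assms by auto
  have "d * p = p * d" by (rule d(3)) (rule assms(6))
  then have df: "d * f = f * d" using f(3) by metis
  have sq: "(d * w) * (d * w) = w * r * w" "(f * w) * (f * w) = w * p * w"
    by (metis d(2) dw mult.assoc, metis f(2) fw mult.assoc)
  have "d * w = 0"
  proof (rule commuting_squares_eq_0)
    show "star (d * w) = d * w" "star (f * w) = f * w"
      using d(1) f(1) dw fw assms(3) by (simp_all add: star_mult nonneg_selfadjoint)
    show "d * w * (f * w) = f * w * (d * w)" by (metis df dw fw mult.assoc)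
    show "d * w * (d * w) + f * w * (f * w) = 0" unfolding sq by (rule assms(7))
  qed
  then show ?thesis using sq(1) by simp
qed

text \<open>Uniqueness of the positive root. For \<open>w = r - p\<close>, commutation gives
  \<open>w (r + p) w = 0\<close>; then \<open>w r w\<close> and \<open>w p w\<close> both vanish,
  and their difference is \<open>w^3\<close>.\<close>

lemma psqrt_square:
  assumes "nonneg p" "norm p \<le> 1"
  shows "psqrt (p * p) = p"
proof -
  have sp: "star p = p" using assms nonneg_selfadjoint by auto
  have b: "mult_bound 1 (- (p * p)) 1" by (rule square_bound[OF sp assms(2)])
  define r where "r = psqrt (p * p)"
  define w where "w = r - p"
  have r: "nonneg r" "r * r = p * p"
    unfolding r_def using psqrt[of "p * p", OF _ b] sp by (auto simp: star_mult)
  have rp: "r * p = p * r"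
    unfolding r_def by (rule psqrt_intertwine[OF b b]) (simp add: mult.assoc)
  have sw: "star w = w" using r(1) sp by (simp add: w_def star_diff nonneg_selfadjoint)
  have "w * (r + p) = 0" using rp r(2) by (simp add: w_def algebra_simps)
  then have "w * (r + p) * w = 0" by simp
  then have sum0: "w * r * w + w * p * w = 0" by (simp add: algebra_simps)
  have comm: "r * w = w * r" "p * w = w * p" using rp by (simp_all add: w_def algebra_simps)
  have "w * r * w = 0"
    using commuting_sandwich_eq_0[OF r(1) assms(1) sw comm rp sum0] .
  moreover have "w * p * w = 0" using sum0 calculation by simp
  moreover have "w * w * w = w * r * w - w * p * w"
    by (metis w_def left_diff_distrib right_diff_distrib)
  ultimately have "w * w * w = 0" by simp
  \<comment> \<open>A self-adjoint element with square 0 vanishes; this is applied to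
    \<open>w^2\<close> and then to \<open>w\<close>.\<close>
  then have "(w * w) * (w * w) = 0" by (simp add: mult.assoc)
  then have "w * w = 0" using selfadjoint_square_eq_0[of "w * w"] sw by (simp add: star_mult)
  then have "w = 0" using selfadjoint_square_eq_0[of w] sw by simp
  then show ?thesis by (simp add: w_def r_def)
qed

lemma nonneg_intertwine_square:
  assumes "nonneg p" "nonneg q" "norm p \<le> 1" "norm q \<le> 1" "p * p * z = z * (q * q)"
  shows "p * z = z * q"
  using psqrt_intertwine[of "p * p" "q * q" z] psqrt_square square_bound assms
    nonneg_selfadjoint by metis

text \<open>Up to sign, \<open>u\<close> and \<open>v\<close> are twice the real and the imaginary
  part of \<open>z\<close>. In \<open>u^2 + v^2\<close> the terms \<open>z^2\<close> and
  \<open>(star z)^2\<close> cancel, which leaves twice the claimed element.\<close>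

lemma nonneg_sum_star_mult: "nonneg (z * star z + star z * (z::'a::cstar_algebra))"
proof -
  define u v where "u = z + star z" and "v = \<i> *\<^sub>C (z - star z)"
  have "nonneg (u * u)"
    by (rule nonneg_square) (simp add: u_def star_add add.commute)
  moreover have "star v = v"
    by (simp add: v_def star_scaleC star_diff flip: scaleC_simps(5))
  then have "nonneg (v * v)" by (rule nonneg_square)
  moreover have "v * v = - ((z - star z) * (z - star z))"
    by (simp add: v_def mult_scaleC_left mult_scaleC_right scaleC_scaleC)
  then have "u * u + v * v = (z * star z + star z * z) + (z * star z + star z * z)"
    by (simp add: u_def algebra_simps)
  ultimately have "nonneg ((1/2) *\<^sub>R ((z * star z + star z * z) + (z * star z + star z * z)))"
    by (metis nonneg_add nonneg_scaleR zero_le_divide_1_iff zero_le_numeral)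
  then show ?thesis by simp
qed

text \<open>Here \<open>p = zz\<^sup>*\<close> and \<open>q = -z\<^sup>*z\<close> are both positive and \<open>pz = -zq\<close>. Hence
  \<open>p\<^sup>2z = zq\<^sup>2\<close>, and taking square roots gives \<open>pz = zq\<close>; so \<open>pz = 0\<close>.\<close>

lemma nonneg_neg_star_mult_aux:
  fixes z :: "'a::cstar_algebra"
  assumes "nonneg (- (star z * z))" "norm z \<le> 1"
  shows "z = 0"
proof -
  define p q where "p = z * star z" and "q = - (star z * z)"
  have "nonneg p"
    using nonneg_add[OF nonneg_sum_star_mult[of z] assms(1)] by (simp add: p_def)
  moreover have "norm p \<le> 1" "norm q \<le> 1"
    using norm_mult_ineq[of z "star z"] norm_mult_ineq[of "star z" z] assms(2)
      mult_le_one[of "norm z" "norm z"] by (simp_all add: p_def q_def)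
  moreover have "nonneg q" using assms(1) by (simp add: q_def)
  moreover have "p * p * z = z * (q * q)" by (simp add: p_def q_def mult.assoc)
  ultimately have "p * z = z * q" by (metis nonneg_intertwine_square)
  moreover have "z * q = - (p * z)" by (simp add: p_def q_def mult.assoc)
  ultimately have "p * z + p * z = 0" by (simp only: eq_neg_iff_add_eq_0)
  then have "2 *\<^sub>R (p * z) = 0" by (simp only: scaleR_2)
  then have "p * z = 0" by simp
  then have "(star z * z) * (star z * z) = 0" by (simp add: p_def mult.assoc)
  then have "star z * z = 0"
    using selfadjoint_square_eq_0[of "star z * z"] by (simp add: star_mult)
  then show ?thesis by (simp add: star_mult_self_eq_0)
qed

lemma nonneg_neg_star_mult:
  fixes z :: "'a::cstar_algebra"
  assumes "nonneg (- (star z * z))"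
  shows "z = 0"
proof (rule ccontr)
  assume "z \<noteq> 0"
  define y where "y = (1 / norm z) *\<^sub>R z"
  have "nonneg ((1 / norm z)\<^sup>2 *\<^sub>R (- (star z * z)))"
    by (intro nonneg_scaleR assms) simp
  then have "nonneg (- (star y * y))"
    by (simp add: y_def power2_eq_square)
  moreover have "norm y \<le> 1" using \<open>z \<noteq> 0\<close> by (simp add: y_def)
  ultimately have "y = 0" by (rule nonneg_neg_star_mult_aux)
  then show False using \<open>z \<noteq> 0\<close> by (simp add: y_def)
qed

text \<open>With \<open>a = y\<^sup>*y\<close>, \<open>m = |a|\<close> and \<open>n = m - a\<close> one has \<open>an = -mn\<close>, so that
  \<open>-(yn)\<^sup>*(yn) = nmn\<close> is positive; this forces \<open>yn = 0\<close> and then \<open>a = m\<close>.\<close>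

theorem nonneg_star_mult: "nonneg (star y * (y::'a::cstar_algebra))"
proof -
  define a where "a = star y * y"
  have sa: "star a = a" by (simp add: a_def star_mult)
  obtain m where m: "nonneg m" "m * m = a * a" "\<And>z. a * a * z = z * (a * a) \<Longrightarrow> m * z = z * m"
    using nonneg_sqrt[OF nonneg_square[OF sa]] by blast
  have ma: "m * a = a * m" by (rule m(3)) (simp add: mult.assoc)
  define n where "n = m - a"
  have sn: "star n = n" using sa m(1) by (simp add: n_def star_diff nonneg_selfadjoint)
  have an: "a * n = - (m * n)" using ma m(2) by (simp add: n_def algebra_simps)
  obtain d where d: "nonneg d" "d * d = m" "\<And>z. m * z = z * m \<Longrightarrow> d * z = z * d"
    using nonneg_sqrt[OF m(1)] by blast
  have dn: "d * n = n * d" by (rule d(3)) (simp add: n_def ma left_diff_distrib right_diff_distrib)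
  have sdn: "star (d * n) = d * n" using sn dn d(1) by (simp add: star_mult nonneg_selfadjoint)
  define z where "z = y * n"
  have zz: "- (star z * z) = (d * n) * (d * n)"
  proof -
    have "star z * z = n * (a * n)" by (simp add: z_def star_mult sn a_def mult.assoc)
    also have "\<dots> = - (n * (d * (d * n)))" by (simp add: an mult.assoc flip: d(2))
    also have "n * (d * (d * n)) = (d * n) * (d * n)" by (metis dn mult.assoc)
    finally show ?thesis by simp
  qed
  have "z = 0" by (rule nonneg_neg_star_mult) (simp only: zz nonneg_square[OF sdn])
  then have "d * n = 0" using zz selfadjoint_square_eq_0[OF sdn] by simp
  then have "m * n = 0" by (simp add: mult.assoc flip: d(2))
  moreover have "n * n = m * n - a * n" by (metis n_def left_diff_distrib)
  ultimately have "n * n = 0" by (simp add: an)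
  then have "n = 0" using selfadjoint_square_eq_0[OF sn] by simp
  then show ?thesis using m(1) by (simp add: n_def a_def)
qed

section \<open>Order and norm\<close>

lemma pos_elems_iff: "a \<in> pos_elems \<longleftrightarrow> nonneg a"
proof
  assume "nonneg a"
  then obtain b where "nonneg b" "b * b = a" using nonneg_sqrt by blast
  then have "a = star b * b" by (simp add: nonneg_selfadjoint)
  then show "a \<in> pos_elems" unfolding pos_elems_def by blast
qed (auto simp: pos_elems_def nonneg_star_mult)

text \<open>\<open>1 - h\<close> is the square of the self-adjoint \<open>1 - k\<close>, so the
  difference is \<open>star (c - k * c) * (c - k * c)\<close>.\<close>

lemma nonneg_contraction:
  fixes c h :: "'a::cstar_algebra"
  assumes "star h = h" "norm h \<le> 1"
  shows "nonneg (star c * c - star c * h * c)"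
proof -
  obtain k where k: "star k = k" "k + k = h + k * k" using one_minus_sqrt[OF assms] by blast
  have "star (c - k * c) * (c - k * c) = star c * c - star c * ((k + k) - k * k) * c"
    by (simp add: star_simps k(1) algebra_simps)
  also have "\<dots> = star c * c - star c * h * c" by (simp add: k(2))
  finally show ?thesis using nonneg_star_mult by metis
qed

text \<open>The aim is a complement \<open>s\<close> of \<open>d = sqrt a\<close> with
  \<open>d^2 + s^2 = 1\<close>, so that \<open>d\<close> is a contraction. Taking
  \<open>s = sqrt (1 - a)\<close> from \<open>one_minus_sqrt\<close> would presuppose the bound on
  \<open>a\<close>. Instead the root of \<open>(1 - a) / T = 1 - (t + a) / T\<close> is taken, where
  \<open>t\<close> witnesses the positivity of \<open>b - a\<close> and makes
  \<open>(t + a) / T\<close> a contraction.\<close>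

lemma nonneg_norm_mono_1:
  fixes a b :: "'a::cstar_algebra"
  assumes "nonneg a" "nonneg (b - a)" "norm b \<le> 1"
  shows "norm a \<le> 1"
proof -
  obtain d where d: "nonneg d" "d * d = a" "\<And>z. a * z = z * a \<Longrightarrow> d * z = z * d"
    using nonneg_sqrt[OF assms(1)] by blast
  have sd: "star d = d" and sa: "star a = a"
    using nonneg_selfadjoint[OF d(1)] nonneg_selfadjoint[OF assms(1)] .
  obtain t where t: "t > 0" "mult_bound t (- (b - a)) t"
    using assms(2) by (auto simp: nonneg_def)
  \<comment> \<open>The added 1 serves twice: it bounds the norm of \<open>b\<close>, and
    \<open>T - t = 1\<close> gives \<open>1 - (t + a) / T = (1 - a) / T\<close>.\<close>
  define T where "T = t + 1"
  have T: "T > 0" using t by (simp add: T_def)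
  have "mult_bound t a (t + norm b)"
    using mult_bound_add[OF t(2) mult_bound_norm[of b]] by simp
  then have "mult_bound t a T"
    unfolding mult_bound_def T_def using assms(3)
    by (smt (verit) mult_right_mono norm_ge_zero)
  from mult_bound_scaleR[OF this, of "1 / T"]
  have bd: "mult_bound (t / T) ((1 / T) *\<^sub>R a) 1" using T by simp
  have t1: "\<bar>t / T\<bar> \<le> 1" using t by (simp add: T_def)
  define l c where "l = scalar_lim (t / T)" and "c = alg_lim (t / T) ((1 / T) *\<^sub>R a)"
  have l: "2 * l = t / T + l\<^sup>2" unfolding l_def by (rule scalar_lim_eq[OF t1])
  have c: "2 *\<^sub>R c = (1 / T) *\<^sub>R a + (2 * l) *\<^sub>R c + c * c"
    unfolding l_def c_def by (rule alg_lim_eq[OF t1 bd])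
  have sc: "star c = c" unfolding c_def by (rule alg_lim_selfadjoint[OF t1 bd]) (simp add: sa)
  have "c * a = a * c" unfolding c_def by (rule alg_lim_intertwine[OF t1 bd bd]) simp
  then have cd: "c * d = d * c" using d(3)[of c] by simp
  have two: "(r * 2) *\<^sub>R x = r *\<^sub>R x + r *\<^sub>R x" for r and x :: 'a
    by (simp only: mult_2_right scaleR_add_left)
  have "norm (d * x) \<le> norm x" for x
  proof -
    \<comment> \<open>\<open>Y\<close> is \<open>s x\<close> for
      \<open>s = sqrt T * (1 - l - c)\<close>, whose square is \<open>1 - a\<close>.\<close>
    define X Y where "X = d * x" and "Y = sqrt T *\<^sub>R ((1 - l) *\<^sub>R x - c * x)"
    have "star X * Y = star Y * X"
      unfolding X_def Y_def star_simps sd sc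
      using arg_cong[OF cd, of "\<lambda>u. u * x"] by (simp add: algebra_simps star_simps sc)
    then have "(norm X)\<^sup>2 \<le> norm (star X * X + star Y * Y)"
      by (rule norm_le_sum_of_squares)
    also have "star Y * Y = T *\<^sub>R (star ((1 - l) *\<^sub>R x - c * x) * ((1 - l) *\<^sub>R x - c * x))"
      using T by (simp add: Y_def)
    also have "star ((1 - l) *\<^sub>R x - c * x) * ((1 - l) *\<^sub>R x - c * x)
        = star x * (((1 - l) * (1 - l)) *\<^sub>R x - (2 *\<^sub>R c - (2 * l) *\<^sub>R c - c * c) * x)"
      by (simp add: star_simps sc algebra_simps scaleR_2 two)
    also have "2 *\<^sub>R c - (2 * l) *\<^sub>R c - c * c = (1 / T) *\<^sub>R a" using c by simp
    also have "(1 - l) * (1 - l) = 1 / T"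
    proof -
      have "(1 - l) * (1 - l) = 1 - (2 * l - l\<^sup>2)" by (simp add: algebra_simps power2_eq_square)
      also have "\<dots> = 1 - t / T" using l by simp
      also have "\<dots> = 1 / T" using T by (simp add: T_def field_simps)
      finally show ?thesis .
    qed
    also have "star X * X + T *\<^sub>R (star x * ((1 / T) *\<^sub>R x - (1 / T) *\<^sub>R a * x)) = star x * x"
      using T by (simp add: X_def star_mult sd mult.assoc algebra_simps flip: d(2))
    finally have "(norm X)\<^sup>2 \<le> (norm x)\<^sup>2" by (simp add: cstar_identity)
    then show ?thesis by (simp add: X_def power2_le_iff_abs_le)
  qed
  then have "mult_bound 0 d 1" by (simp add: mult_bound_def)
  then have "norm d \<le> 1" by (rule mult_bound_norm_le) simp
  then show ?thesis
    using cstar_identity[of d] sd d(2) by (simp add: power_le_one)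
qed

lemma nonneg_norm_mono:
  fixes a b :: "'a::cstar_algebra"
  assumes "nonneg a" "nonneg (b - a)"
  shows "norm a \<le> norm b"
proof (rule field_le_epsilon)
  fix e :: real assume "e > 0"
  define r where "r = norm b + e"
  have r: "r > 0" "norm b \<le> r" using \<open>e > 0\<close> by (simp_all add: r_def add_nonneg_pos)
  have "norm ((1 / r) *\<^sub>R a) \<le> 1"
  proof (rule nonneg_norm_mono_1)
    show "nonneg ((1 / r) *\<^sub>R a)" using assms r by (intro nonneg_scaleR) auto
    have "nonneg ((1 / r) *\<^sub>R (b - a))" using assms r by (intro nonneg_scaleR) auto
    then show "nonneg ((1 / r) *\<^sub>R b - (1 / r) *\<^sub>R a)" by (simp add: scaleR_diff_right)
    show "norm ((1 / r) *\<^sub>R b) \<le> 1" using r by (simp add: pos_divide_le_eq)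
  qed
  then show "norm a \<le> norm b + e" using r by (simp add: r_def)
qed

text \<open>The definition of \<open>nonneg\<close> supplies some \<open>t\<close>; the root
  \<open>d\<close> shows that every positive \<open>t\<close> above the norm works. Limits need this
  uniformity.\<close>

lemma nonneg_bound:
  assumes "nonneg a" "t > 0" "norm a \<le> t"
  shows "mult_bound t (- a) t"
proof -
  obtain d where d: "nonneg d" "d * d = a" using nonneg_sqrt[OF assms(1)] by blast
  then have "(norm d)\<^sup>2 = norm a"
    using cstar_identity[of d] nonneg_selfadjoint[OF d(1)] by simp
  then show ?thesis
    using nonneg_square_bound[of d t] d assms by (simp add: nonneg_selfadjoint)
qed

text \<open>By \<open>nonneg_bound\<close> one \<open>t\<close> serves all parameters in
  \<open>(0, 1]\<close>, so the norm inequality that defines positivity survives the limit.\<close>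

lemma nonneg_limit:
  fixes a c :: "'a::cstar_algebra"
  assumes "\<And>\<epsilon>. \<epsilon> > 0 \<Longrightarrow> nonneg (a + \<epsilon> *\<^sub>R c)"
  shows "nonneg a"
proof -
  \<comment> \<open>Comparing the parameters 1 and 2 yields first \<open>star c = c\<close> and then
    \<open>star a = a\<close>.\<close>
  have 1: "star a + star c = a + c" using nonneg_selfadjoint[OF assms[of 1]] by (simp add: star_add)
  have "star a + (star c + star c) = a + (c + c)"
    using nonneg_selfadjoint[OF assms[of 2]] by (simp add: star_add scaleR_2)
  with 1 have "(a + c) + star c = (a + c) + c" by (metis add.assoc)
  then have "star c = c" by simp
  with 1 have "star a = a" by (metis add_right_cancel)
  define t where "t = norm a + norm c + 1"
  have t: "t > 0" by (simp add: t_def add_nonneg_pos)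
  have "mult_bound t (- a) t"
    unfolding mult_bound_def
  proof (rule allI, rule field_le_epsilon)
    fix x :: 'a and e :: real assume "e > 0"
    \<comment> \<open>\<open>r <= 1\<close> keeps the norm of \<open>a + r c\<close> below
      \<open>t\<close>; the quotient makes \<open>r * norm (c * x)\<close> at most
      \<open>e\<close>.\<close>
    define r where "r = min 1 (e / (norm (c * x) + 1))"
    have nz: "norm (c * x) + 1 > 0" by (simp add: add_nonneg_pos)
    have r: "r > 0" "r \<le> 1" "r \<le> e / (norm (c * x) + 1)"
      using \<open>e > 0\<close> nz by (auto simp: r_def)
    have "norm (a + r *\<^sub>R c) \<le> norm a + r * norm c"
      using norm_triangle_ineq[of a "r *\<^sub>R c"] r by simp
    also have "\<dots> \<le> t"
      using mult_right_mono[of r 1 "norm c"] r by (simp add: t_def)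
    finally have "mult_bound t (- (a + r *\<^sub>R c)) t"
      using nonneg_bound[OF assms] r t by blast
    then have "norm (t *\<^sub>R x + - (a + r *\<^sub>R c) * x) \<le> t * norm x" by (simp add: mult_bound_def)
    moreover have "t *\<^sub>R x + - a * x = (t *\<^sub>R x + - (a + r *\<^sub>R c) * x) + r *\<^sub>R (c * x)"
      by (simp add: algebra_simps)
    then have "norm (t *\<^sub>R x + - a * x)
        \<le> norm (t *\<^sub>R x + - (a + r *\<^sub>R c) * x) + norm (r *\<^sub>R (c * x))"
      by (metis norm_triangle_ineq)
    moreover have "norm (r *\<^sub>R (c * x)) \<le> e"
    proof -
      have "r * norm (c * x) \<le> r * (norm (c * x) + 1)" using r by (simp add: distrib_left)
      also have "\<dots> \<le> e" using r nz by (simp add: pos_le_divide_eq)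
      finally show ?thesis using r by simp
    qed
    ultimately show "norm (t *\<^sub>R x + - a * x) \<le> t * norm x + e" by linarith
  qed
  with \<open>star a = a\<close> t show ?thesis by (auto simp: nonneg_def)
qed

section \<open>Matrix algebra\<close>

lemma mat_star_carrier [simp, intro]: "A \<in> carrier_mat nr nc \<Longrightarrow> mat_star A \<in> carrier_mat nc nr"
  by (auto simp: mat_star_def)

lemma mat_star_dim [simp]: "dim_row (mat_star A) = dim_col A" "dim_col (mat_star A) = dim_row A"
  by (simp_all add: mat_star_def)

lemma mat_star_index [simp]:
  "i < dim_col A \<Longrightarrow> j < dim_row A \<Longrightarrow> mat_star A $$ (i, j) = star (A $$ (j, i))"
  by (simp add: mat_star_def)

lemma mat_scaleC_carrier [simp, intro]:
  "A \<in> carrier_mat nr nc \<Longrightarrow> mat_scaleC c A \<in> carrier_mat nr nc"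
  by (auto simp: mat_scaleC_def)

lemma mat_scaleC_dim [simp]:
  "dim_row (mat_scaleC c A) = dim_row A" "dim_col (mat_scaleC c A) = dim_col A"
  by (simp_all add: mat_scaleC_def)

lemma mat_scaleC_index [simp]:
  "i < dim_row A \<Longrightarrow> j < dim_col A \<Longrightarrow> mat_scaleC c A $$ (i, j) = c *\<^sub>C (A $$ (i, j))"
  by (simp add: mat_scaleC_def)

lemma mat_star_star [simp]: "mat_star (mat_star A) = A"
  by (rule eq_matI) auto

lemma mat_star_zero [simp]: "mat_star (0\<^sub>m m n) = (0\<^sub>m n m :: 'a::cstar_algebra mat)"
  by (rule eq_matI) auto

lemma mat_star_add:
  "A \<in> carrier_mat nr nc \<Longrightarrow> B \<in> carrier_mat nr nc \<Longrightarrow> mat_star (A + B) = mat_star A + mat_star B"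
  by (rule eq_matI) (auto simp: star_add)

lemma mat_star_minus:
  "A \<in> carrier_mat nr nc \<Longrightarrow> B \<in> carrier_mat nr nc \<Longrightarrow> mat_star (A - B) = mat_star A - mat_star B"
  by (rule eq_matI) (auto simp: star_diff)

lemma mat_star_scaleC [simp]: "mat_star (mat_scaleC c A) = mat_scaleC (cnj c) (mat_star A)"
  by (rule eq_matI) (auto simp: star_scaleC)

lemma mat_star_mult:
  assumes "A \<in> carrier_mat nr n" "B \<in> carrier_mat n nc"
  shows "mat_star (A * B) = mat_star B * mat_star A"
  using assms
  by (intro eq_matI) (auto simp: scalar_prod_def star_sum star_mult intro!: sum.cong)

lemma mat_scaleC_1 [simp]: "mat_scaleC 1 A = A"
  by (rule eq_matI) auto

lemma mat_scaleC_scaleC [simp]: "mat_scaleC c (mat_scaleC d A) = mat_scaleC (c * d) A"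
  by (rule eq_matI) (auto simp: scaleC_scaleC)

lemma mat_scaleC_mult_left:
  assumes "A \<in> carrier_mat nr n" "B \<in> carrier_mat n nc"
  shows "mat_scaleC c A * B = mat_scaleC c (A * B)"
  using assms
  by (intro eq_matI) (auto simp: scalar_prod_def scaleC_sum mult_scaleC_left intro!: sum.cong)

lemma mat_scaleC_mult_right:
  assumes "A \<in> carrier_mat nr n" "B \<in> carrier_mat n nc"
  shows "A * mat_scaleC c B = mat_scaleC c (A * B)"
  using assms
  by (intro eq_matI) (auto simp: scalar_prod_def scaleC_sum mult_scaleC_right intro!: sum.cong)

lemma mat_scaleC_add:
  "A \<in> carrier_mat nr nc \<Longrightarrow> B \<in> carrier_mat nr nc \<Longrightarrow>
    mat_scaleC c (A + B) = mat_scaleC c A + mat_scaleC c B"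
  by (rule eq_matI) (auto simp: scaleC_add_right)

lemma mat_scaleC_half: "mat_scaleC (1/2) A + mat_scaleC (1/2) A = A"
  using scaleC_add_left[of "1/2" "1/2", symmetric] by (intro eq_matI) auto

lemma mat_scaleC_minus:
  "A \<in> carrier_mat nr nc \<Longrightarrow> B \<in> carrier_mat nr nc \<Longrightarrow>
    mat_scaleC c (A - B) = mat_scaleC c A - mat_scaleC c B"
  by (rule eq_matI) (auto simp: scaleC_diff_right)

section \<open>C*-norms on a matrix algebra\<close>

text \<open>The iteration is set up again because matrices of a fixed size form a carrier set and
  not a type of class \<open>cstar_algebra\<close>. No scalar part is carried, as \<open>h\<close>
  is always a contraction inside the matrix algebra.\<close>

primrec mat_iter :: "nat \<Rightarrow> 'a::cstar_algebra mat \<Rightarrow> nat \<Rightarrow> 'a mat" where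
  "mat_iter n h 0 = 0\<^sub>m n n"
| "mat_iter n h (Suc m) = mat_scaleC (1/2) (h + mat_iter n h m * mat_iter n h m)"

text \<open>The norm is a parameter so that two C*-norms on the same matrices can be interpreted
  side by side.\<close>

locale cstar_norm_mat =
  fixes n :: nat and N :: "'a::cstar_algebra mat \<Rightarrow> real"
  assumes cstar_norm: "is_cstar_norm_mat n N"
begin

abbreviation M :: "'a mat set" where "M \<equiv> carrier_mat n n"

lemma M_closed [simp, intro]:
  fixes X Y :: "'a mat"
  assumes "X \<in> M" "Y \<in> M"
  shows "X * Y \<in> M" "X - Y \<in> M" "X + Y \<in> M"
  using assms by auto

lemmas mat_alg = mult_add_distrib_mat[of _ n n _ n] add_mult_distrib_mat[of _ n n _ _ n]
  mult_minus_distrib_mat[of _ n n _ n] minus_mult_distrib_mat[of _ n n _ _ n]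
  mat_scaleC_mult_left[of _ n n _ n] mat_scaleC_mult_right[of _ n n _ n]
  mat_scaleC_add[of _ n n] mat_scaleC_minus[of _ n n]
  mat_star_add[of _ n n] mat_star_minus[of _ n n] mat_star_mult[of _ n n _ n]
  assoc_mult_mat[of _ n n _ n _ n]

lemma square_minus_square:
  assumes "h \<in> M" "A \<in> M" "B \<in> M"
  shows "(h + A * A) - (h + B * B) = A * (A - B) + (A - B) * B"
  using assms by (simp add: mat_alg) (intro eq_matI; auto simp del: index_mult_mat(1))

lemma N_nonneg: "X \<in> M \<Longrightarrow> 0 \<le> N X"
  and N_eq_0_iff: "X \<in> M \<Longrightarrow> N X = 0 \<longleftrightarrow> X = 0\<^sub>m n n"
  and N_add: "X \<in> M \<Longrightarrow> Y \<in> M \<Longrightarrow> N (X + Y) \<le> N X + N Y"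
  and N_scaleC: "X \<in> M \<Longrightarrow> N (mat_scaleC c X) = cmod c * N X"
  and N_mult: "X \<in> M \<Longrightarrow> Y \<in> M \<Longrightarrow> N (X * Y) \<le> N X * N Y"
  and N_star_mult: "X \<in> M \<Longrightarrow> N (mat_star X * X) = (N X)\<^sup>2"
  using cstar_norm by (simp_all add: is_cstar_norm_mat_def)

lemma N_complete:
  assumes "\<And>k. S k \<in> M" "\<And>\<epsilon>. \<epsilon> > 0 \<Longrightarrow> \<exists>K. \<forall>k\<ge>K. \<forall>l\<ge>K. N (S k - S l) < \<epsilon>"
  obtains L where "L \<in> M" "(\<lambda>k. N (S k - L)) \<longlonglongrightarrow> 0"
proof -
  have "\<exists>L\<in>M. (\<lambda>k. N (S k - L)) \<longlonglongrightarrow> 0"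
    using cstar_norm assms unfolding is_cstar_norm_mat_def by blast
  then show ?thesis using that by blast
qed

lemma N_star:
  assumes "X \<in> M"
  shows "N (mat_star X) = N X"
proof -
  have "N Y \<le> N (mat_star Y)" if "Y \<in> M" for Y
  proof (cases "N Y = 0")
    case False
    have "N Y * N Y \<le> N (mat_star Y) * N Y"
      using N_mult[of "mat_star Y" Y] N_star_mult[of Y] that by (auto simp: power2_eq_square)
    then show ?thesis using False N_nonneg[OF that] by simp
  qed (use N_nonneg[of "mat_star Y"] that in auto)
  from this[of X] this[of "mat_star X"] show ?thesis using assms by fastforce
qed

lemma N_minus_commute:
  assumes "X \<in> M" "Y \<in> M"
  shows "N (X - Y) = N (Y - X)"
proof -
  have "Y - X = mat_scaleC (- 1) (X - Y)"
    using assms by (intro eq_matI) auto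
  moreover have "X - Y \<in> M" using assms by auto
  ultimately show ?thesis using N_scaleC[of "X - Y" "- 1"] by simp
qed

lemma N_zero [simp]: "N (0\<^sub>m n n) = 0"
  by (simp add: N_eq_0_iff)

lemma N_minus_triangle:
  assumes "X \<in> M" "Y \<in> M" "Z \<in> M"
  shows "N (X - Z) \<le> N (X - Y) + N (Y - Z)"
proof -
  have "X - Z = (X - Y) + (Y - Z)" using assms by (intro eq_matI) auto
  then show ?thesis using N_add[of "X - Y" "Y - Z"] assms by simp
qed

text \<open>Identities for the limit of the iteration are proved by bounding the difference of the
  two sides by multiples of the distance \<open>d\<close> of the iterates from it. The shifted term
  is there because the recursion links steps \<open>m\<close> and \<open>Suc m\<close>.\<close>

lemma eq_if_N_le:
  assumes "X \<in> M" "Y \<in> M" "d \<longlonglongrightarrow> 0" "\<And>m. N (X - Y) \<le> C * d m + D * d (Suc m)"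
  shows "X = Y"
proof -
  have "(\<lambda>m. C * d m + D * d (Suc m)) \<longlonglongrightarrow> C * 0 + D * 0"
    by (intro tendsto_intros LIMSEQ_Suc assms(3))
  then have "N (X - Y) \<le> C * 0 + D * 0"
    using assms(4) by (intro LIMSEQ_le_const) auto
  then have "N (X - Y) = 0" using N_nonneg[of "X - Y"] assms by simp
  then have *: "X - Y = 0\<^sub>m n n" using N_eq_0_iff[of "X - Y"] assms by simp
  show ?thesis
  proof (rule eq_matI)
    fix i j assume "i < dim_row Y" "j < dim_col Y"
    then have "(X - Y) $$ (i, j) = 0" using * assms by auto
    then show "X $$ (i, j) = Y $$ (i, j)" using \<open>i < dim_row Y\<close> \<open>j < dim_col Y\<close> assms by auto
  qed (use assms in auto)
qed

lemma N_le_sum_of_squares: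
  assumes X: "X \<in> M" and Y: "Y \<in> M" and comm: "mat_star X * Y = mat_star Y * X"
  shows "(N X)\<^sup>2 \<le> N (mat_star X * X + mat_star Y * Y)"
proof -
  define S where "S = mat_star X * X + mat_star Y * Y"
  have *: "N (X + mat_scaleC c Y) = sqrt (N S)" if c: "c = \<i> \<or> c = - \<i>" for c
  proof -
    have cc: "cnj c = - c" "c * c = - 1" using c by auto
    have "mat_star (X + mat_scaleC c Y) * (X + mat_scaleC c Y) = S"
      unfolding S_def using X Y cc
      by (simp add: mat_alg comm) (intro eq_matI; auto simp del: index_mult_mat(1))
    then have "(N (X + mat_scaleC c Y))\<^sup>2 = N S"
      using N_star_mult[of "X + mat_scaleC c Y"] X Y by simp
    then show ?thesis
      using N_nonneg[of "X + mat_scaleC c Y"] X Y by (intro real_sqrt_unique[symmetric]) auto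
  qed
  have "mat_scaleC 2 X = (X + mat_scaleC \<i> Y) + (X + mat_scaleC (- \<i>) Y)"
    using X Y scaleC_add_left[of 1 1] by (intro eq_matI) auto
  then have "2 * N X \<le> N (X + mat_scaleC \<i> Y) + N (X + mat_scaleC (- \<i>) Y)"
    using N_add[of "X + mat_scaleC \<i> Y" "X + mat_scaleC (- \<i>) Y"] N_scaleC[of X 2] X Y by simp
  then have "N X \<le> sqrt (N S)" using *[of \<i>] *[of "- \<i>"] by simp
  then show ?thesis
    unfolding S_def using N_nonneg[OF X] by (simp add: sqrt_ge_absD)
qed

section \<open>Square roots in the matrix algebra\<close>

context
  fixes h :: "'a mat"
  assumes h: "h \<in> M" "N h \<le> 1"
begin

lemma mat_iter_carrier [simp]: "mat_iter n h m \<in> M"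
  using h by (induction m) auto

lemma mat_iter_dim [simp]: "dim_row (mat_iter n h m) = n" "dim_col (mat_iter n h m) = n"
  using mat_iter_carrier by blast+

lemma mat_iter_bound:
  "N (mat_iter n h m) \<le> majorant m"
  "N (mat_iter n h (Suc m) - mat_iter n h m) \<le> majorant (Suc m) - majorant m"
proof -
  let ?k = "mat_iter n h"
  have b: "N (?k m) \<le> majorant m" for m
  proof (induction m)
    case (Suc m)
    have "N (h + ?k m * ?k m) \<le> N h + N (?k m * ?k m)"
      using h(1) by (intro N_add) auto
    also have "\<dots> \<le> 1 + N (?k m) * N (?k m)"
      by (intro add_mono h N_mult) auto
    also have "\<dots> \<le> 1 + majorant m * majorant m"
      by (intro add_left_mono mult_mono Suc N_nonneg majorant_bounds) auto
    finally show ?case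
      using N_scaleC[of "h + ?k m * ?k m" "1/2"] h(1) by (simp add: power2_eq_square)
  qed simp
  show "N (?k m) \<le> majorant m" by (rule b)
  show "N (?k (Suc m) - ?k m) \<le> majorant (Suc m) - majorant m"
  proof (induction m)
    case 0
    have "mat_scaleC (1/2) (h + 0\<^sub>m n n * 0\<^sub>m n n) - 0\<^sub>m n n = mat_scaleC (1/2) h"
      using h(1) by (intro eq_matI) auto
    then show ?case using h N_scaleC[of h "1/2"] by simp
  next
    case (Suc m)
    let ?A = "?k (Suc m)" and ?B = "?k m"
    have car: "?A \<in> M" "?B \<in> M" by (rule mat_iter_carrier)+
    have "?k (Suc (Suc m)) - ?k (Suc m)
      = mat_scaleC (1/2) (h + ?A * ?A) - mat_scaleC (1/2) (h + ?B * ?B)"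
      by (subst mat_iter.simps(2)[of n h "Suc m"], subst mat_iter.simps(2)[of n h m]) (rule refl)
    also have "\<dots> = mat_scaleC (1/2) (?A * (?A - ?B) + (?A - ?B) * ?B)"
      using car h(1)
      by (simp only: square_minus_square M_closed flip: mat_scaleC_minus[of _ n n])
    finally have "N (?k (Suc (Suc m)) - ?k (Suc m)) = N (?A * (?A - ?B) + (?A - ?B) * ?B) / 2"
      using N_scaleC[of "?A * (?A - ?B) + (?A - ?B) * ?B" "1/2"] car
      by (simp add: minus_carrier_mat del: mat_iter.simps)
    also have "N (?A * (?A - ?B) + (?A - ?B) * ?B) \<le> N (?A * (?A - ?B)) + N ((?A - ?B) * ?B)"
      using car by (intro N_add) (auto simp del: mat_iter.simps)
    also have "\<dots> \<le> N ?A * N (?A - ?B) + N (?A - ?B) * N ?B"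
      using car by (intro add_mono N_mult minus_carrier_mat) (auto simp del: mat_iter.simps)
    also have "\<dots> \<le> majorant (Suc m) * (majorant (Suc m) - majorant m)
        + (majorant (Suc m) - majorant m) * majorant m"
      using majorant_step[of m] car
      by (intro add_mono mult_mono b Suc N_nonneg minus_carrier_mat majorant_bounds) auto
    also have "\<dots> / 2 = majorant (Suc (Suc m)) - majorant (Suc m)"
      by (simp add: field_simps power2_eq_square)
    finally show ?case by simp
  qed
qed

lemma mat_iter_limit:
  obtains L where "L \<in> M" "(\<lambda>m. N (mat_iter n h m - L)) \<longlonglongrightarrow> 0"
proof (rule N_complete[of "mat_iter n h"])
  let ?k = "mat_iter n h"
  have tele: "N (?k (m + d) - ?k m) \<le> majorant (m + d) - majorant m" for m d
  proof (induction d)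
    case 0
    have "?k m - ?k m = 0\<^sub>m n n"
      by (intro eq_matI) auto
    then show ?case by (simp only: add_0_right N_zero diff_self order_refl)
  next
    case (Suc d)
    have "N (?k (m + Suc d) - ?k m) \<le> N (?k (Suc (m + d)) - ?k (m + d)) + N (?k (m + d) - ?k m)"
      using N_minus_triangle[of "?k (Suc (m + d))" "?k (m + d)" "?k m"]
      by (simp del: mat_iter.simps)
    with Suc mat_iter_bound(2)[of "m + d"] show ?case by (simp del: mat_iter.simps scalar_iter.simps)
  qed
  fix \<epsilon> :: real assume "\<epsilon> > 0"
  from majorant_Cauchy[OF this] obtain K
    where K: "\<And>m d. m \<ge> K \<Longrightarrow> majorant (m + d) - majorant m < \<epsilon>" by blast
  have "N (?k a - ?k b) < \<epsilon>" if ab: "a \<ge> K" "a \<le> b" for a b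
  proof -
    obtain d where b: "b = a + d" using le_Suc_ex[OF ab(2)] ..
    have "N (?k b - ?k a) < \<epsilon>" unfolding b using tele[of a d] K[OF ab(1), of d] by linarith
    then show ?thesis using N_minus_commute[OF mat_iter_carrier mat_iter_carrier, of b a] by simp
  qed
  then have "\<forall>a\<ge>K. \<forall>b\<ge>K. N (?k a - ?k b) < \<epsilon>"
    using N_minus_commute[OF mat_iter_carrier mat_iter_carrier] linear by metis
  then show "\<exists>K. \<forall>a\<ge>K. \<forall>b\<ge>K. N (?k a - ?k b) < \<epsilon>" by blast
qed (use that in auto)

text \<open>\<open>k\<close> is again \<open>1 - sqrt (1 - h)\<close>. The last clause serves
  corners: if a projection \<open>Z\<close> fixes \<open>h\<close>, it fixes \<open>k\<close>, so
  \<open>Z - k\<close> can act as a root of \<open>Z - h\<close>.\<close>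

lemma mat_one_minus_sqrt:
  assumes "mat_star h = h"
  obtains k where "k \<in> M" "mat_star k = k" "k + k = h + k * k"
    "\<And>Z. Z \<in> M \<Longrightarrow> Z * h = h * Z \<Longrightarrow> Z * k = k * Z"
    "\<And>Z. Z \<in> M \<Longrightarrow> Z * h = h \<Longrightarrow> Z * k = k"
proof -
  let ?k = "mat_iter n h"
  obtain L where L: "L \<in> M" "(\<lambda>m. N (mat_iter n h m - L)) \<longlonglongrightarrow> 0" by (rule mat_iter_limit)
  define d where "d m = N (?k m - L)" for m
  have d: "d \<longlonglongrightarrow> 0" unfolding d_def by (rule L(2))
  have d': "N (L - ?k m) = d m" for m unfolding d_def using L(1) by (intro N_minus_commute) auto
  have sym: "mat_star (?k m) = ?k m" for m
    using h(1) by (induction m) (simp_all add: mat_alg assms)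
  show ?thesis
  proof
    show "L \<in> M" by (rule L(1))
    show "mat_star L = L"
    proof (rule eq_if_N_le[OF _ L(1) d])
      fix m
      have "N (mat_star L - L) \<le> N (mat_star L - ?k m) + N (?k m - L)"
        using L(1) by (intro N_minus_triangle) auto
      also have "mat_star L - ?k m = mat_star (L - ?k m)"
        using L(1) by (simp add: mat_star_minus[of _ n n] sym)
      also have "N \<dots> = d m" using N_star[of "L - ?k m"] L(1) d' by simp
      finally show "N (mat_star L - L) \<le> 2 * d m + 0 * d (Suc m)" by (simp add: d_def)
    qed (use L in auto)
    show "Z * L = L * Z" if Z: "Z \<in> M" "Z * h = h * Z" for Z
    proof (rule eq_if_N_le[OF _ _ d])
      fix m
      have comm: "Z * ?k m = ?k m * Z" for m
      proof (induction m)
        case (Suc m)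
        have "Z * (?k m * ?k m) = (Z * ?k m) * ?k m"
          using Z by (simp add: assoc_mult_mat[of _ n n _ n _ n])
        also have "\<dots> = ?k m * (Z * ?k m)"
          using Z by (simp add: Suc assoc_mult_mat[of _ n n _ n _ n])
        also have "\<dots> = ?k m * ?k m * Z"
          using Z by (simp add: Suc assoc_mult_mat[of _ n n _ n _ n])
        finally show ?case
          using Z h(1) by (simp add: mult_add_distrib_mat[of _ n n _ n] add_mult_distrib_mat[of _ n n _ _ n]
              mat_scaleC_mult_left[of _ n n _ n] mat_scaleC_mult_right[of _ n n _ n])
      qed (use Z in auto)
      have "N (Z * L - L * Z) \<le> N (Z * L - Z * ?k m) + N (Z * ?k m - L * Z)"
        using Z L by (intro N_minus_triangle) auto
      also have "Z * L - Z * ?k m = Z * (L - ?k m)"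
        using Z L by (simp add: mult_minus_distrib_mat[of _ n n _ n])
      also have "Z * ?k m - L * Z = (?k m - L) * Z"
        using Z L by (simp add: minus_mult_distrib_mat[of _ n n _ _ n] comm)
      also have "N (Z * (L - ?k m)) \<le> N Z * d m"
        using N_mult[of Z "L - ?k m"] Z L by (simp add: d')
      also have "N ((?k m - L) * Z) \<le> d m * N Z"
        using N_mult[of "?k m - L" Z] Z L by (simp add: d_def)
      finally show "N (Z * L - L * Z) \<le> (2 * N Z) * d m + 0 * d (Suc m)" by simp
    qed (use Z L in auto)
    show "Z * L = L" if Z: "Z \<in> M" "Z * h = h" for Z
    proof (rule eq_if_N_le[OF _ _ d])
      fix m
      have fixd: "Z * ?k m = ?k m" for m
      proof (induction m)
        case (Suc m)
        have "Z * (?k m * ?k m) = (Z * ?k m) * ?k m"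
          using Z by (simp add: assoc_mult_mat[of _ n n _ n _ n])
        with Suc show ?case
          using Z h(1) by (simp add: mult_add_distrib_mat[of _ n n _ n]
              mat_scaleC_mult_right[of _ n n _ n])
      qed (use Z in auto)
      have "N (Z * L - L) \<le> N (Z * L - Z * ?k m) + N (Z * ?k m - L)"
        using Z L by (intro N_minus_triangle) auto
      also have "Z * L - Z * ?k m = Z * (L - ?k m)"
        using Z L by (simp add: mult_minus_distrib_mat[of _ n n _ n])
      also have "N (Z * (L - ?k m)) \<le> N Z * d m"
        using N_mult[of Z "L - ?k m"] Z L by (simp add: d')
      also have "N (Z * ?k m - L) = d m" by (simp add: fixd d_def)
      finally show "N (Z * L - L) \<le> (N Z + 1) * d m + 0 * d (Suc m)" by (simp add: algebra_simps)
    qed (use Z L in auto)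
    show "L + L = h + L * L"
    proof (rule eq_if_N_le[OF _ _ d])
      fix m
      have kk: "?k (Suc m) + ?k (Suc m) = h + ?k m * ?k m"
        by (simp add: mat_scaleC_half)
      have "N ((L + L) - (h + L * L)) \<le> N ((L + L) - (?k (Suc m) + ?k (Suc m)))
          + N ((h + ?k m * ?k m) - (h + L * L))"
        using N_minus_triangle[of "L + L" "?k (Suc m) + ?k (Suc m)" "h + L * L"] L h(1)
        unfolding kk by simp
      also have "(L + L) - (?k (Suc m) + ?k (Suc m)) = (L - ?k (Suc m)) + (L - ?k (Suc m))"
        using L(1) mat_iter_carrier[of "Suc m"]
        by (intro eq_matI) (auto simp: algebra_simps simp del: mat_iter.simps)
      also have "N \<dots> \<le> d (Suc m) + d (Suc m)"
        using N_add[of "L - ?k (Suc m)" "L - ?k (Suc m)"] L(1) mat_iter_carrier[of "Suc m"]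
        by (simp add: d' minus_carrier_mat del: mat_iter.simps)
      also have "(h + ?k m * ?k m) - (h + L * L) = ?k m * (?k m - L) + (?k m - L) * L"
        using L(1) h(1) by (intro square_minus_square) auto
      also have "N \<dots> \<le> N (?k m * (?k m - L)) + N ((?k m - L) * L)"
        using L(1) by (intro N_add) auto
      also have "N (?k m * (?k m - L)) \<le> N (?k m) * d m"
        unfolding d_def using L(1) by (intro N_mult minus_carrier_mat) auto
      also have "\<dots> \<le> 1 * d m"
        unfolding d_def using mat_iter_bound(1)[of m] majorant_bounds(2)[of m] L(1)
        by (intro mult_right_mono N_nonneg minus_carrier_mat) auto
      also have "N ((?k m - L) * L) \<le> d m * N L"
        unfolding d_def using L(1) by (intro N_mult minus_carrier_mat) auto
      finally show "N ((L + L) - (h + L * L)) \<le> (1 + N L) * d m + 2 * d (Suc m)"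
        by (simp add: algebra_simps)
    qed (use L h in auto)
  qed
qed

end

text \<open>\<open>k\<close> is constructed by means of \<open>N\<close>, but
  \<open>(1 - k)^2 = 1 - s^2\<close> is purely algebraic and can be read with \<open>N'\<close>.
  Multiplying by \<open>s\<close> avoids the unit: \<open>X = s^2\<close> and
  \<open>Y = (1 - k) s\<close> satisfy \<open>X^2 + Y^2 = s^2\<close>, so \<open>N'\<close> yields
  \<open>(N' s)^4 <= (N' s)^2\<close>.\<close>

lemma norm_le_1_if_norm_le_1:
  assumes N': "is_cstar_norm_mat n N'" and s: "s \<in> M" "mat_star s = s" "N s \<le> 1"
  shows "N' s \<le> 1"
proof -
  interpret N': cstar_norm_mat n N' by standard (rule N')
  have ss: "s * s \<in> M" using s by auto
  have "N (s * s) \<le> 1"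
    using N_mult[OF s(1) s(1)] mult_le_one[of "N s" "N s"] s N_nonneg[OF s(1)] by simp
  moreover have "mat_star (s * s) = s * s" using s by (simp add: mat_star_mult[of _ n n _ n])
  ultimately obtain k where k: "k \<in> M" "mat_star k = k" "k + k = s * s + k * k"
      "\<And>Z. Z \<in> M \<Longrightarrow> Z * (s * s) = s * s * Z \<Longrightarrow> Z * k = k * Z"
    using mat_one_minus_sqrt[OF ss] by metis
  have sk: "s * k = k * s" using s by (intro k(4)) auto
  note A = assoc_mult_mat[of _ n n _ n _ n]
  define X Y where "X = s * s" and "Y = s - k * s"
  have XY: "X \<in> M" "Y \<in> M" using s(1) k(1) by (auto simp: X_def Y_def)
  have starX: "mat_star X = X" and starY: "mat_star Y = Y"
    using s(1,2) k(1,2) by (simp_all add: X_def Y_def mat_alg sk)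
  have skA: "s * (k * Z) = k * (s * Z)" if "Z \<in> M" for Z
  proof -
    have "s * (k * Z) = (s * k) * Z" using that s(1) k(1) by (simp add: A)
    also have "\<dots> = k * (s * Z)" using that s(1) k(1) by (simp add: A sk)
    finally show ?thesis .
  qed
  have "mat_star X * Y = mat_star Y * X"
    unfolding starX starY unfolding X_def Y_def using s(1) k(1)
    by (simp add: mat_alg skA sk)
  then have "(N' X)\<^sup>2 \<le> N' (mat_star X * X + mat_star Y * Y)"
    by (rule N'.N_le_sum_of_squares[OF XY])
  also have "mat_star X * X + mat_star Y * Y = s * s + ((s * s + k * k) * (s * s) - (k + k) * (s * s))"
    unfolding starX starY unfolding X_def Y_def using s(1) k(1)
    by (simp add: mat_alg skA sk)
      (intro eq_matI; auto simp del: index_mult_mat(1))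
  also have "\<dots> = s * s"
    unfolding k(3) using s(1) k(1) by (intro eq_matI) (auto simp del: index_mult_mat(1))
  finally have "(N' (s * s))\<^sup>2 \<le> N' (s * s)" by (simp add: X_def)
  moreover have "N' (s * s) = (N' s)\<^sup>2" using N'.N_star_mult[OF s(1)] s(2) by simp
  ultimately have "(N' s)\<^sup>2 * (N' s)\<^sup>2 \<le> 1 * (N' s)\<^sup>2" by (simp add: power2_eq_square)
  then have "(N' s)\<^sup>2 \<le> 1"
    using mult_strict_right_mono[of 1 "(N' s)\<^sup>2" "(N' s)\<^sup>2"] by fastforce
  then show ?thesis using abs_square_le_1 by force
qed

text \<open>The C*-identity reduces \<open>X\<close> to the self-adjoint
  \<open>mat_star X * X\<close>, and scaling reduces self-adjoint matrices to those of norm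
  1.\<close>

lemma norm_le_norm:
  assumes N': "is_cstar_norm_mat n N'" and X: "X \<in> M"
  shows "N' X \<le> N X"
proof -
  interpret N': cstar_norm_mat n N' by standard (rule N')
  have sa: "N' s \<le> N s" if s: "s \<in> M" "mat_star s = s" for s
  proof (cases "N s = 0")
    case True
    then show ?thesis using N_eq_0_iff[OF s(1)] by simp
  next
    case False
    define r where "r = N s"
    have r: "r > 0" using False N_nonneg[OF s(1)] by (simp add: r_def)
    have "N' (mat_scaleC (complex_of_real (1 / r)) s) \<le> 1"
      by (rule norm_le_1_if_norm_le_1[OF N']) (use s r N_scaleC[OF s(1)] in \<open>auto simp: r_def norm_divide\<close>)
    then show ?thesis using r N'.N_scaleC[OF s(1)] by (simp add: r_def norm_divide)
  qed
  have "(N' X)\<^sup>2 \<le> (N X)\<^sup>2"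
    using sa[of "mat_star X * X"] X N_star_mult[OF X] N'.N_star_mult[OF X]
    by (simp add: mat_star_mult[of _ n n _ n] mult_carrier_mat[of _ n n])
  then show ?thesis using N_nonneg[OF X] power2_le_imp_le by blast
qed

lemma mat_norm_eq:
  assumes X: "X \<in> M"
  shows "mat_norm n X = N X"
  unfolding mat_norm_def
proof (rule the_equality)
  show "\<exists>N'. is_cstar_norm_mat n N' \<and> N' X = N X" using cstar_norm by blast
  fix r assume "\<exists>N'. is_cstar_norm_mat n N' \<and> N' X = r"
  then obtain N' where N': "is_cstar_norm_mat n N'" "N' X = r" by blast
  interpret N': cstar_norm_mat n N' by standard (rule N')
  show "r = N X"
    using norm_le_norm[OF N'(1) X] N'.norm_le_norm[OF cstar_norm X] N'(2) by simp
qed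

end

section \<open>Columns as a Hilbert module\<close>

text \<open>The matrices over \<open>A\<close> act on the Hilbert \<open>A\<close>-module of columns; the operator norm of this
  action is a C*-norm.\<close>

definition ip :: "'a::cstar_algebra mat \<Rightarrow> 'a mat \<Rightarrow> 'a" where
  "ip u v = (mat_star u * v) $$ (0, 0)"

definition col_norm :: "'a::cstar_algebra mat \<Rightarrow> real" where
  "col_norm u = sqrt (norm (ip u u))"

lemma ip_sum:
  assumes "u \<in> carrier_mat m 1" "v \<in> carrier_mat m 1"
  shows "ip u v = (\<Sum>i = 0..<m. star (u $$ (i, 0)) * v $$ (i, 0))"
  using assms unfolding ip_def by (auto simp: scalar_prod_def intro!: sum.cong)

lemma ip_add_right:
  "u \<in> carrier_mat m 1 \<Longrightarrow> v \<in> carrier_mat m 1 \<Longrightarrow> w \<in> carrier_mat m 1 \<Longrightarrow>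
    ip u (v + w) = ip u v + ip u w"
  by (simp add: ip_sum[of _ m] distrib_left sum.distrib)

lemma ip_minus_right:
  "u \<in> carrier_mat m 1 \<Longrightarrow> v \<in> carrier_mat m 1 \<Longrightarrow> w \<in> carrier_mat m 1 \<Longrightarrow>
    ip u (v - w) = ip u v - ip u w"
  by (simp add: ip_sum[of _ m] minus_carrier_mat right_diff_distrib sum_subtractf)

lemma ip_minus_left:
  "u \<in> carrier_mat m 1 \<Longrightarrow> v \<in> carrier_mat m 1 \<Longrightarrow> w \<in> carrier_mat m 1 \<Longrightarrow>
    ip (v - w) u = ip v u - ip w u"
  by (simp add: ip_sum[of _ m] minus_carrier_mat left_diff_distrib sum_subtractf star_diff)

lemma ip_scaleC_right:
  "u \<in> carrier_mat m 1 \<Longrightarrow> v \<in> carrier_mat m 1 \<Longrightarrow> ip u (mat_scaleC c v) = c *\<^sub>C ip u v"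
  by (simp add: ip_sum[of _ m] mult_scaleC_right scaleC_sum)

lemma star_ip:
  "u \<in> carrier_mat m 1 \<Longrightarrow> v \<in> carrier_mat m 1 \<Longrightarrow> star (ip u v) = ip v u"
  by (simp add: ip_sum[of _ m] star_sum star_mult)

lemma ip_scaleC_left:
  "u \<in> carrier_mat m 1 \<Longrightarrow> v \<in> carrier_mat m 1 \<Longrightarrow> ip (mat_scaleC c u) v = cnj c *\<^sub>C ip u v"
  by (simp add: ip_sum[of _ m] mult_scaleC_left star_scaleC scaleC_sum)

lemma ip_adjoint:
  assumes "A \<in> carrier_mat m n" "u \<in> carrier_mat n 1" "v \<in> carrier_mat m 1"
  shows "ip (A * u) v = ip u (mat_star A * v)"
  using assms unfolding ip_def
  by (simp add: mat_star_mult[of _ m n _ 1] assoc_mult_mat[of _ 1 n _ m _ 1])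

lemma nonneg_ip: "u \<in> carrier_mat m 1 \<Longrightarrow> nonneg (ip u u)"
  by (simp add: ip_sum[of _ m] nonneg_sum nonneg_star_mult)

lemma col_norm_nonneg [simp]: "0 \<le> col_norm u"
  by (simp add: col_norm_def)

lemma col_norm_square: "(col_norm u)\<^sup>2 = norm (ip u u)"
  by (simp add: col_norm_def)

lemma col_norm_mono: "nonneg (ip u u) \<Longrightarrow> nonneg (ip v v - ip u u) \<Longrightarrow> col_norm u \<le> col_norm v"
  by (simp add: col_norm_def nonneg_norm_mono)

lemma col_norm_scaleC:
  assumes "u \<in> carrier_mat m 1"
  shows "col_norm (mat_scaleC c u) = cmod c * col_norm u"
proof -
  have "ip (mat_scaleC c u) (mat_scaleC c u) = (cnj c * c) *\<^sub>C ip u u"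
    using assms by (simp add: ip_scaleC_left[of _ m] ip_scaleC_right[of _ m] scaleC_scaleC mult.commute)
  then show ?thesis
    by (simp add: col_norm_def norm_scaleC norm_mult real_sqrt_mult)
qed

text \<open>Expand the inner product of \<open>u a - v\<close> with itself for
  \<open>a = ip u v\<close>, the coefficient of the projection when \<open>ip u u\<close> is a unit.
  By \<open>nonneg_contraction\<close> the term \<open>star a * ip u u * a\<close> is at most
  \<open>star a * a\<close>, which leaves \<open>star a * a <= ip v v\<close>.\<close>

lemma norm_ip_le_1:
  assumes u: "u \<in> carrier_mat m 1" and v: "v \<in> carrier_mat m 1" and le: "norm (ip u u) \<le> 1"
  shows "norm (ip u v) \<le> col_norm v"
proof -
  define a where "a = ip u v"
  have sa: "star a = ip v u" unfolding a_def by (rule star_ip[OF u v])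
  define z where "z i = u $$ (i, 0) * a - v $$ (i, 0)" for i
  have "(\<Sum>i = 0..<m. star (z i) * z i)
    = (\<Sum>i = 0..<m. star a * (star (u $$ (i, 0)) * u $$ (i, 0)) * a
        - star a * (star (u $$ (i, 0)) * v $$ (i, 0))
        - (star (v $$ (i, 0)) * u $$ (i, 0)) * a + star (v $$ (i, 0)) * v $$ (i, 0))"
    by (intro sum.cong refl) (simp add: z_def star_simps algebra_simps)
  also have "\<dots> = star a * ip u u * a - star a * ip u v - ip v u * a + ip v v"
    by (simp only: sum.distrib sum_subtractf ip_sum[OF u u] ip_sum[OF u v] ip_sum[OF v u]
        ip_sum[OF v v] sum_distrib_left sum_distrib_right)
  also have "\<dots> = ip v v - star a * a - (star a * a - star a * ip u u * a)"
    by (simp add: sa flip: a_def)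
  finally have "nonneg (ip v v - star a * a - (star a * a - star a * ip u u * a))"
    by (metis (no_types, lifting) nonneg_star_mult nonneg_sum)
  moreover have "nonneg (star a * a - star a * ip u u * a)"
    by (rule nonneg_contraction[OF star_ip[OF u u] le])
  ultimately have "nonneg (ip v v - star a * a)" using nonneg_add by fastforce
  then have "norm (star a * a) \<le> norm (ip v v)"
    by (rule nonneg_norm_mono[OF nonneg_star_mult])
  then have "sqrt ((norm a)\<^sup>2) \<le> sqrt (norm (ip v v))"
    unfolding cstar_identity by (rule real_sqrt_le_mono)
  then show ?thesis by (simp add: a_def col_norm_def)
qed

lemma Cauchy_Schwarz_ip:
  assumes u: "u \<in> carrier_mat m 1" and v: "v \<in> carrier_mat m 1"
  shows "norm (ip u v) \<le> col_norm u * col_norm v"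
proof -
  \<comment> \<open>A number strictly above \<open>col_norm u\<close> is used because the latter may
    be 0 and cannot be divided by.\<close>
  have *: "norm (ip u v) \<le> r * col_norm v" if r: "r > col_norm u" for r
  proof -
    have r0: "r > 0" using r col_norm_nonneg[of u] by linarith
    define w where "w = mat_scaleC (complex_of_real (1 / r)) u"
    have w: "w \<in> carrier_mat m 1" using u by (simp add: w_def)
    have "col_norm w \<le> 1"
      using r r0 by (simp add: w_def col_norm_scaleC[OF u] norm_divide)
    then have "norm (ip w w) \<le> 1"
      by (metis col_norm_square col_norm_nonneg power_le_one)
    then have "norm (ip w v) \<le> col_norm v" by (rule norm_ip_le_1[OF w v])
    then show ?thesis
      using r0 u v by (simp add: w_def ip_scaleC_left[of _ m] norm_scaleC norm_divide field_simps)
  qed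
  show ?thesis
  proof (cases "col_norm v = 0")
    case True
    then show ?thesis using *[of "col_norm u + 1"] by simp
  next
    case False
    then have pos: "col_norm v > 0" using col_norm_nonneg[of v] by linarith
    have "norm (ip u v) / col_norm v \<le> col_norm u"
    proof (rule dense_ge)
      fix r assume "col_norm u < r"
      then show "norm (ip u v) / col_norm v \<le> r" using *[of r] pos by (simp add: divide_le_eq)
    qed
    then show ?thesis using pos by (simp add: divide_le_eq)
  qed
qed

lemma col_norm_add:
  assumes u: "u \<in> carrier_mat m 1" and v: "v \<in> carrier_mat m 1"
  shows "col_norm (u + v) \<le> col_norm u + col_norm v"
proof -
  have uv: "u + v \<in> carrier_mat m 1" using u v by auto
  have "ip (u + v) (u + v) = ip (u + v) u + ip (u + v) v"
    by (rule ip_add_right[OF uv u v])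
  then have "(col_norm (u + v))\<^sup>2 \<le> norm (ip (u + v) u) + norm (ip (u + v) v)"
    by (metis col_norm_square norm_triangle_ineq)
  also have "\<dots> \<le> col_norm (u + v) * col_norm u + col_norm (u + v) * col_norm v"
    by (intro add_mono Cauchy_Schwarz_ip[of _ m] uv u v)
  finally have "col_norm (u + v) * col_norm (u + v) \<le> col_norm (u + v) * (col_norm u + col_norm v)"
    by (simp add: power2_eq_square distrib_left)
  then show ?thesis
    using col_norm_nonneg[of "u + v"] by (cases "col_norm (u + v) = 0") auto
qed

lemma norm_entry_le_col_norm:
  assumes u: "u \<in> carrier_mat m 1" and "i < m"
  shows "norm (u $$ (i, 0)) \<le> col_norm u"
proof -
  let ?f = "\<lambda>i. star (u $$ (i, 0)) * u $$ (i, 0)"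
  have "sum ?f {0..<m} = ?f i + sum ?f ({0..<m} - {i})"
    using \<open>i < m\<close> by (intro sum.remove) auto
  then have "nonneg (ip u u - ?f i)"
    by (simp add: ip_sum[OF u u] nonneg_sum nonneg_star_mult)
  then have "norm (?f i) \<le> norm (ip u u)"
    by (rule nonneg_norm_mono[OF nonneg_star_mult])
  then have "sqrt ((norm (u $$ (i, 0)))\<^sup>2) \<le> col_norm u"
    unfolding cstar_identity col_norm_def by (rule real_sqrt_le_mono)
  then show ?thesis by simp
qed

lemma col_norm_le_sum:
  assumes u: "u \<in> carrier_mat m 1"
  shows "col_norm u \<le> (\<Sum>i = 0..<m. norm (u $$ (i, 0)))"
proof -
  let ?a = "\<lambda>i. norm (u $$ (i, 0))"
  let ?S = "\<Sum>i = 0..<m. ?a i"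
  have "norm (ip u u) \<le> (\<Sum>i = 0..<m. ?a i * ?a i)"
    unfolding ip_sum[OF u u]
    by (rule sum_norm_le) (simp add: cstar_identity power2_eq_square)
  also have "\<dots> \<le> (\<Sum>i = 0..<m. ?a i * ?S)"
    by (intro sum_mono mult_left_mono) (auto intro!: member_le_sum)
  also have "\<dots> = ?S\<^sup>2" by (simp add: sum_distrib_right power2_eq_square)
  finally have "col_norm u \<le> sqrt (?S\<^sup>2)"
    unfolding col_norm_def by (rule real_sqrt_le_mono)
  then show ?thesis by (simp add: sum_nonneg)
qed

text \<open>Requiring \<open>0 <= K\<close> keeps the set bounded below even if every column has
  norm 0, as for \<open>n = 0\<close>.\<close>

definition op_norm :: "nat \<Rightarrow> 'a::cstar_algebra mat \<Rightarrow> real" where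
  "op_norm n V = Inf {K. 0 \<le> K \<and> (\<forall>x\<in>carrier_mat n 1. col_norm (V * x) \<le> K * col_norm x)}"

lemma col_norm_mult_le_entries:
  assumes V: "V \<in> carrier_mat n n" and x: "x \<in> carrier_mat n 1"
  shows "col_norm (V * x) \<le> (\<Sum>i = 0..<n. \<Sum>j = 0..<n. norm (V $$ (i, j))) * col_norm x"
proof -
  have "V * x \<in> carrier_mat n 1" using V x by auto
  then have "col_norm (V * x) \<le> (\<Sum>i = 0..<n. norm ((V * x) $$ (i, 0)))"
    by (rule col_norm_le_sum)
  also have "\<dots> \<le> (\<Sum>i = 0..<n. \<Sum>j = 0..<n. norm (V $$ (i, j)) * col_norm x)"
  proof (intro sum_mono)
    fix i assume "i \<in> {0..<n}"
    then have "(V * x) $$ (i, 0) = (\<Sum>j = 0..<n. V $$ (i, j) * x $$ (j, 0))"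
      using V x by (auto simp: scalar_prod_def intro!: sum.cong)
    also have "norm \<dots> \<le> (\<Sum>j = 0..<n. norm (V $$ (i, j)) * col_norm x)"
    proof (rule sum_norm_le)
      fix j assume "j \<in> {0..<n}"
      have "norm (V $$ (i, j) * x $$ (j, 0)) \<le> norm (V $$ (i, j)) * norm (x $$ (j, 0))"
        by (rule norm_mult_ineq)
      also have "\<dots> \<le> norm (V $$ (i, j)) * col_norm x"
        using \<open>j \<in> {0..<n}\<close> by (intro mult_left_mono norm_entry_le_col_norm[OF x]) auto
      finally show "norm (V $$ (i, j) * x $$ (j, 0)) \<le> norm (V $$ (i, j)) * col_norm x" .
    qed
    finally show "norm ((V * x) $$ (i, 0)) \<le> (\<Sum>j = 0..<n. norm (V $$ (i, j)) * col_norm x)" .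
  qed
  finally show ?thesis by (simp add: sum_distrib_right)
qed

lemma op_norm_le:
  assumes "0 \<le> K" "\<And>x. x \<in> carrier_mat n 1 \<Longrightarrow> col_norm (V * x) \<le> K * col_norm x"
  shows "op_norm n V \<le> K"
  unfolding op_norm_def
  by (rule cInf_lower) (use assms in \<open>auto intro: bdd_belowI[of _ 0]\<close>)

lemma op_norm_le_entries:
  assumes "V \<in> carrier_mat n n"
  shows "op_norm n V \<le> (\<Sum>i = 0..<n. \<Sum>j = 0..<n. norm (V $$ (i, j)))"
  by (rule op_norm_le) (auto intro!: sum_nonneg col_norm_mult_le_entries[OF assms])

lemma op_norm_witness:
  assumes "V \<in> carrier_mat n n"
  shows "{K. 0 \<le> K \<and> (\<forall>x\<in>carrier_mat n 1. col_norm (V * x) \<le> K * col_norm x)} \<noteq> {}"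
proof -
  have "0 \<le> (\<Sum>i = 0..<n. \<Sum>j = 0..<n. norm (V $$ (i, j)))" by (intro sum_nonneg) auto
  then show ?thesis using col_norm_mult_le_entries[OF assms] by blast
qed

lemma op_norm_nonneg: "V \<in> carrier_mat n n \<Longrightarrow> 0 \<le> op_norm n V"
  unfolding op_norm_def by (rule cInf_greatest[OF op_norm_witness]) auto

lemma op_norm_bound:
  assumes V: "V \<in> carrier_mat n n" and x: "x \<in> carrier_mat n 1"
  shows "col_norm (V * x) \<le> op_norm n V * col_norm x"
proof (cases "col_norm x = 0")
  case True
  then show ?thesis using col_norm_mult_le_entries[OF V x] by simp
next
  case False
  then have pos: "col_norm x > 0" using col_norm_nonneg[of x] by linarith
  have "col_norm (V * x) / col_norm x \<le> op_norm n V"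
    unfolding op_norm_def
    by (rule cInf_greatest[OF op_norm_witness[OF V]]) (use pos x in \<open>auto simp: divide_le_eq\<close>)
  then show ?thesis using pos by (simp add: divide_le_eq)
qed

text \<open>In place of a unit vector, the test column has the adjoint of the matrix entry in
  position \<open>j\<close>; the C*-identity then recovers the norm of the entry.\<close>

lemma norm_entry_le_op_norm:
  assumes V: "V \<in> carrier_mat n n" and ij: "i < n" "j < n"
  shows "norm (V $$ (i, j)) \<le> op_norm n V"
proof -
  define a where "a = star (V $$ (i, j))"
  define x where "x = mat n 1 (\<lambda>(k, l). if k = j then a else 0)"
  have x: "x \<in> carrier_mat n 1" by (simp add: x_def)
  have Vx: "V * x \<in> carrier_mat n 1" using V x by auto
  have "(V * x) $$ (i, 0) = (\<Sum>k = 0..<n. V $$ (i, k) * x $$ (k, 0))"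
    using V x ij by (auto simp: scalar_prod_def intro!: sum.cong)
  also have "\<dots> = (\<Sum>k = 0..<n. if k = j then V $$ (i, j) * a else 0)"
    by (intro sum.cong refl) (auto simp: x_def)
  also have "\<dots> = star a * a" using ij by (simp add: a_def)
  finally have 1: "norm ((V * x) $$ (i, 0)) = norm a * norm a"
    by (simp add: cstar_identity power2_eq_square)
  have "ip x x = (\<Sum>k = 0..<n. if k = j then star a * a else 0)"
    unfolding ip_sum[OF x x] by (intro sum.cong refl) (auto simp: x_def)
  then have 2: "col_norm x = norm a" using ij by (simp add: col_norm_def cstar_identity)
  have "norm a * norm a \<le> op_norm n V * norm a"
    using norm_entry_le_col_norm[OF Vx ij(1)] op_norm_bound[OF V x] unfolding 1 2 by linarith
  then have "norm a \<le> op_norm n V"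
    using op_norm_nonneg[OF V] by (cases "a = 0") auto
  then show ?thesis by (simp add: a_def)
qed

lemma op_norm_mult:
  assumes V: "V \<in> carrier_mat n n" and U: "U \<in> carrier_mat n n"
  shows "op_norm n (V * U) \<le> op_norm n V * op_norm n U"
proof (rule op_norm_le)
  fix x :: "'a mat" assume x: "x \<in> carrier_mat n 1"
  have "V * U * x = V * (U * x)" by (rule assoc_mult_mat[OF V U x])
  also have "col_norm \<dots> \<le> op_norm n V * col_norm (U * x)"
    using U x by (intro op_norm_bound[OF V]) auto
  also have "\<dots> \<le> op_norm n V * (op_norm n U * col_norm x)"
    by (intro mult_left_mono op_norm_bound U x op_norm_nonneg V)
  finally show "col_norm (V * U * x) \<le> op_norm n V * op_norm n U * col_norm x"
    by (simp add: mult.assoc)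
qed (intro mult_nonneg_nonneg op_norm_nonneg V U)

lemma op_norm_square_le:
  assumes V: "V \<in> carrier_mat n n"
  shows "(op_norm n V)\<^sup>2 \<le> op_norm n (mat_star V * V)"
proof -
  have VV: "mat_star V * V \<in> carrier_mat n n" using V by auto
  have "op_norm n V \<le> sqrt (op_norm n (mat_star V * V))"
  proof (rule op_norm_le)
    fix x :: "'a mat" assume x: "x \<in> carrier_mat n 1"
    have "(col_norm (V * x))\<^sup>2 = norm (ip x (mat_star V * V * x))"
      using V x by (simp add: col_norm_square ip_adjoint[of _ n n] assoc_mult_mat[of _ n n _ n _ 1])
    also have "\<dots> \<le> col_norm x * col_norm (mat_star V * V * x)"
      using V x by (intro Cauchy_Schwarz_ip[of _ n]) auto
    also have "\<dots> \<le> col_norm x * (op_norm n (mat_star V * V) * col_norm x)"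
      by (intro mult_left_mono op_norm_bound VV x) simp
    finally have "(col_norm (V * x))\<^sup>2 \<le> op_norm n (mat_star V * V) * (col_norm x)\<^sup>2"
      by (simp add: power2_eq_square mult_ac)
    then have "col_norm (V * x) \<le> sqrt (op_norm n (mat_star V * V) * (col_norm x)\<^sup>2)"
      by (rule real_le_rsqrt)
    then show "col_norm (V * x) \<le> sqrt (op_norm n (mat_star V * V)) * col_norm x"
      by (simp add: real_sqrt_mult)
  qed (simp add: op_norm_nonneg[OF VV])
  then have "(op_norm n V)\<^sup>2 \<le> (sqrt (op_norm n (mat_star V * V)))\<^sup>2"
    by (intro power_mono op_norm_nonneg V)
  then show ?thesis using op_norm_nonneg[OF VV] by simp
qed

lemma op_norm_star_le:
  assumes V: "V \<in> carrier_mat n n"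
  shows "op_norm n V \<le> op_norm n (mat_star V)"
proof (cases "op_norm n V = 0")
  case True
  then show ?thesis using op_norm_nonneg[of "mat_star V" n] V by simp
next
  case False
  have "op_norm n V * op_norm n V \<le> op_norm n (mat_star V) * op_norm n V"
    using op_norm_square_le[OF V] op_norm_mult[of "mat_star V" n V] V
    by (simp add: power2_eq_square)
  then show ?thesis using False op_norm_nonneg[OF V] by simp
qed

lemma op_norm_star_mult:
  assumes V: "V \<in> carrier_mat n n"
  shows "op_norm n (mat_star V * V) = (op_norm n V)\<^sup>2"
proof (rule antisym[OF _ op_norm_square_le[OF V]])
  have "op_norm n (mat_star V * V) \<le> op_norm n (mat_star V) * op_norm n V"
    using V by (intro op_norm_mult) auto
  also have "\<dots> \<le> op_norm n V * op_norm n V"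
    using op_norm_star_le[of "mat_star V" n] V by (intro mult_right_mono op_norm_nonneg) auto
  finally show "op_norm n (mat_star V * V) \<le> (op_norm n V)\<^sup>2" by (simp add: power2_eq_square)
qed

lemma op_norm_add:
  assumes V: "V \<in> carrier_mat n n" and U: "U \<in> carrier_mat n n"
  shows "op_norm n (V + U) \<le> op_norm n V + op_norm n U"
proof (rule op_norm_le)
  fix x :: "'a mat" assume x: "x \<in> carrier_mat n 1"
  have "col_norm ((V + U) * x) = col_norm (V * x + U * x)"
    by (simp add: add_mult_distrib_mat[OF V U x])
  also have "\<dots> \<le> col_norm (V * x) + col_norm (U * x)"
    using V U x by (intro col_norm_add[of _ n]) auto
  also have "\<dots> \<le> op_norm n V * col_norm x + op_norm n U * col_norm x"
    by (intro add_mono op_norm_bound V U x)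
  finally show "col_norm ((V + U) * x) \<le> (op_norm n V + op_norm n U) * col_norm x"
    by (simp add: distrib_right)
qed (intro add_nonneg_nonneg op_norm_nonneg V U)

lemma op_norm_scaleC:
  assumes V: "V \<in> carrier_mat n n"
  shows "op_norm n (mat_scaleC c V) = cmod c * op_norm n V"
proof -
  have le: "op_norm n (mat_scaleC d U) \<le> cmod d * op_norm n U"
    if U: "U \<in> carrier_mat n n" for d and U :: "'a mat"
  proof (rule op_norm_le)
    fix x :: "'a mat" assume x: "x \<in> carrier_mat n 1"
    have "col_norm (mat_scaleC d U * x) = cmod d * col_norm (U * x)"
      using U x by (simp add: mat_scaleC_mult_left[of _ n n] col_norm_scaleC[of _ n])
    also have "\<dots> \<le> cmod d * (op_norm n U * col_norm x)"
      by (intro mult_left_mono op_norm_bound U x) simp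
    finally show "col_norm (mat_scaleC d U * x) \<le> cmod d * op_norm n U * col_norm x"
      by (simp add: mult.assoc)
  qed (simp add: op_norm_nonneg[OF U])
  show ?thesis
  proof (cases "c = 0")
    case True
    then show ?thesis using le[OF V, of c] op_norm_nonneg[of "mat_scaleC c V" n] V by simp
  next
    case False
    have "op_norm n V \<le> cmod (1 / c) * op_norm n (mat_scaleC c V)"
      using le[of "mat_scaleC c V" "1 / c"] V False by simp
    then have "cmod c * op_norm n V \<le> op_norm n (mat_scaleC c V)"
      using False by (simp add: norm_divide field_simps)
    then show ?thesis using le[OF V, of c] by simp
  qed
qed

text \<open>The norm of each entry is at most the operator norm, which is at most the sum over all
  entries; so limits may be taken entry by entry.\<close>

lemma op_norm_complete:
  fixes S :: "nat \<Rightarrow> 'a::cstar_algebra mat"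
  assumes S: "\<And>k. S k \<in> carrier_mat n n"
    and Cauchy: "\<And>\<epsilon>. \<epsilon> > 0 \<Longrightarrow> \<exists>K. \<forall>k\<ge>K. \<forall>l\<ge>K. op_norm n (S k - S l) < \<epsilon>"
  shows "\<exists>L\<in>carrier_mat n n. (\<lambda>k. op_norm n (S k - L)) \<longlonglongrightarrow> 0"
proof -
  define L where "L = mat n n (\<lambda>(i, j). lim (\<lambda>k. S k $$ (i, j)))"
  have L: "L \<in> carrier_mat n n" by (simp add: L_def)
  have conv: "(\<lambda>k. S k $$ (i, j)) \<longlonglongrightarrow> L $$ (i, j)" if ij: "i < n" "j < n" for i j
  proof -
    have "Cauchy (\<lambda>k. S k $$ (i, j))"
    proof (rule CauchyI)
      fix e :: real assume "e > 0"
      from Cauchy[OF this] obtain K where K: "\<forall>k\<ge>K. \<forall>l\<ge>K. op_norm n (S k - S l) < e" by blast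
      have "norm (S k $$ (i, j) - S l $$ (i, j)) \<le> op_norm n (S k - S l)" for k l
        using norm_entry_le_op_norm[of "S k - S l" n i j] S[of k] S[of l] ij
        by (simp add: minus_carrier_mat)
      then show "\<exists>M. \<forall>m\<ge>M. \<forall>l\<ge>M. norm (S m $$ (i, j) - S l $$ (i, j)) < e"
        using K by (meson le_less_trans)
    qed
    then show ?thesis
      using ij by (simp add: L_def Cauchy_convergent_iff convergent_LIMSEQ_iff)
  qed
  have "(\<lambda>k. \<Sum>i = 0..<n. \<Sum>j = 0..<n. norm (S k $$ (i, j) - L $$ (i, j)))
      \<longlonglongrightarrow> (\<Sum>i = 0..<n. \<Sum>j = 0..<n. norm (L $$ (i, j) - L $$ (i, j)))"
    by (intro tendsto_intros conv) auto
  then have lim: "(\<lambda>k. \<Sum>i = 0..<n. \<Sum>j = 0..<n. norm (S k $$ (i, j) - L $$ (i, j))) \<longlonglongrightarrow> 0"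
    by simp
  have le: "op_norm n (S k - L) \<le> (\<Sum>i = 0..<n. \<Sum>j = 0..<n. norm (S k $$ (i, j) - L $$ (i, j)))" for k
  proof -
    have SL: "S k - L \<in> carrier_mat n n" using S[of k] L by (simp add: minus_carrier_mat)
    have "(\<Sum>i = 0..<n. \<Sum>j = 0..<n. norm ((S k - L) $$ (i, j)))
        = (\<Sum>i = 0..<n. \<Sum>j = 0..<n. norm (S k $$ (i, j) - L $$ (i, j)))"
      using S[of k] L by (intro sum.cong refl) auto
    then show ?thesis using op_norm_le_entries[OF SL] by simp
  qed
  have "(\<lambda>k. op_norm n (S k - L)) \<longlonglongrightarrow> 0"
  proof (rule tendsto_sandwich[OF _ _ tendsto_const lim])
    show "\<forall>\<^sub>F k in sequentially. 0 \<le> op_norm n (S k - L)"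
      using S L by (intro always_eventually allI op_norm_nonneg) (simp add: minus_carrier_mat)
  qed (use le in auto)
  with L show ?thesis by blast
qed

lemma op_norm_eq_0:
  assumes V: "V \<in> carrier_mat n n" and "op_norm n V = 0"
  shows "V = 0\<^sub>m n n"
proof (rule eq_matI)
  fix i j assume "i < dim_row (0\<^sub>m n n :: 'a mat)" "j < dim_col (0\<^sub>m n n :: 'a mat)"
  then show "V $$ (i, j) = 0\<^sub>m n n $$ (i, j)"
    using norm_entry_le_op_norm[OF V, of i j] assms(2) by simp
qed (use V in auto)

theorem is_cstar_norm_op_norm: "is_cstar_norm_mat n (op_norm n :: 'a::cstar_algebra mat \<Rightarrow> real)"
  unfolding is_cstar_norm_mat_def
proof (intro conjI ballI allI impI)
  fix X :: "'a mat" assume X: "X \<in> carrier_mat n n"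
  show "0 \<le> op_norm n X" by (rule op_norm_nonneg[OF X])
  have "op_norm n (0\<^sub>m n n :: 'a mat) \<le> 0"
    using op_norm_le_entries[of "0\<^sub>m n n :: 'a mat" n] by simp
  then show "(op_norm n X = 0) = (X = 0\<^sub>m n n)"
    using op_norm_eq_0[OF X] op_norm_nonneg[OF X] by auto
next
  fix S :: "nat \<Rightarrow> 'a mat"
  assume "(\<forall>k. S k \<in> carrier_mat n n) \<and>
    (\<forall>\<epsilon>>0. \<exists>K. \<forall>k\<ge>K. \<forall>l\<ge>K. op_norm n (S k - S l) < \<epsilon>)"
  then show "\<exists>L\<in>carrier_mat n n. (\<lambda>k. op_norm n (S k - L)) \<longlonglongrightarrow> 0"
    by (intro op_norm_complete) auto
qed (rule op_norm_add op_norm_scaleC op_norm_mult op_norm_star_mult; assumption)+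

interpretation op_norm: cstar_norm_mat n "op_norm n" for n
  by standard (rule is_cstar_norm_op_norm)

text \<open>If \<open>Z\<^sup>*Z = K(2k - k\<^sup>2)\<close> with \<open>k\<close> self-adjoint, the difference below is
  \<open>\<langle>u - ku, u - ku\<rangle>\<close>.\<close>

lemma nonneg_ip_contraction:
  fixes Z :: "'a::cstar_algebra mat"
  assumes Z: "Z \<in> carrier_mat n n" and u: "u \<in> carrier_mat n 1" and K: "K > 0" "(op_norm n Z)\<^sup>2 \<le> K"
  shows "nonneg (ip u u - (1 / K) *\<^sub>R ip (Z * u) (Z * u))"
proof -
  define h where "h = mat_scaleC (complex_of_real (1 / K)) (mat_star Z * Z)"
  have h: "h \<in> carrier_mat n n" using Z by (auto simp: h_def)
  have "mat_star h = h"
    using Z by (simp add: h_def mat_star_mult[of _ n n _ n])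
  moreover have "op_norm n h \<le> 1"
    using Z K op_norm_star_mult[OF Z]
    by (simp add: h_def op_norm_scaleC mult_carrier_mat[of _ n n] norm_divide)
  ultimately obtain k where k: "k \<in> carrier_mat n n" "mat_star k = k" "k + k = h + k * k"
    using op_norm.mat_one_minus_sqrt[OF h] by metis
  have ku: "k * u \<in> carrier_mat n 1" "k * (k * u) \<in> carrier_mat n 1" "h * u \<in> carrier_mat n 1"
    using k(1) h u by auto
  have ZZu: "mat_star Z * (Z * u) \<in> carrier_mat n 1" using Z u by auto
  have "(k + k) * u = (h + k * k) * u" by (simp only: k(3))
  then have "k * u + k * u = h * u + k * (k * u)"
    using k(1) u h by (simp add: add_mult_distrib_mat[of _ n n _ _ 1] assoc_mult_mat[of _ n n _ n _ 1])
  then have "ip u (k * u + k * u) = ip u (h * u + k * (k * u))" by (simp only:)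
  then have 1: "ip u (k * u) + ip u (k * u) = ip u (h * u) + ip u (k * (k * u))"
    by (simp only: ip_add_right[OF u ku(1,1)] ip_add_right[OF u ku(3,2)])
  have adj: "ip (k * u) v = ip u (k * v)" if "v \<in> carrier_mat n 1" for v
    using ip_adjoint[OF k(1) u that] k(2) by simp
  have "ip (u - k * u) (u - k * u) = ip u u - ip u (k * u) - (ip u (k * u) - ip u (k * (k * u)))"
    using u ku by (simp add: ip_minus_left[of _ n] ip_minus_right[of _ n] adj minus_carrier_mat)
  also have "\<dots> = ip u u - (ip u (k * u) + ip u (k * u)) + ip u (k * (k * u))"
    by (simp add: algebra_simps)
  also have "\<dots> = ip u u - ip u (h * u)" unfolding 1 by simp
  also have "ip u (h * u) = (1 / K) *\<^sub>R ip (Z * u) (Z * u)"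
    using Z u ZZu
    by (simp add: h_def mat_scaleC_mult_left[of _ n n _ 1] assoc_mult_mat[of _ n n _ n _ 1]
        ip_adjoint[of _ n n] ip_scaleC_right[of _ n] flip: scaleC_of_real)
  finally show ?thesis
    using nonneg_ip[of "u - k * u" n] u ku by (simp add: minus_carrier_mat)
qed

section \<open>Unital hereditary subalgebras are matrix order unit ideals\<close>

lemma diag_copies_carrier [simp]: "diag_copies n c \<in> carrier_mat n n"
  by (simp add: diag_copies_def)

lemma diag_copies_dim [simp]: "dim_row (diag_copies n c) = n" "dim_col (diag_copies n c) = n"
  by (simp_all add: diag_copies_def)

lemma diag_copies_index [simp]:
  "i < n \<Longrightarrow> j < n \<Longrightarrow> diag_copies n c $$ (i, j) = (if i = j then c else 0)"
  by (simp add: diag_copies_def)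

lemma index_mult_sum:
  assumes "A \<in> carrier_mat nr n" "B \<in> carrier_mat n nc" "i < nr" "j < nc"
  shows "(A * B) $$ (i, j) = (\<Sum>k = 0..<n. A $$ (i, k) * B $$ (k, j))"
  using assms by (auto simp: scalar_prod_def intro!: sum.cong)

lemma index_diag_copies_mult:
  assumes "V \<in> carrier_mat n m" "i < n" "j < m"
  shows "(diag_copies n c * V) $$ (i, j) = c * (V $$ (i, j) :: 'a::cstar_algebra)"
proof -
  have "(diag_copies n c * V) $$ (i, j) = (\<Sum>k = 0..<n. diag_copies n c $$ (i, k) * V $$ (k, j))"
    using assms by (intro index_mult_sum[of _ n n]) auto
  also have "\<dots> = (\<Sum>k = 0..<n. if k = i then c * V $$ (i, j) else 0)"
    using assms by (intro sum.cong refl) auto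
  finally show ?thesis using assms by simp
qed

lemma mat_star_diag_copies: "mat_star (diag_copies n c) = diag_copies n (star c)"
  by (rule eq_matI) auto

lemma diag_copies_scaleR: "diag_copies n (r *\<^sub>R c) = mat_scaleC (complex_of_real r) (diag_copies n c)"
  by (rule eq_matI) (auto simp: scaleC_of_real)

lemma mat_star_four_block:
  assumes "A \<in> carrier_mat n n" "B \<in> carrier_mat n n" "C \<in> carrier_mat n n" "D \<in> carrier_mat n n"
  shows "mat_star (four_block_mat A B C D)
    = four_block_mat (mat_star A) (mat_star C) (mat_star B) (mat_star D)"
  using assms by (intro eq_matI) auto

lemma mat_scaleC_four_block:
  assumes "A \<in> carrier_mat n n" "B \<in> carrier_mat n n" "C \<in> carrier_mat n n" "D \<in> carrier_mat n n"
  shows "mat_scaleC c (four_block_mat A B C D)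
    = four_block_mat (mat_scaleC c A) (mat_scaleC c B) (mat_scaleC c C) (mat_scaleC c D)"
  using assms by (intro eq_matI) auto

definition stack :: "nat \<Rightarrow> 'a mat \<Rightarrow> 'a mat \<Rightarrow> 'a mat" where
  "stack n p q = mat (n + n) 1 (\<lambda>(i, j). if i < n then p $$ (i, 0) else q $$ (i - n, 0))"

lemma sum_split_half: "(\<Sum>i = 0..<n + n. f i) = (\<Sum>i = 0..<n. f i) + (\<Sum>i = 0..<n. f (n + i))"
  for f :: "nat \<Rightarrow> 'a::comm_monoid_add"
  using sum.atLeastLessThan_concat[of 0 n "n + n" f] sum.shift_bounds_nat_ivl[of f 0 n n]
  by (simp add: add.commute)

lemma ip_stack:
  assumes "p \<in> carrier_mat n 1" "q \<in> carrier_mat n 1" "p' \<in> carrier_mat n 1" "q' \<in> carrier_mat n 1"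
  shows "ip (stack n p q) (stack n p' q') = ip p p' + ip q q'"
proof -
  have "stack n p q \<in> carrier_mat (n + n) 1" "stack n p' q' \<in> carrier_mat (n + n) 1"
    by (simp_all add: stack_def)
  then show ?thesis
    using assms by (simp add: ip_sum[of _ "n + n"] ip_sum[of _ n] sum_split_half) (simp add: stack_def)
qed

lemma four_block_mult_stack:
  fixes A B C D p q :: "'a::cstar_algebra mat"
  assumes "A \<in> carrier_mat n n" "B \<in> carrier_mat n n" "C \<in> carrier_mat n n" "D \<in> carrier_mat n n"
    and "p \<in> carrier_mat n 1" "q \<in> carrier_mat n 1"
  shows "four_block_mat A B C D * stack n p q = stack n (A * p + B * q) (C * p + D * q)"
proof (rule eq_matI)
  fix i j assume "i < dim_row (stack n (A * p + B * q) (C * p + D * q))"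
    "j < dim_col (stack n (A * p + B * q) (C * p + D * q))"
  then have i: "i < n + n" and j: "j = 0" by (simp_all add: stack_def)
  let ?F = "four_block_mat A B C D"
  have car: "?F \<in> carrier_mat (n + n) (n + n)" "stack n p q \<in> carrier_mat (n + n) 1"
    using assms by (auto simp: stack_def)
  then have "(?F * stack n p q) $$ (i, 0)
      = (\<Sum>k = 0..<n + n. ?F $$ (i, k) * stack n p q $$ (k, 0))"
    using i by (intro index_mult_sum) auto
  also have "\<dots> = (\<Sum>k = 0..<n. (if i < n then A $$ (i, k) else C $$ (i - n, k)) * p $$ (k, 0))
      + (\<Sum>k = 0..<n. (if i < n then B $$ (i, k) else D $$ (i - n, k)) * q $$ (k, 0))"
    unfolding sum_split_half
    by (intro arg_cong2[where f = "(+)"] sum.cong refl) (use assms i in \<open>auto simp: stack_def\<close>)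
  also have "\<dots> = stack n (A * p + B * q) (C * p + D * q) $$ (i, 0)"
    using assms i by (auto simp: stack_def scalar_prod_def)
  finally show "(?F * stack n p q) $$ (i, j) = stack n (A * p + B * q) (C * p + D * q) $$ (i, j)"
    by (simp add: j)
qed (use assms in \<open>auto simp: stack_def\<close>)

text \<open>This links the list form in \<open>order_unit_for\<close> to the block form in
  \<open>determines_norms\<close>.\<close>

lemma four_block_1:
  "four_block_mat (diag_copies 1 a) (mat 1 1 (\<lambda>_. v)) (mat_star (mat 1 1 (\<lambda>_. v))) (diag_copies 1 a)
    = mat_of_rows_list 2 [[a, v], [star v, a]]"
  by (rule eq_matI) (auto simp: mat_of_rows_list_def less_Suc_eq numeral_2_eq_2)

lemma op_norm_1:
  assumes "V \<in> carrier_mat 1 1"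
  shows "op_norm 1 V = norm (V $$ (0, 0))"
  using op_norm_le_entries[OF assms] norm_entry_le_op_norm[OF assms, of 0 0] by simp

lemma csubspace_minus: "csubspace W \<Longrightarrow> x \<in> W \<Longrightarrow> - x \<in> W"
  unfolding csubspace_def by (metis scaleC_simps(2,4))

lemma csubspace_diff: "csubspace W \<Longrightarrow> x \<in> W \<Longrightarrow> y \<in> W \<Longrightarrow> x - y \<in> W"
  using csubspace_minus[of W y] unfolding csubspace_def by (metis diff_conv_add_uminus)

lemma csubspace_scaleR: "csubspace W \<Longrightarrow> x \<in> W \<Longrightarrow> r *\<^sub>R x \<in> W"
  unfolding csubspace_def by (metis scaleC_of_real)

section \<open>Self-adjoint subspaces with a unit of their own\<close>

locale unital_subspace =
  fixes W :: "'a::cstar_algebra set" and e :: 'a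
  assumes subspace: "csubspace W" and selfadjoint: "selfadjoint_set W"
    and e_in: "e \<in> W" and e_left: "x \<in> W \<Longrightarrow> e * x = x" and e_right: "x \<in> W \<Longrightarrow> x * e = x"
begin

lemma W_simps [simp]:
  "0 \<in> W" "x \<in> W \<Longrightarrow> y \<in> W \<Longrightarrow> x + y \<in> W" "x \<in> W \<Longrightarrow> c *\<^sub>C x \<in> W" "x \<in> W \<Longrightarrow> star x \<in> W"
  "x \<in> W \<Longrightarrow> r *\<^sub>R x \<in> W"
  using subspace selfadjoint csubspace_scaleR[OF subspace]
  by (auto simp: csubspace_def selfadjoint_set_def)

lemma star_e [simp]: "star e = e"
  using e_left[of "star e"] e_in by (metis W_simps(4) star_mult star_star)

lemma e_e [simp]: "e * e = e"
  by (rule e_left[OF e_in])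

lemma nonneg_e: "nonneg e"
  using nonneg_star_mult[of e] by simp

abbreviation E :: "nat \<Rightarrow> 'a mat" where "E n \<equiv> diag_copies n e"

lemma star_E [simp]: "mat_star (E n) = E n"
  by (simp add: mat_star_diag_copies)

lemma E_mult_left: "V \<in> mats_over n W \<Longrightarrow> E n * V = V"
  by (rule eq_matI)
    (auto simp: mats_over_def index_diag_copies_mult[of _ n n] e_left simp del: index_mult_mat(1))

lemma mats_over_star: "V \<in> mats_over n W \<Longrightarrow> mat_star V \<in> mats_over n W"
  by (auto simp: mats_over_def)

lemma E_mult_right:
  assumes "V \<in> mats_over n W"
  shows "V * E n = V"
proof -
  have "mat_star (E n * mat_star V) = mat_star (mat_star V)"
    using E_mult_left[OF mats_over_star[OF assms]] by simp
  then show ?thesis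
    using assms by (simp add: mats_over_def mat_star_mult[of _ n n _ n])
qed

lemma E_in: "E n \<in> mats_over n W"
  by (auto simp: mats_over_def e_in)

lemma E_E [simp]: "E n * E n = E n"
  by (rule E_mult_left[OF E_in])

text \<open>In the corner where \<open>E n\<close> is the unit,
  \<open>k = E n - sqrt (E n - h)\<close>, and \<open>D\<close> is \<open>E n - k\<close>.\<close>

lemma E_minus_sqrt:
  assumes h: "h \<in> carrier_mat n n" "mat_star h = h" "op_norm n h \<le> 1" "E n * h = h"
  obtains D where "D \<in> carrier_mat n n" "mat_star D = D" "D * D = E n - h" "E n * D = D" "D * E n = D"
proof -
  note mat_alg = op_norm.mat_alg[where n = n]
  obtain k where k: "k \<in> carrier_mat n n" "mat_star k = k" "k + k = h + k * k" "E n * k = k"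
    using op_norm.mat_one_minus_sqrt[OF h(1,3,2)] h(4) diag_copies_carrier by metis
  have "mat_star (E n * k) = mat_star k" by (simp only: k(4))
  then have kE: "k * E n = k" using k(1,2) by (simp add: mat_alg)
  show ?thesis
  proof
    show "mat_star (E n - k) = E n - k" using k(1,2) by (simp add: mat_alg)
    have "(E n - k) * (E n - k) = E n - ((k + k) - k * k)"
      using k(1,4) kE by (simp add: mat_alg) (intro eq_matI; auto simp del: index_mult_mat(1))
    also have "\<dots> = E n - h"
      unfolding k(3) using k(1) h(1) by (intro eq_matI) (auto simp del: index_mult_mat(1))
    finally show "(E n - k) * (E n - k) = E n - h" .
    show "E n * (E n - k) = E n - k" "(E n - k) * E n = E n - k"
      using k(1,4) kE by (simp_all add: mat_alg)
  qed (use k(1) in auto)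
qed

lemma block_contraction:
  assumes v: "v \<in> mats_over n W" and le: "op_norm n v \<le> 1"
  obtains Y where "Y \<in> carrier_mat (n + n) (n + n)"
    "mat_star Y * Y = four_block_mat (E n) v (mat_star v) (E n)"
proof -
  note mat_alg = op_norm.mat_alg[where n = n]
  have vM: "v \<in> carrier_mat n n" using v by (simp add: mats_over_def)
  define h where "h = v * mat_star v"
  have h: "h \<in> carrier_mat n n" "mat_star h = h" using vM by (auto simp: h_def mat_alg)
  have "op_norm n h \<le> 1"
    using op_norm_star_mult[of "mat_star v" n] op_norm.N_star[OF vM] vM le op_norm_nonneg[OF vM]
    by (simp add: h_def power_le_one)
  moreover have "E n * h = h"
    using vM E_mult_left[OF v] by (simp add: h_def flip: assoc_mult_mat[of _ n n _ n _ n])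
  ultimately obtain D where D: "D \<in> carrier_mat n n" "mat_star D = D" "D * D = E n - h"
    using E_minus_sqrt h by metis
  define Y where "Y = four_block_mat D (0\<^sub>m n n) (mat_star v) (E n)"
  have "mat_star Y * Y = four_block_mat D v (0\<^sub>m n n) (E n) * Y"
    using D vM by (simp add: Y_def mat_star_four_block[of _ n])
  also have "\<dots> = four_block_mat (D * D + v * mat_star v) (D * 0\<^sub>m n n + v * E n)
      (0\<^sub>m n n * D + E n * mat_star v) (0\<^sub>m n n * 0\<^sub>m n n + E n * E n)"
    unfolding Y_def using D vM by (intro mult_four_block_mat[of _ n n _ n _ n]) auto
  also have "D * D + v * mat_star v = E n"
    unfolding D(3) using h(1) by (intro eq_matI) (auto simp: h_def simp del: index_mult_mat(1))
  also have "D * 0\<^sub>m n n + v * E n = v"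
    using D(1) vM E_mult_right[OF v] by simp
  also have "0\<^sub>m n n * D + E n * mat_star v = mat_star v"
    using D(1) vM E_mult_left[OF mats_over_star[OF v]] by simp
  also have "0\<^sub>m n n * 0\<^sub>m n n + E n * E n = E n" by simp
  finally have "mat_star Y * Y = four_block_mat (E n) v (mat_star v) (E n)" .
  moreover have "Y \<in> carrier_mat (n + n) (n + n)"
    unfolding Y_def using D vM by (intro four_block_carrier_mat) auto
  ultimately show ?thesis using that by blast
qed

lemma block_in_pos_mats_of:
  assumes v: "v \<in> mats_over n W" and le: "op_norm n v \<le> \<mu>" and "\<mu> > 0"
  shows "four_block_mat (diag_copies n (\<mu> *\<^sub>R e)) v (mat_star v) (diag_copies n (\<mu> *\<^sub>R e))
    \<in> pos_mats_of (2 * n) W" (is "?B \<in> _")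
proof -
  have vM: "v \<in> carrier_mat n n" using v by (simp add: mats_over_def)
  define w where "w = mat_scaleC (complex_of_real (1 / \<mu>)) v"
  have w: "w \<in> mats_over n W" "w \<in> carrier_mat n n" using v by (auto simp: w_def mats_over_def)
  have "op_norm n w \<le> 1"
    using le \<open>\<mu> > 0\<close> by (simp add: w_def op_norm_scaleC[OF vM] norm_divide)
  then obtain Y where Y: "Y \<in> carrier_mat (n + n) (n + n)"
    "mat_star Y * Y = four_block_mat (E n) w (mat_star w) (E n)"
    using block_contraction[OF w(1)] by blast
  define Z where "Z = mat_scaleC (complex_of_real (sqrt \<mu>)) Y"
  have "mat_star Z * Z = mat_scaleC (complex_of_real \<mu>) (mat_star Y * Y)"
    using Y(1) \<open>\<mu> > 0\<close>
    by (simp add: Z_def mat_scaleC_mult_left[of _ "n + n" "n + n" _ "n + n"]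
        mat_scaleC_mult_right[of _ "n + n" "n + n" _ "n + n"] flip: of_real_mult)
  also have "\<dots> = ?B"
    unfolding Y(2) using w vM \<open>\<mu> > 0\<close>
    by (simp add: mat_scaleC_four_block[of _ n] diag_copies_scaleR w_def)
  finally have "?B \<in> pos_mats (2 * n)"
    unfolding pos_mats_def using Y(1) by (auto simp: Z_def mult_2 intro!: exI[of _ Z])
  moreover have "?B \<in> sa_mats (2 * n) W"
    using vM v unfolding sa_mats_def mats_over_def
    by (auto simp: mat_star_four_block[of _ n] mat_star_diag_copies e_in mult_2)
  ultimately show ?thesis by (simp add: pos_mats_of_def)
qed

lemma nonneg_ip_E:
  assumes x: "x \<in> carrier_mat n 1"
  shows "nonneg (ip x x - ip (E n * x) (E n * x))"
proof -
  have Ex: "E n * x \<in> carrier_mat n 1" using x by auto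
  have adj: "ip (E n * x) w = ip x (E n * w)" if "w \<in> carrier_mat n 1" for w
    using ip_adjoint[OF diag_copies_carrier x that] by simp
  have EEx: "E n * (E n * x) = E n * x" using x by (simp flip: assoc_mult_mat[of _ n n _ n _ 1])
  have "ip (x - E n * x) (x - E n * x) = ip x x - ip (E n * x) (E n * x)"
    using x Ex by (simp add: ip_minus_left[of _ n] ip_minus_right[of _ n] adj EEx minus_carrier_mat)
  moreover have "x - E n * x \<in> carrier_mat n 1" using x Ex by (simp add: minus_carrier_mat)
  ultimately show ?thesis using nonneg_ip by metis
qed

lemma op_norm_le_if_block_pos:
  assumes v: "v \<in> mats_over n W" and "\<mu> > 0"
    and B: "four_block_mat (diag_copies n (\<mu> *\<^sub>R e)) v (mat_star v) (diag_copies n (\<mu> *\<^sub>R e))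
      \<in> pos_mats (2 * n)" (is "?B \<in> _")
  shows "op_norm n v \<le> \<mu>"
proof (rule op_norm_le)
  fix x :: "'a mat" assume x: "x \<in> carrier_mat n 1"
  let ?c = "complex_of_real \<mu>"
  have vM: "v \<in> carrier_mat n n" using v by (simp add: mats_over_def)
  obtain Y where Y: "Y \<in> carrier_mat (n + n) (n + n)" "?B = mat_star Y * Y"
    using B by (auto simp: pos_mats_def mult_2)
  note A = assoc_mult_mat[of _ n n _ n _ 1]
  define y where "y = E n * x"
  have y: "y \<in> carrier_mat n 1" "E n * y = y" "v * y = v * x"
    using x vM by (auto simp: y_def E_mult_right[OF v] simp flip: A)
  have vx: "v * x \<in> carrier_mat n 1" and vvx: "mat_star v * (v * x) \<in> carrier_mat n 1"
    using vM x by auto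
  have Evx: "E n * (v * x) = v * x" using E_mult_left[OF v] x vM by (simp flip: A)
  \<comment> \<open>The factor \<open>mu\<close> in \<open>q\<close> makes the first block row
    vanish: \<open>mu E (- v x) + v (mu E x) = 0\<close>. Only \<open>r\<close> remains, and pairing
    it with \<open>q\<close> gives \<open>mu\<close> times the difference
    \<open>mu^2 ip y y - ip (v x) (v x)\<close>.\<close>
  define p q where "p = mat_scaleC (- 1) (v * x)" and "q = mat_scaleC ?c y"
  have pq: "p \<in> carrier_mat n 1" "q \<in> carrier_mat n 1" using vx y by (auto simp: p_def q_def)
  define u where "u = stack n p q"
  have u: "u \<in> carrier_mat (n + n) 1" by (simp add: u_def stack_def)
  define r where "r = mat_scaleC (?c * ?c) y - mat_star v * (v * x)"
  have r: "r \<in> carrier_mat n 1" using y vvx by (auto simp: r_def minus_carrier_mat)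
  have Bu: "?B * u = stack n (0\<^sub>m n 1) r"
  proof -
    have "diag_copies n (\<mu> *\<^sub>R e) * p + v * q = 0\<^sub>m n 1"
      using vM vx y Evx
      by (simp add: diag_copies_scaleR p_def q_def mat_scaleC_mult_left[of _ n n _ 1]
          mat_scaleC_mult_right[of _ n n _ 1])
        (intro eq_matI; auto simp del: index_mult_mat(1))
    moreover have "mat_star v * p + diag_copies n (\<mu> *\<^sub>R e) * q = r"
      using vM vx vvx y
      by (simp add: diag_copies_scaleR p_def q_def r_def mat_scaleC_mult_left[of _ n n _ 1]
          mat_scaleC_mult_right[of _ n n _ 1])
        (intro eq_matI; auto simp del: index_mult_mat(1))
    ultimately show ?thesis
      using vM pq by (simp add: u_def four_block_mult_stack[of _ n])
  qed
  have "nonneg (ip (Y * u) (Y * u))" using Y(1) u by (intro nonneg_ip) auto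
  also have "ip (Y * u) (Y * u) = ip u (?B * u)"
    unfolding Y(2) using Y(1) u
    by (simp add: ip_adjoint[of _ "n + n" "n + n"] assoc_mult_mat[of _ "n + n" "n + n" _ "n + n" _ 1])
  also have "\<dots> = ip p (0\<^sub>m n 1) + ip q r"
    unfolding Bu unfolding u_def using pq r by (intro ip_stack) auto
  also have "ip p (0\<^sub>m n 1) = 0" using pq by (simp add: ip_sum[of _ n])
  also have "0 + ip q r = \<mu> *\<^sub>R (\<mu>\<^sup>2 *\<^sub>R ip y y - ip y (mat_star v * (v * x)))"
    using y r vvx
    by (simp add: q_def r_def ip_scaleC_left[of _ n] ip_scaleC_right[of _ n] ip_minus_right[of _ n]
        power2_eq_square scaleC_diff_right scaleC_scaleC mult_ac flip: scaleC_of_real)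
  also have "ip y (mat_star v * (v * x)) = ip (v * x) (v * x)"
    using ip_adjoint[OF vM y(1) vx] y(3) by simp
  finally have "nonneg ((1 / \<mu>) *\<^sub>R (\<mu> *\<^sub>R (\<mu>\<^sup>2 *\<^sub>R ip y y - ip (v * x) (v * x))))"
    by (rule nonneg_scaleR) (use \<open>\<mu> > 0\<close> in simp)
  then have 1: "nonneg (\<mu>\<^sup>2 *\<^sub>R ip y y - ip (v * x) (v * x))" using \<open>\<mu> > 0\<close> by simp
  \<comment> \<open>Passing from \<open>y = E x\<close> back to \<open>x\<close> only adds a
    positive term, since \<open>E\<close> is a projection.\<close>
  have 2: "nonneg (\<mu>\<^sup>2 *\<^sub>R (ip x x - ip y y))"
    unfolding y_def by (intro nonneg_scaleR nonneg_ip_E x) simp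
  have "nonneg (\<mu>\<^sup>2 *\<^sub>R ip x x - ip (v * x) (v * x))"
    using nonneg_add[OF 1 2] by (simp add: scaleR_diff_right)
  then have "norm (ip (v * x) (v * x)) \<le> norm (\<mu>\<^sup>2 *\<^sub>R ip x x)"
    by (intro nonneg_norm_mono nonneg_ip[OF vx])
  then have "(col_norm (v * x))\<^sup>2 \<le> (\<mu> * col_norm x)\<^sup>2"
    by (simp add: col_norm_square power_mult_distrib)
  then show "col_norm (v * x) \<le> \<mu> * col_norm x"
    by (rule power2_le_imp_le) (use \<open>\<mu> > 0\<close> in simp)
qed (use \<open>\<mu> > 0\<close> in simp)

text \<open>With \<open>u = E x\<close>, \<open>y = Y u\<close> and \<open>z = u - V u / t\<close>,
  the difference \<open>ip u u - ip z z\<close> is the sum of \<open>ip y y / t\<close> and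
  \<open>(ip y y - b / t) / t\<close>. The second term is positive because \<open>mat_star Y\<close>
  has squared norm at most \<open>t\<close>.\<close>

lemma op_norm_unit_minus_le:
  assumes Y: "Y \<in> carrier_mat n n" and V: "V = mat_star Y * Y" "V \<in> mats_over n W"
    and t: "t > 0" "op_norm n V \<le> t"
  shows "op_norm n (E n - mat_scaleC (complex_of_real (1 / t)) V) \<le> 1"
proof (rule op_norm_le)
  fix x :: "'a mat" assume x: "x \<in> carrier_mat n 1"
  note A = assoc_mult_mat[of _ n n _ n _ 1]
  have VM: "V \<in> carrier_mat n n" using V(2) by (simp add: mats_over_def)
  define u where "u = E n * x"
  have u: "u \<in> carrier_mat n 1" using x by (auto simp: u_def)
  define y where "y = Y * u"
  have y: "y \<in> carrier_mat n 1" "mat_star Y * y \<in> carrier_mat n 1" using Y u by (auto simp: y_def)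
  define z where "z = (E n - mat_scaleC (complex_of_real (1 / t)) V) * x"
  have z: "z = u - mat_scaleC (complex_of_real (1 / t)) (mat_star Y * y)"
  proof -
    have "V * x = V * u" using x VM by (simp add: u_def E_mult_right[OF V(2)] flip: A)
    also have "\<dots> = mat_star Y * y" using Y u by (simp add: V(1) y_def A)
    finally have "V * x = mat_star Y * y" .
    then show ?thesis
      using x VM by (simp add: z_def u_def minus_mult_distrib_mat[of _ n n _ _ 1]
          mat_scaleC_mult_left[of _ n n _ 1])
  qed
  have yy: "ip u (mat_star Y * y) = ip y y" "ip (mat_star Y * y) u = ip y y"
    using ip_adjoint[OF Y u y(1)] star_ip[OF u y(2)] star_ip[OF y(1) y(1)]
    by (simp_all add: y_def[symmetric])
  define b where "b = ip (mat_star Y * y) (mat_star Y * y)"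
  have "ip z z = ip u u - (1 / t) *\<^sub>R ip y y - (1 / t) *\<^sub>R (ip y y - (1 / t) *\<^sub>R b)"
    unfolding z using u y
    by (simp add: ip_minus_left[of _ n] ip_minus_right[of _ n] ip_scaleC_left[of _ n]
        ip_scaleC_right[of _ n] yy b_def scaleC_scaleC scaleC_diff_right minus_carrier_mat
        flip: scaleC_of_real)
  then have "ip u u - ip z z = (1 / t) *\<^sub>R ip y y + (1 / t) *\<^sub>R (ip y y - (1 / t) *\<^sub>R b)"
    by simp
  moreover have "nonneg ((1 / t) *\<^sub>R ip y y + (1 / t) *\<^sub>R (ip y y - (1 / t) *\<^sub>R b))"
  proof -
    have "(op_norm n (mat_star Y))\<^sup>2 \<le> t"
      using t(2) op_norm_star_mult[OF Y] op_norm.N_star[OF Y] by (simp add: V(1))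
    then have "nonneg (ip y y - (1 / t) *\<^sub>R b)"
      unfolding b_def using Y y(1) t(1) by (intro nonneg_ip_contraction) auto
    then show ?thesis
      using t(1) nonneg_ip[OF y(1)] by (intro nonneg_add nonneg_scaleR) auto
  qed
  ultimately have "nonneg (ip u u - ip z z)" by (simp only:)
  then have "nonneg (ip x x - ip z z)"
    using nonneg_add[OF nonneg_ip_E[OF x]] by (fastforce simp: u_def)
  moreover have "z \<in> carrier_mat n 1"
    unfolding z using u y by (simp add: minus_carrier_mat)
  then have "nonneg (ip z z)" by (rule nonneg_ip)
  ultimately show "col_norm ((E n - mat_scaleC (complex_of_real (1 / t)) V) * x) \<le> 1 * col_norm x"
    unfolding z_def[symmetric] mult_1 by (intro col_norm_mono)
qed simp

text \<open>A positive matrix \<open>V\<close> over \<open>W\<close> of norm at most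
  \<open>t\<close> makes \<open>E - V / t\<close> a contraction. This condition is closed, so it
  passes from \<open>k w + v\<close> to \<open>v\<close> as \<open>k\<close> tends to 0; there it
  makes \<open>v / t = E - h\<close> the square of some \<open>D\<close>.\<close>

lemma unital_archimedean: "archimedean_level n W"
  unfolding archimedean_level_def
proof (intro ballI impI)
  fix v w :: "'a mat"
  assume v: "v \<in> sa_mats n W" and w: "w \<in> pos_mats_of n W"
    and pos: "\<forall>k>0. mat_scaleC (complex_of_real k) w + v \<in> pos_mats_of n W"
  have vW: "v \<in> mats_over n W" "v \<in> carrier_mat n n" "mat_star v = v"
    using v by (auto simp: sa_mats_def mats_over_def)
  have wM: "w \<in> carrier_mat n n" using w by (auto simp: pos_mats_of_def sa_mats_def mats_over_def)
  \<comment> \<open>Large enough for \<open>k w + v\<close> with all \<open>0 < k < 1\<close> at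
    once, and positive.\<close>
  define t where "t = op_norm n v + op_norm n w + 1"
  have t: "t > 0" using op_norm_nonneg[OF vW(2)] op_norm_nonneg[OF wM] by (simp add: t_def)
  let ?c = "complex_of_real (1 / t)"
  define h where "h = E n - mat_scaleC ?c v"
  have h: "h \<in> carrier_mat n n" "mat_star h = h"
    using vW by (simp_all add: h_def mat_star_minus[of _ n n] minus_carrier_mat)
  have bound: "op_norm n h \<le> 1 + k * (op_norm n w / t)" if k: "0 < k" "k < 1" for k
  proof -
    define V where "V = mat_scaleC (complex_of_real k) w + v"
    have "V \<in> pos_mats_of n W" using pos k by (simp add: V_def)
    then obtain Y where Y: "Y \<in> carrier_mat n n" "V = mat_star Y * Y" and V: "V \<in> mats_over n W"
      by (auto simp: pos_mats_of_def pos_mats_def sa_mats_def)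
    have VM: "V \<in> carrier_mat n n" using V by (simp add: mats_over_def)
    have "op_norm n V \<le> k * op_norm n w + op_norm n v"
      using op_norm_add[of "mat_scaleC (complex_of_real k) w" n v] op_norm_scaleC[OF wM, of "complex_of_real k"]
        wM vW k by (simp add: V_def)
    also have "\<dots> \<le> t"
      using mult_right_mono[of k 1 "op_norm n w"] op_norm_nonneg[OF wM] k by (simp add: t_def)
    finally have 1: "op_norm n (E n - mat_scaleC ?c V) \<le> 1"
      by (rule op_norm_unit_minus_le[OF Y V t])
    have "h = (E n - mat_scaleC ?c V) + mat_scaleC (complex_of_real (k / t)) w"
      unfolding h_def V_def using vW wM
      by (intro eq_matI) (auto simp: scaleC_add_right scaleC_scaleC)
    then have "op_norm n h \<le> op_norm n (E n - mat_scaleC ?c V)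
        + op_norm n (mat_scaleC (complex_of_real (k / t)) w)"
      using VM wM by (simp only:) (intro op_norm_add; simp add: minus_carrier_mat)
    also have "op_norm n (mat_scaleC (complex_of_real (k / t)) w) = k * (op_norm n w / t)"
      using k t unfolding op_norm_scaleC[OF wM] by (simp add: norm_divide)
    finally show ?thesis using 1 by simp
  qed
  have "op_norm n h \<le> 1"
  proof (rule tendsto_lowerbound)
    show "((\<lambda>k. 1 + k * (op_norm n w / t)) \<longlongrightarrow> 1) (at_right 0)"
      using t by (auto intro!: tendsto_eq_intros)
    show "\<forall>\<^sub>F k in at_right 0. op_norm n h \<le> 1 + k * (op_norm n w / t)"
      using eventually_at_right_less[of 0]
      by (intro eventually_at_rightI[of 0 1]) (use bound in auto)
  qed simp
  moreover have "E n * h = h"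
    using vW by (simp add: h_def mult_minus_distrib_mat[of _ n n _ n] mat_scaleC_mult_right[of _ n n _ n]
        E_mult_left)
  ultimately obtain D where D: "D \<in> carrier_mat n n" "mat_star D = D" "D * D = E n - h"
    using E_minus_sqrt h by metis
  define Y where "Y = mat_scaleC (complex_of_real (sqrt t)) D"
  have "mat_star Y * Y = mat_scaleC (complex_of_real t) (D * D)"
    using D t by (simp add: Y_def mat_scaleC_mult_left[of _ n n _ n]
        mat_scaleC_mult_right[of _ n n _ n] flip: of_real_mult)
  also have "\<dots> = v"
    unfolding D(3) h_def using vW t
    by (intro eq_matI) (auto simp: scaleC_diff_right scaleC_scaleC)
  finally have "v \<in> pos_mats n" unfolding pos_mats_def using D by (auto simp: Y_def intro!: exI[of _ Y])
  then show "v \<in> pos_mats_of n W" using v by (simp add: pos_mats_of_def)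
qed

lemma unital_determines_norms: "determines_norms W e"
  unfolding determines_norms_def
proof (intro allI impI ballI)
  fix n :: nat and v :: "'a mat"
  assume v: "v \<in> mats_over n W"
  let ?S = "{\<mu>::real. \<mu> > 0 \<and> four_block_mat (diag_copies n (\<mu> *\<^sub>R e)) v (mat_star v)
    (diag_copies n (\<mu> *\<^sub>R e)) \<in> pos_mats_of (2 * n) W}"
  have vM: "v \<in> carrier_mat n n" using v by (simp add: mats_over_def)
  have nn: "0 \<le> op_norm n v" by (rule op_norm_nonneg[OF vM])
  \<comment> \<open>The inequality is strict because members of the set are positive: for
    \<open>v = 0\<close> the norm itself is not among them.\<close>
  have in_S: "\<mu> \<in> ?S" if "\<mu> > op_norm n v" for \<mu>
    using block_in_pos_mats_of[OF v, of \<mu>] that nn by auto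
  have "Inf ?S = op_norm n v"
  proof (rule antisym)
    show "Inf ?S \<le> op_norm n v"
    proof (rule dense_ge)
      fix \<mu> assume "op_norm n v < \<mu>"
      then show "Inf ?S \<le> \<mu>" by (intro cInf_lower in_S) (auto intro: bdd_belowI[of _ 0])
    qed
    have "op_norm n v + 1 \<in> ?S" by (rule in_S) simp
    then have "?S \<noteq> {}" by blast
    then show "op_norm n v \<le> Inf ?S"
      by (rule cInf_greatest) (auto simp: pos_mats_of_def intro: op_norm_le_if_block_pos[OF v])
  qed
  then show "mat_norm n v = Inf ?S" using op_norm.mat_norm_eq[OF vM] by simp
qed

lemma unital_order_unit: "order_unit_for W e"
  unfolding order_unit_for_def
proof (intro conjI ballI)
  show "e \<in> pos_of W" using e_in nonneg_e by (simp add: pos_of_def pos_elems_iff)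
  fix v assume v: "v \<in> W"
  define V where "V = mat 1 1 (\<lambda>_. v)"
  have V: "V \<in> mats_over 1 W" "V \<in> carrier_mat 1 1" using v by (auto simp: V_def mats_over_def)
  have "op_norm 1 V \<le> norm v + 1" unfolding op_norm_1[OF V(2)] by (simp add: V_def)
  from block_in_pos_mats_of[OF V(1) this]
  have "mat_of_rows_list 2 [[(norm v + 1) *\<^sub>R e, v], [star v, (norm v + 1) *\<^sub>R e]] \<in> pos_mats_of 2 W"
    unfolding V_def four_block_1 by (simp add: add_nonneg_pos)
  then show "\<exists>k::real. k > 0 \<and>
      mat_of_rows_list 2 [[k *\<^sub>R e, v], [star v, k *\<^sub>R e]] \<in> pos_mats_of 2 W"
    by (intro exI[of _ "norm v + 1"]) (simp add: add_nonneg_pos)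
qed

end

lemma proper_pos_of: "0 \<in> W \<Longrightarrow> proper_cone (pos_of W)"
  using nonneg_antisym by (auto simp: proper_cone_def pos_of_def pos_elems_iff)

theorem matrix_order_unit_ideal_if_unital_hereditary:
  assumes "cstar_subalgebra W" "hereditary W" "has_own_identity W"
  shows "\<exists>e\<in>pos_of W. matrix_order_unit_ideal W e"
proof -
  obtain e where e: "e \<in> W" "\<forall>x\<in>W. e * x = x \<and> x * e = x"
    using assms(3) by (auto simp: has_own_identity_def)
  interpret unital_subspace W e
    by standard (use assms(1) e in \<open>auto simp: cstar_subalgebra_def\<close>)
  have "matrix_order_ideal W"
    using subspace selfadjoint assms(2)
    unfolding matrix_order_ideal_def hereditary_def
    by (auto simp: pos_of_def pos_elems_iff nonneg_selfadjoint)
  then have "matrix_order_unit_ideal W e"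
    unfolding matrix_order_unit_ideal_def
    using unital_order_unit unital_archimedean unital_determines_norms proper_pos_of[OF W_simps(1)] by simp
  then show ?thesis using unital_order_unit by (auto simp: order_unit_for_def)
qed

section \<open>Matrix order unit ideals are unital hereditary subalgebras\<close>

text \<open>Evaluating the block matrix at the column \<open>(1, -1)\<close> gives
  \<open>2 (a - v)\<close>. In the absence of a unit this is done on the factor: \<open>?y\<close>
  and \<open>?z\<close> are the entries of the difference of the two columns of
  \<open>Y\<close>.\<close>

lemma nonneg_if_block_pos:
  assumes "mat_of_rows_list 2 [[a, v], [star v, a]] \<in> pos_mats 2" "star v = (v::'a::cstar_algebra)"
  shows "nonneg (a - v)"
proof -
  obtain Y :: "'a mat" where Y: "Y \<in> carrier_mat 2 2"
    "mat_of_rows_list 2 [[a, v], [star v, a]] = mat_star Y * Y"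
    using assms(1) by (auto simp: pos_mats_def)
  have entry: "mat_of_rows_list 2 [[a, v], [star v, a]] $$ (i, j)
      = star (Y $$ (0, i)) * Y $$ (0, j) + star (Y $$ (1, i)) * Y $$ (1, j)" if "i < 2" "j < 2" for i j
  proof -
    have "(mat_star Y * Y) $$ (i, j) = (\<Sum>k = 0..<2. mat_star Y $$ (i, k) * Y $$ (k, j))"
      using Y(1) that by (intro index_mult_sum[of _ 2 2]) auto
    then show ?thesis using Y that by (simp add: numeral_2_eq_2)
  qed
  let ?y = "Y $$ (0, 0) - Y $$ (0, 1)" and ?z = "Y $$ (1, 0) - Y $$ (1, 1)"
  have 1: "star (Y $$ (0, 0)) * Y $$ (0, 0) + star (Y $$ (1, 0)) * Y $$ (1, 0) = a"
    and 2: "star (Y $$ (0, 0)) * Y $$ (0, 1) + star (Y $$ (1, 0)) * Y $$ (1, 1) = v"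
    and 3: "star (Y $$ (0, 1)) * Y $$ (0, 0) + star (Y $$ (1, 1)) * Y $$ (1, 0) = v"
    and 4: "star (Y $$ (0, 1)) * Y $$ (0, 1) + star (Y $$ (1, 1)) * Y $$ (1, 1) = a"
    using entry[of 0 0] entry[of 0 1] entry[of 1 0] entry[of 1 1] assms(2)
    by (simp_all add: mat_of_rows_list_def)
  have "star ?y * ?y + star ?z * ?z
    = (star (Y $$ (0, 0)) * Y $$ (0, 0) + star (Y $$ (1, 0)) * Y $$ (1, 0))
    - (star (Y $$ (0, 0)) * Y $$ (0, 1) + star (Y $$ (1, 0)) * Y $$ (1, 1))
    - (star (Y $$ (0, 1)) * Y $$ (0, 0) + star (Y $$ (1, 1)) * Y $$ (1, 0))
    + (star (Y $$ (0, 1)) * Y $$ (0, 1) + star (Y $$ (1, 1)) * Y $$ (1, 1))"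
    by (simp add: star_diff algebra_simps)
  also have "\<dots> = 2 *\<^sub>R (a - v)" unfolding 1 2 3 4 by (simp add: scaleR_2)
  finally have "nonneg (2 *\<^sub>R (a - v))"
    by (metis nonneg_add nonneg_star_mult)
  then have "nonneg ((1/2) *\<^sub>R 2 *\<^sub>R (a - v))" by (rule nonneg_scaleR) simp
  then show ?thesis by simp
qed

text \<open>The explicit formulas are part of the result so that membership of \<open>u\<close> and
  \<open>v\<close> in a self-adjoint subspace can be read off.\<close>

lemma real_imaginary_parts:
  fixes x :: "'a::cstar_algebra"
  obtains u v where "star u = u" "star v = v" "x = u + \<i> *\<^sub>C v"
    "u = (1/2) *\<^sub>R (x + star x)" "v = (1/2) *\<^sub>R (\<i> *\<^sub>C (star x - x))"
proof
  let ?u = "(1/2) *\<^sub>R (x + star x)" and ?v = "(1/2) *\<^sub>R (\<i> *\<^sub>C (star x - x))"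
  show "star ?u = ?u" by (simp add: star_add add.commute)
  show "star ?v = ?v" by (simp add: star_scaleC star_diff scaleC_diff_right)
  have "\<i> *\<^sub>C (1/2) *\<^sub>R (\<i> *\<^sub>C y) = (1/2) *\<^sub>R (- y)" for y :: 'a
    by (simp add: scaleC_scaleC flip: scaleC_of_real)
  from this[of "star x - x"] have "\<i> *\<^sub>C ?v = (1/2) *\<^sub>R (x - star x)"
    by (simp only: minus_diff_eq)
  then have "?u + \<i> *\<^sub>C ?v = (1/2) *\<^sub>R (x + x)" by (simp flip: scaleR_add_right)
  then show "x = ?u + \<i> *\<^sub>C ?v" by (simp only: scaleR_half_double)
qed (rule refl)+

section \<open>The order unit as a projection, and its corner\<close>

locale order_unit_ideal =
  fixes W :: "'a::cstar_algebra set" and e :: 'a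
  assumes moui: "matrix_order_unit_ideal W e"
begin

lemma subspace: "csubspace W" and selfadjoint: "selfadjoint_set W"
  and order_unit: "order_unit_for W e" and norms: "determines_norms W e"
  using moui by (auto simp: matrix_order_unit_ideal_def matrix_order_ideal_def)

lemma W_closed:
  "x \<in> W \<Longrightarrow> y \<in> W \<Longrightarrow> x + y \<in> W" "x \<in> W \<Longrightarrow> y \<in> W \<Longrightarrow> x - y \<in> W" "x \<in> W \<Longrightarrow> - x \<in> W"
  "x \<in> W \<Longrightarrow> star x \<in> W" "x \<in> W \<Longrightarrow> r *\<^sub>R x \<in> W" "x \<in> W \<Longrightarrow> c *\<^sub>C x \<in> W"
  using subspace selfadjoint csubspace_diff[OF subspace] csubspace_minus[OF subspace]
    csubspace_scaleR[OF subspace]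
  by (auto simp: csubspace_def selfadjoint_set_def)

lemma order_idealD:
  assumes "nonneg v" "nonneg (w - v)" "nonneg w" "w \<in> W"
  shows "v \<in> W"
proof -
  have "w \<in> pos_of W"
    using assms by (simp add: pos_of_def pos_elems_iff nonneg_selfadjoint)
  then have "v \<in> pos_of W"
    using moui assms(1,2)
    unfolding matrix_order_unit_ideal_def matrix_order_ideal_def pos_elems_iff[symmetric] by blast
  then show ?thesis by (simp add: pos_of_def)
qed

lemma e_in: "e \<in> W" and nonneg_e: "nonneg e" and star_e: "star e = e"
  using order_unit by (auto simp: order_unit_for_def pos_of_def pos_elems_iff)

lemma order_unitD:
  assumes "v \<in> W" "star v = v"
  obtains k where "k > 0" "nonneg (k *\<^sub>R e - v)"
proof -
  obtain k :: real where "k > 0" "mat_of_rows_list 2 [[k *\<^sub>R e, v], [star v, k *\<^sub>R e]] \<in> pos_mats_of 2 W"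
    using order_unit assms(1) by (auto simp: order_unit_for_def)
  then have "mat_of_rows_list 2 [[k *\<^sub>R e, v], [star v, k *\<^sub>R e]] \<in> pos_mats 2"
    by (simp add: pos_mats_of_def)
  with \<open>k > 0\<close> show ?thesis using that nonneg_if_block_pos[OF _ assms(2)] by blast
qed

lemma norm_eq_Inf:
  assumes "v \<in> W"
  shows "norm v = Inf {\<mu>::real. \<mu> > 0 \<and>
    mat_of_rows_list 2 [[\<mu> *\<^sub>R e, v], [star v, \<mu> *\<^sub>R e]] \<in> pos_mats_of 2 W}"
proof -
  define V where "V = mat 1 1 (\<lambda>_. v)"
  have V: "V \<in> mats_over 1 W" "V \<in> carrier_mat 1 1" using assms by (auto simp: V_def mats_over_def)
  have "mat_norm 1 V = norm v"
    using op_norm.mat_norm_eq[OF V(2)] op_norm_1[OF V(2)] by (simp add: V_def)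
  moreover have "mat_norm 1 V = Inf {\<mu>::real. \<mu> > 0 \<and>
    four_block_mat (diag_copies 1 (\<mu> *\<^sub>R e)) V (mat_star V) (diag_copies 1 (\<mu> *\<^sub>R e))
      \<in> pos_mats_of (2 * 1) W}"
    using norms V(1) unfolding determines_norms_def by blast
  ultimately show ?thesis unfolding V_def four_block_1 mult_1_right by simp
qed

text \<open>The infimum is not known to be attained, so a positive parameter is added to the
  coefficient of \<open>e\<close>; \<open>nonneg_limit\<close> removes it.\<close>

lemma le_e:
  assumes v: "v \<in> W" "star v = v" "norm v \<le> 1"
  shows "nonneg (e - v)"
proof (rule nonneg_limit)
  fix \<epsilon> :: real assume "\<epsilon> > 0"
  let ?S = "{\<mu>::real. \<mu> > 0 \<and>
    mat_of_rows_list 2 [[\<mu> *\<^sub>R e, v], [star v, \<mu> *\<^sub>R e]] \<in> pos_mats_of 2 W}"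
  \<comment> \<open>A small infimum yields a small member only for a nonempty set; the order unit
    property supplies a member.\<close>
  have "?S \<noteq> {}" using order_unit v(1) by (auto simp: order_unit_for_def)
  moreover have "Inf ?S < 1 + \<epsilon>" using norm_eq_Inf[OF v(1)] v(3) \<open>\<epsilon> > 0\<close> by simp
  ultimately obtain \<mu> where \<mu>: "\<mu> \<in> ?S" "\<mu> < 1 + \<epsilon>" by (rule cInf_lessD[elim_format]) blast
  then have "mat_of_rows_list 2 [[\<mu> *\<^sub>R e, v], [star v, \<mu> *\<^sub>R e]] \<in> pos_mats 2"
    by (simp add: pos_mats_of_def)
  then have "nonneg (\<mu> *\<^sub>R e - v)" by (rule nonneg_if_block_pos[OF _ v(2)])
  moreover have "nonneg ((1 + \<epsilon> - \<mu>) *\<^sub>R e)" using \<mu> by (intro nonneg_scaleR nonneg_e) simp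
  ultimately have "nonneg (\<mu> *\<^sub>R e - v + (1 + \<epsilon> - \<mu>) *\<^sub>R e)" by (rule nonneg_add)
  then show "nonneg (e - v + \<epsilon> *\<^sub>R e)" by (simp add: algebra_simps)
qed

text \<open>The matrix with all four entries \<open>e\<close> is \<open>mat_star Y * Y\<close> for
  \<open>Y\<close> with rows \<open>(y, y)\<close> and \<open>(0, 0)\<close>. So 1 belongs to the
  set whose infimum is the norm of \<open>e\<close>.\<close>

lemma norm_e_le: "norm e \<le> 1"
proof -
  obtain y where y: "e = star y * y"
    using nonneg_e by (auto simp: pos_elems_def simp flip: pos_elems_iff)
  define Y where "Y = mat_of_rows_list 2 [[y, y], [0, 0]]"
  have Y: "Y \<in> carrier_mat 2 2"
    by (rule carrier_matI) (simp_all add: Y_def mat_of_rows_list_def)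
  have YY: "mat_star Y * Y = mat_of_rows_list 2 [[1 *\<^sub>R e, e], [star e, 1 *\<^sub>R e]]"
  proof (rule eq_matI)
    fix i j assume "i < dim_row (mat_of_rows_list 2 [[1 *\<^sub>R e, e], [star e, 1 *\<^sub>R e]])"
      "j < dim_col (mat_of_rows_list 2 [[1 *\<^sub>R e, e], [star e, 1 *\<^sub>R e]])"
    then have ij: "i < 2" "j < 2" by (simp_all add: mat_of_rows_list_def)
    have "(mat_star Y * Y) $$ (i, j) = (\<Sum>k = 0..<2. mat_star Y $$ (i, k) * Y $$ (k, j))"
      using Y ij by (intro index_mult_sum[of _ 2 2]) auto
    also have "\<dots> = e"
      using Y ij by (auto simp: numeral_2_eq_2 less_Suc_eq y) (auto simp: Y_def mat_of_rows_list_def)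
    finally show "(mat_star Y * Y) $$ (i, j)
        = mat_of_rows_list 2 [[1 *\<^sub>R e, e], [star e, 1 *\<^sub>R e]] $$ (i, j)"
      using ij by (auto simp: mat_of_rows_list_def numeral_2_eq_2 less_Suc_eq star_e)
  qed (use Y in \<open>auto simp: mat_of_rows_list_def\<close>)
  have "mat_of_rows_list 2 [[1 *\<^sub>R e, e], [star e, 1 *\<^sub>R e]] \<in> pos_mats 2"
    unfolding pos_mats_def YY[symmetric] using Y by blast
  moreover have "mat_of_rows_list 2 [[1 *\<^sub>R e, e], [star e, 1 *\<^sub>R e]] \<in> sa_mats 2 W"
    unfolding sa_mats_def mats_over_def
    by (auto simp: mat_of_rows_list_def numeral_2_eq_2 less_Suc_eq e_in star_e intro!: eq_matI)
  ultimately show ?thesis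
    unfolding norm_eq_Inf[OF e_in]
    by (intro cInf_lower) (auto simp: pos_mats_of_def intro: bdd_belowI[of _ 0])
qed

text \<open>The element \<open>2e - e\<^sup>2 = 1 - (1 - e)\<^sup>2\<close> has norm at most \<open>1\<close>, so it lies below \<open>e\<close>.\<close>

lemma e_e: "e * e = e"
proof -
  obtain d where d: "nonneg d" "d * d = e" using nonneg_sqrt[OF nonneg_e] by blast
  have sd: "star d = d" by (rule nonneg_selfadjoint[OF d(1)])
  have "nonneg (star d * d - star d * e * d)"
    by (rule nonneg_contraction[OF star_e norm_e_le])
  moreover have "star d * e * d = e * e" by (simp add: sd mult.assoc flip: d(2))
  ultimately have ge: "nonneg (e - e * e)" by (simp add: sd d(2))
  have ee: "e * e \<in> W"
    by (rule order_idealD[OF _ ge nonneg_e e_in]) (rule nonneg_square[OF star_e])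
  define v where "v = e + (e - e * e)"
  have v: "v \<in> W" "star v = v"
    using e_in ee star_e by (auto simp: v_def star_simps intro!: W_closed)
  have "nonneg v" unfolding v_def by (rule nonneg_add[OF nonneg_e ge])
  then obtain f where f: "nonneg f" "f * f = v" "\<And>z. v * z = z * v \<Longrightarrow> f * z = z * f"
    using nonneg_sqrt by blast
  have sf: "star f = f" by (rule nonneg_selfadjoint[OF f(1)])
  have fe: "f * e = e * f" by (rule f(3)) (simp add: v_def algebra_simps)
  have "norm (f * x) \<le> norm x" for x
  proof -
    \<comment> \<open>Since \<open>f^2 = v = 1 - (1 - e)^2\<close>, the pair \<open>f\<close>,
      \<open>1 - e\<close> has squares adding up to 1, and it commutes.\<close>
    define X Y where "X = f * x" and "Y = x - e * x"
    have "star X * Y = star Y * X"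
      using arg_cong[OF fe, of "\<lambda>u. u * x"]
      by (simp add: X_def Y_def star_simps sf star_e algebra_simps)
    then have "(norm X)\<^sup>2 \<le> norm (star X * X + star Y * Y)"
      by (rule norm_le_sum_of_squares)
    also have "star X * X + star Y * Y = star x * (f * f) * x + star x * (x - (e + (e - e * e)) * x)"
      by (simp add: X_def Y_def star_simps sf star_e algebra_simps)
    also have "\<dots> = star x * x" by (simp add: f(2) v_def algebra_simps)
    finally have "(norm X)\<^sup>2 \<le> (norm x)\<^sup>2" by (simp add: cstar_identity)
    then show ?thesis by (simp add: X_def power2_le_iff_abs_le)
  qed
  then have "mult_bound 0 f 1" by (simp add: mult_bound_def)
  then have "norm f \<le> 1" by (rule mult_bound_norm_le) simp
  then have "norm v \<le> 1"
    using cstar_identity[of f] sf f(2) by (simp add: power_le_one)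
  then have "nonneg (e - v)" by (rule le_e[OF v])
  then have "nonneg (- (e - e * e))" by (simp add: v_def)
  then have "e - e * e = 0" by (rule nonneg_antisym[OF ge])
  then show ?thesis by simp
qed

text \<open>Compression by \<open>1 - e\<close> kills \<open>e\<close>, so it turns
  \<open>k e - v\<close> into minus the compression of \<open>v\<close>, which is
  \<open>- (star w * w)\<close> for \<open>w = d (1 - e)\<close>. As a compression of a positive
  element it is positive, so \<open>w = 0\<close> by \<open>nonneg_neg_star_mult\<close>.\<close>

lemma nonneg_mult_e:
  assumes v: "nonneg v" "nonneg (k *\<^sub>R e - v)"
  shows "v * e = v" "e * v = v"
proof -
  obtain d where d: "nonneg d" "d * d = v" using nonneg_sqrt[OF v(1)] by blast
  have sd: "star d = d" by (rule nonneg_selfadjoint[OF d(1)])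
  define w where "w = d - d * e"
  have ww: "star w * w = v - v * e - e * v + e * v * e"
    by (simp add: w_def star_simps sd star_e algebra_simps flip: d(2))
  obtain c where c: "nonneg c" "c * c = k *\<^sub>R e - v" using nonneg_sqrt[OF v(2)] by blast
  have sc: "star c = c" by (rule nonneg_selfadjoint[OF c(1)])
  have "star (c - c * e) * (c - c * e)
      = c * c - (c * c) * e - e * (c * c) + e * (c * c) * e"
    by (simp add: star_simps sc star_e algebra_simps)
  also have "\<dots> = - (star w * w)"
    unfolding ww c(2) by (simp add: algebra_simps e_e)
  finally have "nonneg (- (star w * w))" by (metis nonneg_star_mult)
  then have "w = 0" by (rule nonneg_neg_star_mult)
  then have de: "d * e = d" by (simp add: w_def)
  then have ed: "e * d = d" using sd star_e by (metis star_mult)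
  show "v * e = v" "e * v = v"
    unfolding d(2)[symmetric] using de ed by (simp_all add: mult.assoc) (simp flip: mult.assoc)
qed

lemma selfadjoint_mult_e:
  assumes v: "v \<in> W" "star v = v"
  shows "v * e = v" "e * v = v"
proof -
  obtain k where k: "k > 0" "nonneg (k *\<^sub>R e - - v)"
    using order_unitD[of "- v"] v W_closed(3) by auto
  obtain l where l: "l > 0" "nonneg (l *\<^sub>R e - v)"
    using order_unitD v by auto
  \<comment> \<open>Shifting by \<open>k e\<close> turns \<open>v\<close> into an element between 0
    and a multiple of \<open>e\<close>.\<close>
  have "nonneg ((k + l) *\<^sub>R e - (k *\<^sub>R e + v))" using l(2) by (simp add: algebra_simps)
  from nonneg_mult_e[OF _ this] k(2)
  show "v * e = v" "e * v = v" by (simp_all add: algebra_simps e_e)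
qed

lemma mult_e:
  assumes "x \<in> W"
  shows "x * e = x" "e * x = x"
proof -
  obtain u v where uv: "star u = u" "star v = v" "x = u + \<i> *\<^sub>C v"
      "u = (1/2) *\<^sub>R (x + star x)" "v = (1/2) *\<^sub>R (\<i> *\<^sub>C (star x - x))"
    by (rule real_imaginary_parts)
  have "u \<in> W" "v \<in> W" using assms unfolding uv(4,5) by (intro W_closed; assumption)+
  then show "x * e = x" "e * x = x"
    unfolding uv(3) using uv(1,2)
    by (simp_all only: distrib_left distrib_right mult_scaleC_left mult_scaleC_right selfadjoint_mult_e)
qed

text \<open>From \<open>- e <= e a e <= e\<close>: the order ideal property concerns positive
  elements only, so it is applied to \<open>e + e a e\<close>, which lies between 0 and
  \<open>2 e\<close>.\<close>

lemma contraction_corner_in: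
  assumes a: "star a = a" "norm a \<le> 1"
  shows "e * a * e \<in> W"
proof -
  have 1: "nonneg (e - e * a * e)" using nonneg_contraction[OF a, of e] by (simp add: star_e e_e)
  have "nonneg (star e * e - star e * (- a) * e)" by (rule nonneg_contraction) (simp_all add: a)
  then have 2: "nonneg (e + e * a * e)" by (simp add: star_e e_e)
  have "e + e * a * e \<in> W"
  proof (rule order_idealD[OF 2])
    show "nonneg (2 *\<^sub>R e - (e + e * a * e))" using 1 by (simp add: scaleR_2)
    show "nonneg (2 *\<^sub>R e)" by (intro nonneg_scaleR nonneg_e) simp
  qed (intro W_closed e_in)
  then have "e + e * a * e - e \<in> W" by (rule W_closed(2)[OF _ e_in])
  then show ?thesis by simp
qed

lemma selfadjoint_corner_in:
  assumes "star a = a"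
  shows "e * a * e \<in> W"
proof -
  define r where "r = norm a + 1"
  have r: "r > 0" by (simp add: r_def add_nonneg_pos)
  have "e * ((1 / r) *\<^sub>R a) * e \<in> W"
    by (rule contraction_corner_in) (use assms r in \<open>simp_all add: r_def divide_le_eq\<close>)
  then have "r *\<^sub>R (e * ((1 / r) *\<^sub>R a) * e) \<in> W" by (rule W_closed)
  then show ?thesis using r by simp
qed

lemma corner_in: "e * a * e \<in> W"
proof -
  obtain u v where uv: "star u = u" "star v = v" "a = u + \<i> *\<^sub>C v"
    by (rule real_imaginary_parts)
  have "e * u * e + \<i> *\<^sub>C (e * v * e) \<in> W"
    by (intro W_closed selfadjoint_corner_in uv)
  then show ?thesis
    by (simp add: uv(3) distrib_left distrib_right mult_scaleC_left mult_scaleC_right)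
qed

text \<open>So \<open>W\<close> is the corner of \<open>e\<close>. As the solution set of a
  continuous equation it is closed, and products stay in it.\<close>

lemma in_W_iff: "x \<in> W \<longleftrightarrow> e * x * e = x"
  using corner_in[of x] mult_e[of x] by metis

lemma unital_hereditary: "cstar_subalgebra W \<and> hereditary W \<and> has_own_identity W"
proof (intro conjI)
  have "x * y \<in> W" if "x \<in> W" "y \<in> W" for x y
    using mult_e(2)[OF that(1)] mult_e(1)[OF that(2)] by (simp add: in_W_iff mult.assoc) (simp flip: mult.assoc)
  moreover have "W = {x. e * x * e = x}" using in_W_iff by blast
  then have "closed W"
    by (simp only:) (intro closed_Collect_eq continuous_intros)
  ultimately show "cstar_subalgebra W"
    using subspace selfadjoint by (simp add: cstar_subalgebra_def)
  show "hereditary W"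
    using moui by (auto simp: hereditary_def matrix_order_unit_ideal_def matrix_order_ideal_def pos_of_def)
  show "has_own_identity W" unfolding has_own_identity_def using e_in mult_e by blast
qed

end

theorem mainTheorem2:
  fixes W :: "'a::cstar_algebra set"
  assumes "csubspace W"
  shows "(\<exists>e\<in>pos_of W. matrix_order_unit_ideal W e) \<longleftrightarrow>
         cstar_subalgebra W \<and> hereditary W \<and> has_own_identity W"
proof
  assume "\<exists>e\<in>pos_of W. matrix_order_unit_ideal W e"
  then obtain e where "matrix_order_unit_ideal W e" by blast
  then interpret order_unit_ideal W e by unfold_locales
  show "cstar_subalgebra W \<and> hereditary W \<and> has_own_identity W" by (rule unital_hereditary)
qed (use matrix_order_unit_ideal_if_unital_hereditary in blast)

end
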